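(* Let $p>1$, $\epsilon>0$, and set $C_\epsilon=\Big(1-\big(\tfrac{1}{1+\epsilon}\big)^{\frac{1}{p-1}}\Big)^{1-p}$. Assume that Hypotheses (C1) and (C2) (stated in the context) are satisfied and that $$\mathbb E\exp\Big[\Big(\frac{2p-1}{p-1}+(p-1)\,C_r^{\left(\frac{p}{p-1}\right)^2}\Big)A_T\Big]<\infty .$$ Suppose also that there exists $\beta$ such that $$\beta>1+\frac{C_\epsilon}{1+\epsilon}+(p-1)\big((C_r+1)^p(1+\epsilon)\big)^{\frac1{p-1}},\qquad \mathbb E\exp(\beta A_T)<\infty,\qquad \mathbb E\big[|g(X_T)|^pe^{\beta A_T}\big]<\infty .$$ Let $(Y,Z)\in L^p_\beta$ denote the solution of the BSDE $$Y_t+\int_t^T\!\!\int_K Z(s,x)\,\mu(ds,dx)=g(X_T)+\int_t^T f(s,X_s,Z_s(\cdot))\,dA_s,\qquad t\in[0,T],$$ where $f$ is the Hamiltonian function, and let $u^*=\underline u^Z$ be the corresponding admissible control provided by Hypothesis (C2). Then $u^*(\cdot)$ is optimal, and $Y_0=J(u^*(\cdot))=\inf_{u(\cdot)\in\mathcal A}J(u(\cdot))$ is the optimal cost.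
   Context: Setting. $T\in(0,\infty)$, $(\Omega,\mathcal F,\mathbb P)$ is a complete probability space, $(K,\mathcal K)$ is a Lusin space. $(S_n,X_n)_{n\ge1}$ is a non-explosive marked point process: $S_n$ takes values in $(0,T]\cup\{\infty\}$, $X_n$ takes values in $K$, $S_0=0$, $S_1>0$ a.s., $S_n\le S_{n+1}$ everywhere, $S_n<S_{n+1}$ if $S_n\le T$, and $\Omega=\bigcup_n\{S_n>T\}$; $X_n=\Delta$ when $S_n=\infty$, for a distinguished point $\Delta\in K$. Set $\mu(dt,dx)=\sum_{n\ge1:\,S_n\le T}\delta_{(S_n,X_n)}(dt,dx)$ (sum of Dirac masses). $(\mathcal F_t)_{t\ge0}$ is the smallest filtration for which each $S_n$ is a stopping time and $X_n$ is $\mathcal F_{S_n}$-measurable. $\mathcal P$ is the predictable $\sigma$-field on $\Omega\times[0,T]$; for a measurable space $(G,\mathcal G)$, a function on $\Omega\times[0,T]\times G$ is called predictable if it is $\mathcal P\otimes\mathcal G$-measurable. $\nu$ is the predictable compensator of $\mu$ relative to $(\mathcal F_t)$; it disintegrates as $\nu(\omega,dt,dx)=dA_t(\omega)\,\phi_{\omega,t}(dx)$, where $A$ is the predictable increasing càdlàg process with $A_0=0$ compensating $N_t=\mu([0,t]\times K)$, and $\phi$ is a transition probability from $(\Omega\times[0,T],\mathcal P)$ into $(K,\mathcal K)$. Standing assumption: $A$ is continuous (equivalently, the $S_n$ are totally inaccessible). The associated piecewise constant process is $X_t=X_n$ for $S_n\le t<S_{n+1}$, $t\in[0,T]$, $n\ge0$,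 where $X_0=\Delta$; $X_{t-}$ denotes its left limit. Integrals $\int_t^T$ are over $(t,T]$. $\mathcal B(K)$ is the set of Borel functions on $K$; for $Z$ on $\Omega\times[0,T]\times K$, $Z_{\omega,t}(x)=Z(\omega,t,x)$, abbreviated $Z_t$ or $Z_t(\cdot)$. Hypothesis (C1). (1) $(U,\mathcal U)$ is a measurable space. (2) $r,l:\Omega\times[0,T]\times K\times U\to\mathbb R$ are predictable and there are constants $C_r>1$, $C_l>0$ with $0\le r(\omega,t,x,u)\le C_r$ and $|l(\omega,t,x,u)|\le C_l$ for all $\omega,t,x,u$. (3) $g:\Omega\times K\to\mathbb R$ is $\mathcal F_T\otimes\mathcal K$-measurable. Admissible controls. $\mathcal A$ is the set of predictable $U$-valued processes $(u_t)_{t\in[0,T]}$. For $u(\cdot)\in\mathcal A$ put $$L_t=\exp\Big(\int_0^t\!\!\int_K(1-r(s,x,u_s))\,\nu(ds,dx)\Big)\prod_{n\ge1:\,S_n\le t}r(S_n,X_n,u_{S_n}),\qquad t\in[0,T]$$ (empty product $=1$), and let $\mathbb P_u$ be the measure $\mathbb P_u(d\omega)=L_T(\omega)\,\mathbb P(d\omega)$. Under the exponential integrability assumption of the theorem, $\mathbb P_u$ is a probability, and under it $\mu$ has compensator $r(t,x,u_t)\,\nu(dt,dx)$. With $\mathbb E_u$ the expectation under $\mathbb P_u$, the cost of $u(\cdot)$ is $$J(u(\cdot))=\mathbb E_u\Big(\int_0^Tl(t,X_t,u_t)\,dA_t+g(X_T)\Big),$$ and the control problem is to minimize $J$ over $\mathcal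 A$. Hamiltonian. For $\omega\in\Omega$, $t\in[0,T]$, $x\in K$, $\zeta\in\mathcal B(K)$, $$f(\omega,t,x,\zeta)=\inf_{u\in U}\Big(l(\omega,t,x,u)+\int_K\zeta(v)\,r(\omega,t,v,u)\,\phi_{\omega,t}(dv)\Big)\quad\text{if }\int_K|\zeta(v)|\,\phi_{\omega,t}(dv)<\infty,$$ and $f(\omega,t,x,\zeta)=0$ otherwise. Hypothesis (C2). For every predictable function $Z$ on $\Omega\times[0,T]\times K$ there exists a $U$-valued predictable process (i.e. an admissible control) $\underline u^Z$ such that, $dA_t(\omega)\mathbb P(d\omega)$-almost surely, $$f(\omega,t,X_{t-}(\omega),Z_{\omega,t}(\cdot))=l(\omega,t,X_{t-}(\omega),\underline u^Z(\omega,t))+\int_KZ_{\omega,t}(v)\,r(\omega,t,v,\underline u^Z(\omega,t))\,\phi_{\omega,t}(dv).$$ $L^p_\beta$ ($\beta>0$) is the Banach space of equivalence classes of pairs $(Y,Z)$ on $[0,T]$ with $Y$ progressive, $Z$ predictable and $\mathbb E\int_0^T\int_K(|Y_s|^p+|Z(s,x)|^p)e^{\beta A_s}\,\nu(ds,dx)<\infty$, identified when they agree $\mathbb P(d\omega)\,\nu(\omega,dt,dx)$-a.e. A solution of the BSDE is a pair $(Y,Z)$ with $Y$ real-valued adapted càdlàg and $Z$ predictable on $\Omega\times[0,T]\times K$ with $\int_0^T\int_K|Z(s,x)|\,\nu(ds,dx)<\infty$ a.s., satisfying the equation for all $t\in[0,T]$ outside a $\mathbb P$-null set. Under the assumptions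 of the theorem the BSDE has a unique solution in $L^p_\beta$. *)

theory Defs
  imports "HOL-Probability.Probability"
begin

section \<open>Measure-theoretic preliminaries\<close>

text \<open>Bourbaki's notion: a Hausdorff space that is a continuous bijective image of a Polish space;
  transporting the Polish topology along the bijection, one may take the same underlying set.\<close>

definition lusin_space :: "'k topology \<Rightarrow> bool" where
  "lusin_space X \<longleftrightarrow> Hausdorff_space X \<and>
     (\<exists>P. topspace P = topspace X \<and> completely_metrizable_space P \<and> second_countable P \<and>
          continuous_map P X id)"

abbreviation time_space :: "real \<Rightarrow> real measure" where
  "time_space T \<equiv> restrict_space borel {0..T}"

text \<open>The measure \<open>M(dx) \<kappa>(x, dy)\<close>. The kernel \<open>\<kappa>\<close> need not consist of probability measures,
  so the monadic bind of the Giry monad is not available.\<close>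

definition kernel_product :: "'a measure \<Rightarrow> 'b measure \<Rightarrow> ('a \<Rightarrow> 'b measure) \<Rightarrow> ('a \<times> 'b) measure" where
  "kernel_product M N \<kappa> = measure_of (space (M \<Otimes>\<^sub>M N)) (sets (M \<Otimes>\<^sub>M N))
     (\<lambda>B. \<integral>\<^sup>+x. emeasure (\<kappa> x) (Pair x -` B) \<partial>M)"

lemma sets_kernel_product [simp, measurable_cong]: "sets (kernel_product M N \<kappa>) = sets (M \<Otimes>\<^sub>M N)"
  unfolding kernel_product_def by (simp add: sets.sets_measure_of_eq)

lemma space_kernel_product [simp]: "space (kernel_product M N \<kappa>) = space M \<times> space N"
  using sets_eq_imp_space_eq[OF sets_kernel_product, of M N \<kappa>] by (simp add: space_pair_measure)

lemma emeasure_kernel_product: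
  assumes \<kappa>: "\<And>x. x \<in> space M \<Longrightarrow> sets (\<kappa> x) = sets N"
    and meas: "\<And>B. B \<in> sets (M \<Otimes>\<^sub>M N) \<Longrightarrow>
      (\<lambda>x. emeasure (\<kappa> x) (Pair x -` B)) \<in> borel_measurable M"
    and B: "B \<in> sets (M \<Otimes>\<^sub>M N)"
  shows "emeasure (kernel_product M N \<kappa>) B = (\<integral>\<^sup>+x. emeasure (\<kappa> x) (Pair x -` B) \<partial>M)"
proof (rule emeasure_measure_of[OF kernel_product_def _ _ _ ])
  show "sets (M \<Otimes>\<^sub>M N) \<subseteq> Pow (space (M \<Otimes>\<^sub>M N))"
    by (rule sets.space_closed)
  show "B \<in> sets (kernel_product M N \<kappa>)"
    using B by simp
  show "positive (sets (kernel_product M N \<kappa>))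
     (\<lambda>B. \<integral>\<^sup>+x. emeasure (\<kappa> x) (Pair x -` B) \<partial>M)"
    by (simp add: positive_def)
  show "countably_additive (sets (kernel_product M N \<kappa>))
     (\<lambda>B. \<integral>\<^sup>+x. emeasure (\<kappa> x) (Pair x -` B) \<partial>M)"
  proof (rule countably_additiveI)
    fix D :: "nat \<Rightarrow> ('a \<times> 'b) set"
    assume D: "range D \<subseteq> sets (kernel_product M N \<kappa>)" "disjoint_family D"
    have "(\<Sum>i. \<integral>\<^sup>+x. emeasure (\<kappa> x) (Pair x -` D i) \<partial>M)
        = (\<integral>\<^sup>+x. (\<Sum>i. emeasure (\<kappa> x) (Pair x -` D i)) \<partial>M)"
      using D by (intro nn_integral_suminf[symmetric] meas) auto
    also have "\<dots> = (\<integral>\<^sup>+x. emeasure (\<kappa> x) (Pair x -` (\<Union>i. D i)) \<partial>M)"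
    proof (rule nn_integral_cong)
      fix x assume x: "x \<in> space M"
      have "range (\<lambda>i. Pair x -` D i) \<subseteq> sets (\<kappa> x)"
        using D \<kappa>[OF x] by (auto intro!: sets_Pair1)
      moreover have "disjoint_family (\<lambda>i. Pair x -` D i)"
        using D(2) by (auto simp: disjoint_family_on_def)
      ultimately show "(\<Sum>i. emeasure (\<kappa> x) (Pair x -` D i)) = emeasure (\<kappa> x) (Pair x -` (\<Union>i. D i))"
        by (subst suminf_emeasure) (auto simp: vimage_UN)
    qed
    finally show "(\<Sum>i. \<integral>\<^sup>+x. emeasure (\<kappa> x) (Pair x -` D i) \<partial>M)
        = (\<integral>\<^sup>+x. emeasure (\<kappa> x) (Pair x -` (\<Union>i. D i)) \<partial>M)" .
  qed
qed

text \<open>The Lebesgue--Stieltjes measure on \<open>[0, T]\<close> of an increasing right-continuous function on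
  \<open>[0, T]\<close>. The function is extended by constants outside \<open>[0, T]\<close>, so there is no mass at \<open>0\<close>.\<close>

definition stieltjes :: "real \<Rightarrow> (real \<Rightarrow> real) \<Rightarrow> real measure" where
  "stieltjes T a = restrict_space (interval_measure (\<lambda>t. a (max 0 (min T t)))) {0..T}"

definition cadlag_on :: "real \<Rightarrow> (real \<Rightarrow> real) \<Rightarrow> bool" where
  "cadlag_on T y \<longleftrightarrow> (\<forall>t\<in>{0..<T}. continuous (at_right t) y) \<and>
     (\<forall>t\<in>{0<..T}. \<exists>c. (y \<longlongrightarrow> c) (at_left t))"


section \<open>Processes and marked point processes\<close>

text \<open>Filtrations are indexed by \<open>[0, \<infinity>]\<close>, so that the library's stopping times may take the
  value \<open>\<infinity>\<close>. Stochastic processes on \<open>[0, T]\<close> are curried functions of \<open>\<omega>\<close> and of a real time.\<close>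

definition mpp_adapted ::
    "'a set \<Rightarrow> (nat \<Rightarrow> 'a \<Rightarrow> ennreal) \<Rightarrow> (nat \<Rightarrow> 'a \<Rightarrow> 'k::topological_space) \<Rightarrow> (ennreal \<Rightarrow> 'a measure) \<Rightarrow> bool" where
  "mpp_adapted \<Omega> S X G \<longleftrightarrow> filtration \<Omega> G \<and>
     (\<forall>n\<ge>1. stopping_time G (S n) \<and> X n \<in> filtration.pre_sigma \<Omega> G (S n) \<rightarrow>\<^sub>M borel)"

definition mpp_filtration ::
    "'a set \<Rightarrow> (nat \<Rightarrow> 'a \<Rightarrow> ennreal) \<Rightarrow> (nat \<Rightarrow> 'a \<Rightarrow> 'k::topological_space) \<Rightarrow> (ennreal \<Rightarrow> 'a measure) \<Rightarrow> bool" where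
  "mpp_filtration \<Omega> S X F \<longleftrightarrow> mpp_adapted \<Omega> S X F \<and>
     (\<forall>G. mpp_adapted \<Omega> S X G \<longrightarrow> (\<forall>t. sets (F t) \<subseteq> sets (G t)))"

definition predictable_sigma :: "'a set \<Rightarrow> (ennreal \<Rightarrow> 'a measure) \<Rightarrow> real \<Rightarrow> ('a \<times> real) measure" where
  "predictable_sigma \<Omega> F T = sigma (\<Omega> \<times> {0..T})
     ({B \<times> {0} | B. B \<in> sets (F 0)} \<union>
      {B \<times> {s<..t} | B s t. 0 \<le> s \<and> s \<le> t \<and> t \<le> T \<and> B \<in> sets (F (ennreal s))})"

definition adapted :: "(ennreal \<Rightarrow> 'a measure) \<Rightarrow> real \<Rightarrow> ('a \<Rightarrow> real \<Rightarrow> real) \<Rightarrow> bool" where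
  "adapted F T Y \<longleftrightarrow> (\<forall>t\<in>{0..T}. (\<lambda>\<omega>. Y \<omega> t) \<in> borel_measurable (F (ennreal t)))"

definition progressive :: "(ennreal \<Rightarrow> 'a measure) \<Rightarrow> real \<Rightarrow> ('a \<Rightarrow> real \<Rightarrow> real) \<Rightarrow> bool" where
  "progressive F T Y \<longleftrightarrow>
     (\<forall>t\<in>{0..T}. (\<lambda>(\<omega>, s). Y \<omega> s) \<in> borel_measurable (F (ennreal t) \<Otimes>\<^sub>M time_space t))"

definition predictable_fun ::
    "'a set \<Rightarrow> (ennreal \<Rightarrow> 'a measure) \<Rightarrow> real \<Rightarrow> ('a \<Rightarrow> real \<Rightarrow> 'k::topological_space \<Rightarrow> real) \<Rightarrow> bool" where
  "predictable_fun \<Omega> F T Z \<longleftrightarrow>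
     (\<lambda>((\<omega>, t), x). Z \<omega> t x) \<in> borel_measurable (predictable_sigma \<Omega> F T \<Otimes>\<^sub>M borel)"

text \<open>Image of the counting measure on the indices, i.e. the sum of the Dirac masses at
  \<open>(S n, X n)\<close> over \<open>n \<ge> 1\<close> with \<open>S n \<le> T\<close>.\<close>

definition jump_measure ::
    "real \<Rightarrow> (nat \<Rightarrow> 'a \<Rightarrow> ennreal) \<Rightarrow> (nat \<Rightarrow> 'a \<Rightarrow> 'k::topological_space) \<Rightarrow> 'a \<Rightarrow> (real \<times> 'k) measure" where
  "jump_measure T S X \<omega> = distr (count_space {n. 1 \<le> n \<and> S n \<omega> \<le> ennreal T})
     (time_space T \<Otimes>\<^sub>M borel) (\<lambda>n. (enn2real (S n \<omega>), X n \<omega>))"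

text \<open>\<open>\<nu>(\<omega>, dt, dx) = dA\<^sub>t(\<omega>) \<phi>\<^sub>\<omega>\<^sub>,\<^sub>t(dx)\<close>.\<close>

definition compensator ::
    "real \<Rightarrow> ('a \<Rightarrow> real \<Rightarrow> real) \<Rightarrow> ('a \<Rightarrow> real \<Rightarrow> 'k::topological_space measure) \<Rightarrow> 'a \<Rightarrow> (real \<times> 'k) measure" where
  "compensator T A \<phi> \<omega> = kernel_product (stieltjes T (A \<omega>)) borel (\<phi> \<omega>)"

definition pc_process ::
    "(nat \<Rightarrow> 'a \<Rightarrow> ennreal) \<Rightarrow> (nat \<Rightarrow> 'a \<Rightarrow> 'k) \<Rightarrow> 'a \<Rightarrow> real \<Rightarrow> 'k" where
  "pc_process S X \<omega> t = X (THE n. S n \<omega> \<le> ennreal t \<and> ennreal t < S (Suc n) \<omega>) \<omega>"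

definition pc_left ::
    "(nat \<Rightarrow> 'a \<Rightarrow> ennreal) \<Rightarrow> (nat \<Rightarrow> 'a \<Rightarrow> 'k::t2_space) \<Rightarrow> 'a \<Rightarrow> real \<Rightarrow> 'k" where
  "pc_left S X \<omega> t = Lim (at_left t) (pc_process S X \<omega>)"

text \<open>The space \<open>(K, \<K>)\<close> of marks is the type \<open>'k\<close> with its Borel sets. The condition
  \<open>S 1 > 0\<close> is part of \<open>S_range\<close>. The last assumption characterises \<open>\<nu>\<close> as the predictable
  compensator of \<open>\<mu>\<close>; its predictability comes from that of \<open>A\<close> and \<open>\<phi>\<close>, and integrands not
  depending on the mark show that \<open>A\<close> compensates \<open>N\<^sub>t = \<mu>([0, t] \<times> K)\<close>.\<close>

locale marked_point_process = prob_space M + complete_measure M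
  for M :: "'a measure" +
  fixes T :: real
    and S :: "nat \<Rightarrow> 'a \<Rightarrow> ennreal"
    and X :: "nat \<Rightarrow> 'a \<Rightarrow> 'k::t2_space"
    and \<Delta> :: 'k
    and F :: "ennreal \<Rightarrow> 'a measure"
    and A :: "'a \<Rightarrow> real \<Rightarrow> real"
    and \<phi> :: "'a \<Rightarrow> real \<Rightarrow> 'k measure"
  assumes T_pos: "0 < T"
    and lusin: "lusin_space (euclidean :: 'k topology)"
    and S_measurable: "\<And>n. S n \<in> borel_measurable M"
    and X_measurable: "\<And>n. X n \<in> M \<rightarrow>\<^sub>M borel"
    and S_0: "\<And>\<omega>. \<omega> \<in> space M \<Longrightarrow> S 0 \<omega> = 0"
    and X_0: "\<And>\<omega>. \<omega> \<in> space M \<Longrightarrow> X 0 \<omega> = \<Delta>"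
    and S_range: "\<And>n \<omega>. \<omega> \<in> space M \<Longrightarrow> 1 \<le> n \<Longrightarrow> S n \<omega> \<in> {0<..ennreal T} \<union> {\<infinity>}"
    and S_mono: "\<And>n \<omega>. \<omega> \<in> space M \<Longrightarrow> S n \<omega> \<le> S (Suc n) \<omega>"
    and S_strict: "\<And>n \<omega>. \<omega> \<in> space M \<Longrightarrow> S n \<omega> \<le> ennreal T \<Longrightarrow> S n \<omega> < S (Suc n) \<omega>"
    and non_explosive: "\<And>\<omega>. \<omega> \<in> space M \<Longrightarrow> \<exists>n. ennreal T < S n \<omega>"
    and X_infinity: "\<And>n \<omega>. \<omega> \<in> space M \<Longrightarrow> S n \<omega> = \<infinity> \<Longrightarrow> X n \<omega> = \<Delta>"
    and F_filtration: "mpp_filtration (space M) S X F"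
    and A_predictable: "(\<lambda>(\<omega>, t). A \<omega> t) \<in> borel_measurable (predictable_sigma (space M) F T)"
    and A_0: "\<And>\<omega>. \<omega> \<in> space M \<Longrightarrow> A \<omega> 0 = 0"
    and A_mono: "\<And>\<omega>. \<omega> \<in> space M \<Longrightarrow> mono_on {0..T} (A \<omega>)"
    and A_continuous: "\<And>\<omega>. \<omega> \<in> space M \<Longrightarrow> continuous_on {0..T} (A \<omega>)"
    and \<phi>_kernel: "(\<lambda>(\<omega>, t). \<phi> \<omega> t) \<in> predictable_sigma (space M) F T \<rightarrow>\<^sub>M prob_algebra borel"
    and compensation: "\<And>H :: 'a \<Rightarrow> real \<Rightarrow> 'k \<Rightarrow> ennreal.
      (\<lambda>((\<omega>, t), x). H \<omega> t x) \<in> borel_measurable (predictable_sigma (space M) F T \<Otimes>\<^sub>M borel) \<Longrightarrow>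
      (\<integral>\<^sup>+\<omega>. (\<integral>\<^sup>+(t, x). H \<omega> t x \<partial>jump_measure T S X \<omega>) \<partial>M) =
      (\<integral>\<^sup>+\<omega>. (\<integral>\<^sup>+(t, x). H \<omega> t x \<partial>compensator T A \<phi> \<omega>) \<partial>M)"


section \<open>The control problem\<close>

definition hypothesis_C1 ::
    "'a set \<Rightarrow> (ennreal \<Rightarrow> 'a measure) \<Rightarrow> real \<Rightarrow> 'u measure \<Rightarrow>
     ('a \<Rightarrow> real \<Rightarrow> 'k::topological_space \<Rightarrow> 'u \<Rightarrow> real) \<Rightarrow> ('a \<Rightarrow> real \<Rightarrow> 'k \<Rightarrow> 'u \<Rightarrow> real) \<Rightarrow>
     ('a \<Rightarrow> 'k \<Rightarrow> real) \<Rightarrow> real \<Rightarrow> real \<Rightarrow> bool" where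
  "hypothesis_C1 \<Omega> F T U r l g C\<^sub>r C\<^sub>l \<longleftrightarrow>
     (\<lambda>((\<omega>, t), (x, u)). r \<omega> t x u) \<in> borel_measurable (predictable_sigma \<Omega> F T \<Otimes>\<^sub>M (borel \<Otimes>\<^sub>M U)) \<and>
     (\<lambda>((\<omega>, t), (x, u)). l \<omega> t x u) \<in> borel_measurable (predictable_sigma \<Omega> F T \<Otimes>\<^sub>M (borel \<Otimes>\<^sub>M U)) \<and>
     1 < C\<^sub>r \<and> 0 < C\<^sub>l \<and>
     (\<forall>\<omega>\<in>\<Omega>. \<forall>t\<in>{0..T}. \<forall>x. \<forall>u\<in>space U. 0 \<le> r \<omega> t x u \<and> r \<omega> t x u \<le> C\<^sub>r \<and> \<bar>l \<omega> t x u\<bar> \<le> C\<^sub>l) \<and>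
     (\<lambda>(\<omega>, x). g \<omega> x) \<in> borel_measurable (F (ennreal T) \<Otimes>\<^sub>M borel)"

definition controls ::
    "'a set \<Rightarrow> (ennreal \<Rightarrow> 'a measure) \<Rightarrow> real \<Rightarrow> 'u measure \<Rightarrow> ('a \<Rightarrow> real \<Rightarrow> 'u) set" where
  "controls \<Omega> F T U = {u. (\<lambda>(\<omega>, t). u \<omega> t) \<in> predictable_sigma \<Omega> F T \<rightarrow>\<^sub>M U}"

definition likelihood ::
    "real \<Rightarrow> (nat \<Rightarrow> 'a \<Rightarrow> ennreal) \<Rightarrow> (nat \<Rightarrow> 'a \<Rightarrow> 'k::topological_space) \<Rightarrow> ('a \<Rightarrow> real \<Rightarrow> real) \<Rightarrow>
     ('a \<Rightarrow> real \<Rightarrow> 'k measure) \<Rightarrow> ('a \<Rightarrow> real \<Rightarrow> 'k \<Rightarrow> 'u \<Rightarrow> real) \<Rightarrow> ('a \<Rightarrow> real \<Rightarrow> 'u) \<Rightarrow>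
     'a \<Rightarrow> real \<Rightarrow> real" where
  "likelihood T S X A \<phi> r u \<omega> t =
     exp (LINT (s, x):{0<..t} \<times> UNIV|compensator T A \<phi> \<omega>. 1 - r \<omega> s x (u \<omega> s)) *
     (\<Prod>n | 1 \<le> n \<and> S n \<omega> \<le> ennreal t.
        r \<omega> (enn2real (S n \<omega>)) (X n \<omega>) (u \<omega> (enn2real (S n \<omega>))))"

definition controlled_measure ::
    "'a measure \<Rightarrow> real \<Rightarrow> (nat \<Rightarrow> 'a \<Rightarrow> ennreal) \<Rightarrow> (nat \<Rightarrow> 'a \<Rightarrow> 'k::topological_space) \<Rightarrow>
     ('a \<Rightarrow> real \<Rightarrow> real) \<Rightarrow> ('a \<Rightarrow> real \<Rightarrow> 'k measure) \<Rightarrow> ('a \<Rightarrow> real \<Rightarrow> 'k \<Rightarrow> 'u \<Rightarrow> real) \<Rightarrow>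
     ('a \<Rightarrow> real \<Rightarrow> 'u) \<Rightarrow> 'a measure" where
  "controlled_measure M T S X A \<phi> r u = density M (\<lambda>\<omega>. ennreal (likelihood T S X A \<phi> r u \<omega> T))"

definition cost ::
    "'a measure \<Rightarrow> real \<Rightarrow> (nat \<Rightarrow> 'a \<Rightarrow> ennreal) \<Rightarrow> (nat \<Rightarrow> 'a \<Rightarrow> 'k::topological_space) \<Rightarrow>
     ('a \<Rightarrow> real \<Rightarrow> real) \<Rightarrow> ('a \<Rightarrow> real \<Rightarrow> 'k measure) \<Rightarrow> ('a \<Rightarrow> real \<Rightarrow> 'k \<Rightarrow> 'u \<Rightarrow> real) \<Rightarrow>
     ('a \<Rightarrow> real \<Rightarrow> 'k \<Rightarrow> 'u \<Rightarrow> real) \<Rightarrow> ('a \<Rightarrow> 'k \<Rightarrow> real) \<Rightarrow> ('a \<Rightarrow> real \<Rightarrow> 'u) \<Rightarrow> real" where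
  "cost M T S X A \<phi> r l g u =
     (LINT \<omega>|controlled_measure M T S X A \<phi> r u.
        (LINT t:{0<..T}|stieltjes T (A \<omega>). l \<omega> t (pc_process S X \<omega> t) (u \<omega> t)) +
        g \<omega> (pc_process S X \<omega> T))"

definition hamiltonian ::
    "'u measure \<Rightarrow> ('a \<Rightarrow> real \<Rightarrow> 'k measure) \<Rightarrow> ('a \<Rightarrow> real \<Rightarrow> 'k \<Rightarrow> 'u \<Rightarrow> real) \<Rightarrow>
     ('a \<Rightarrow> real \<Rightarrow> 'k \<Rightarrow> 'u \<Rightarrow> real) \<Rightarrow> 'a \<Rightarrow> real \<Rightarrow> 'k \<Rightarrow> ('k \<Rightarrow> real) \<Rightarrow> real" where
  "hamiltonian U \<phi> r l \<omega> t x \<zeta> =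
     (if (\<integral>\<^sup>+v. ennreal \<bar>\<zeta> v\<bar> \<partial>\<phi> \<omega> t) < \<infinity>
      then (INF u\<in>space U. l \<omega> t x u + (LINT v|\<phi> \<omega> t. \<zeta> v * r \<omega> t v u))
      else 0)"

text \<open>The control \<open>u\<close> attains the infimum in the Hamiltonian along \<open>Z\<close>, almost everywhere for
  \<open>dA\<^sub>t(\<omega>) P(d\<omega>)\<close>. The equation is only meaningful, and only required, where \<open>Z\<^sub>\<omega>\<^sub>,\<^sub>t\<close> is
  \<open>\<phi>\<^sub>\<omega>\<^sub>,\<^sub>t\<close>-integrable; for the \<open>Z\<close> of a solution of the equation this is almost everywhere.\<close>

definition minimizing_control ::
    "'a measure \<Rightarrow> real \<Rightarrow> (nat \<Rightarrow> 'a \<Rightarrow> ennreal) \<Rightarrow> (nat \<Rightarrow> 'a \<Rightarrow> 'k::t2_space) \<Rightarrow>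
     (ennreal \<Rightarrow> 'a measure) \<Rightarrow> ('a \<Rightarrow> real \<Rightarrow> real) \<Rightarrow> ('a \<Rightarrow> real \<Rightarrow> 'k measure) \<Rightarrow> 'u measure \<Rightarrow>
     ('a \<Rightarrow> real \<Rightarrow> 'k \<Rightarrow> 'u \<Rightarrow> real) \<Rightarrow> ('a \<Rightarrow> real \<Rightarrow> 'k \<Rightarrow> 'u \<Rightarrow> real) \<Rightarrow>
     ('a \<Rightarrow> real \<Rightarrow> 'k \<Rightarrow> real) \<Rightarrow> ('a \<Rightarrow> real \<Rightarrow> 'u) \<Rightarrow> bool" where
  "minimizing_control M T S X F A \<phi> U r l Z u \<longleftrightarrow>
     u \<in> controls (space M) F T U \<and>
     (AE (\<omega>, t) in kernel_product M (time_space T) (\<lambda>\<omega>. stieltjes T (A \<omega>)).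
        (\<integral>\<^sup>+v. ennreal \<bar>Z \<omega> t v\<bar> \<partial>\<phi> \<omega> t) < \<infinity> \<longrightarrow>
        hamiltonian U \<phi> r l \<omega> t (pc_left S X \<omega> t) (Z \<omega> t) =
          l \<omega> t (pc_left S X \<omega> t) (u \<omega> t) +
          (LINT v|\<phi> \<omega> t. Z \<omega> t v * r \<omega> t v (u \<omega> t)))"

definition hypothesis_C2 ::
    "'a measure \<Rightarrow> real \<Rightarrow> (nat \<Rightarrow> 'a \<Rightarrow> ennreal) \<Rightarrow> (nat \<Rightarrow> 'a \<Rightarrow> 'k::t2_space) \<Rightarrow>
     (ennreal \<Rightarrow> 'a measure) \<Rightarrow> ('a \<Rightarrow> real \<Rightarrow> real) \<Rightarrow> ('a \<Rightarrow> real \<Rightarrow> 'k measure) \<Rightarrow> 'u measure \<Rightarrow>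
     ('a \<Rightarrow> real \<Rightarrow> 'k \<Rightarrow> 'u \<Rightarrow> real) \<Rightarrow> ('a \<Rightarrow> real \<Rightarrow> 'k \<Rightarrow> 'u \<Rightarrow> real) \<Rightarrow> bool" where
  "hypothesis_C2 M T S X F A \<phi> U r l \<longleftrightarrow>
     (\<forall>Z. predictable_fun (space M) F T Z \<longrightarrow> (\<exists>u. minimizing_control M T S X F A \<phi> U r l Z u))"


section \<open>The backward equation\<close>

text \<open>Representatives of the elements of \<open>L\<^sup>p\<^sub>\<beta>\<close>; membership is invariant under equality almost
  everywhere for \<open>P(d\<omega>) \<nu>(\<omega>, dt, dx)\<close>.\<close>

definition Lp_space ::
    "'a measure \<Rightarrow> real \<Rightarrow> (ennreal \<Rightarrow> 'a measure) \<Rightarrow> ('a \<Rightarrow> real \<Rightarrow> real) \<Rightarrow>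
     ('a \<Rightarrow> real \<Rightarrow> 'k::topological_space measure) \<Rightarrow> real \<Rightarrow> real \<Rightarrow>
     (('a \<Rightarrow> real \<Rightarrow> real) \<times> ('a \<Rightarrow> real \<Rightarrow> 'k \<Rightarrow> real)) set" where
  "Lp_space M T F A \<phi> p \<beta> = {(Y, Z). progressive F T Y \<and> predictable_fun (space M) F T Z \<and>
     (\<integral>\<^sup>+\<omega>. (\<integral>\<^sup>+(s, x). ennreal ((\<bar>Y \<omega> s\<bar> powr p + \<bar>Z \<omega> s x\<bar> powr p) * exp (\<beta> * A \<omega> s))
        \<partial>compensator T A \<phi> \<omega>) \<partial>M) < \<infinity>}"

text \<open>The integral of the Hamiltonian is taken for the completion of \<open>dA\<close>: as an infimum over a
  possibly uncountable family, the integrand is in general only almost everywhere equal to a Borel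
  function, and the Bochner integral of a non-measurable function is \<open>0\<close> by convention.\<close>

definition bsde_solution ::
    "'a measure \<Rightarrow> real \<Rightarrow> (nat \<Rightarrow> 'a \<Rightarrow> ennreal) \<Rightarrow> (nat \<Rightarrow> 'a \<Rightarrow> 'k::topological_space) \<Rightarrow>
     (ennreal \<Rightarrow> 'a measure) \<Rightarrow> ('a \<Rightarrow> real \<Rightarrow> real) \<Rightarrow> ('a \<Rightarrow> real \<Rightarrow> 'k measure) \<Rightarrow>
     ('a \<Rightarrow> real \<Rightarrow> 'k \<Rightarrow> ('k \<Rightarrow> real) \<Rightarrow> real) \<Rightarrow> ('a \<Rightarrow> 'k \<Rightarrow> real) \<Rightarrow>
     ('a \<Rightarrow> real \<Rightarrow> real) \<Rightarrow> ('a \<Rightarrow> real \<Rightarrow> 'k \<Rightarrow> real) \<Rightarrow> bool" where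
  "bsde_solution M T S X F A \<phi> f g Y Z \<longleftrightarrow>
     adapted F T Y \<and> (\<forall>\<omega>\<in>space M. cadlag_on T (Y \<omega>)) \<and>
     predictable_fun (space M) F T Z \<and>
     (AE \<omega> in M. (\<integral>\<^sup>+(s, x). ennreal \<bar>Z \<omega> s x\<bar> \<partial>compensator T A \<phi> \<omega>) < \<infinity>) \<and>
     (AE \<omega> in M. \<forall>t\<in>{0..T}.
        Y \<omega> t + (LINT (s, x):{t<..T} \<times> UNIV|jump_measure T S X \<omega>. Z \<omega> s x) =
        g \<omega> (pc_process S X \<omega> T) +
        (LINT s:{t<..T}|completion (stieltjes T (A \<omega>)). f \<omega> s (pc_process S X \<omega> s) (Z \<omega> s)))"

end

theory Submission
  imports Defs
begin

text \<open>
  The value \<open>Y 0\<close> of the backward equation is a lower bound for the cost of every control and equals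
  the cost of the minimising one. Fix a control \<open>u\<close>, with density \<open>L\<close> of the controlled measure
  with respect to \<open>P\<close>. If the compensator of the point process under the controlled measure
  is \<open>r \<nu>\<close>, then taking expectations in the backward equation at time \<open>0\<close> replaces the sum of
  the jumps \<open>Z (S n, X n)\<close> by the integral of \<open>Z r\<close> against \<open>\<nu>\<close>, and the cost of \<open>u\<close> becomes \<open>Y 0\<close> plus the
  expectation of the \<open>dA\<close>-integral of
  \<open>l (t, X\<^sub>t, u\<^sub>t) + \<integral> Z\<^sub>t r \<phi>\<^sub>t(dv) - f (t, X\<^sub>t, Z\<^sub>t)\<close>. By definition of the Hamiltonian \<open>f\<close> the
  integrand is nonnegative, and for the minimising control it vanishes (\<open>verification\<close>). Moreover \<open>Y 0\<close> is
  deterministic: as all jump times are positive, the filtration is trivial at time \<open>0\<close>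
  (\<open>sets_F_subset\<close>).

  The work lies in the change of measure, which is obtained in an elementary way.

  \<^item> \<open>A\<close> is continuous, so that the density \<open>L\<close> satisfies path by path the equation
    \<open>dL = L_ (\<integral> (r - 1) d\<mu> - \<integral> (r - 1) d\<nu>)\<close> of a stochastic exponential (\<open>exp_jump_formula\<close>). As \<open>L_\<close>
    is predictable, the compensation formula shows that \<open>L\<close> has expectation \<open>1\<close>
    whenever \<open>\<integral> L_ dA\<close> is integrable (\<open>expectation_jump_density\<close>).

  \<^item> Since \<open>0 \<le> r \<le> C\<^sub>r\<close>, the density is at most \<open>exp (A\<^sub>T) C\<^sub>r^N\<close>, with \<open>N\<close> the number of jumps.
    With \<open>q = p / (p - 1)\<close>, the \<open>q\<close>-th power of this bound is integrable: the stochastic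
    exponentials of constant intensities have expectation at most \<open>1\<close>
    (\<open>jump_moment\<close>), and Young's inequality turns this into the assumed exponential moment of \<open>A\<^sub>T\<close>
    (\<open>jump_exponential_moment\<close>).

  \<^item> Every bounded predictable factor close enough to \<open>r\<close> thus defines a density of
    expectation \<open>1\<close>. Differentiating this identity along the perturbations \<open>r (1 + e H)\<close> at \<open>e = 0\<close>
    gives the compensation formula for \<open>H\<close> under the controlled measure
    (\<open>compensation_under_density_bounded\<close>).

  \<^item> Integrability of \<open>Z\<close> under the controlled measure follows from Young's inequality between the \<open>q\<close>-th
    power of \<open>L\<close> and the norm of \<open>Z\<close> in \<open>L\<^sup>p\<^sub>\<beta>\<close> (\<open>integrable_density_field\<close>).
\<close>


section \<open>Elementary inequalities\<close>

lemma Young_sum: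
  fixes a b p q :: real
  assumes "1 < p" "1 < q" "1 / p + 1 / q = 1" "0 \<le> a" "0 \<le> b"
  shows "a * b \<le> a powr p + b powr q"
proof -
  have "a powr p / p \<le> a powr p" "b powr q / q \<le> b powr q"
    using assms by (simp_all add: divide_le_eq mult_le_cancel_left1 powr_ge_zero)
  then show ?thesis
    using Youngs_inequality[OF assms] by linarith
qed

text \<open>A factor \<open>a\<close> is absorbed by any increase of the exponential rate above \<open>1\<close>. This is where
  the strict inequality \<open>p / (p - 1) > 1\<close> is spent.\<close>

lemma mult_exp_le:
  fixes a \<kappa> :: real
  assumes "1 < \<kappa>" and a: "0 \<le> a"
  shows "a * exp a \<le> 1 / (\<kappa> - 1) * exp (\<kappa> * a)"
proof -
  have "(\<kappa> - 1) * a \<le> exp ((\<kappa> - 1) * a)"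
    using exp_ge_add_one_self[of "(\<kappa> - 1) * a"] by linarith
  then have "a \<le> 1 / (\<kappa> - 1) * exp ((\<kappa> - 1) * a)"
    using assms(1) by (simp add: field_simps)
  then have "a * exp a \<le> 1 / (\<kappa> - 1) * exp ((\<kappa> - 1) * a) * exp a"
    by (rule mult_right_mono) simp
  also have "\<dots> = 1 / (\<kappa> - 1) * exp (\<kappa> * a)"
    by (simp add: exp_add[symmetric] algebra_simps)
  finally show ?thesis .
qed

lemma prod_le_power_card:
  fixes f :: "'i \<Rightarrow> real"
  assumes "finite J" "I \<subseteq> J" "1 \<le> C" "\<And>i. i \<in> I \<Longrightarrow> 0 \<le> f i \<and> f i \<le> C"
  shows "(\<Prod>i\<in>I. f i) \<le> C ^ card J"
proof -
  have "(\<Prod>i\<in>I. f i) \<le> (\<Prod>i\<in>I. C)"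
    using assms(4) by (intro prod_mono) auto
  also have "\<dots> = C ^ card I"
    by simp
  also have "\<dots> \<le> C ^ card J"
    using assms by (intro power_increasing card_mono)
  finally show ?thesis .
qed

text \<open>The product is convex in \<open>e \<ge> 0\<close>, so that on \<open>[0, 1]\<close> it lies below its chord. The bound
  dominates the difference quotients at \<open>e = 0\<close>.\<close>

lemma prod_perturb_bounds:
  fixes h :: "'i \<Rightarrow> real"
  assumes "finite I" "\<And>i. i \<in> I \<Longrightarrow> 0 \<le> h i" "0 \<le> e" "e \<le> 1"
  shows "1 \<le> (\<Prod>i\<in>I. 1 + e * h i) \<and> (\<Prod>i\<in>I. 1 + e * h i) - 1 \<le> e * ((\<Prod>i\<in>I. 1 + h i) - 1)"
  using assms(1,2)
proof (induction I rule: finite_induct)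
  case (insert j I)
  define P Q where "P = (\<Prod>i\<in>I. 1 + e * h i)" and "Q = (\<Prod>i\<in>I. 1 + h i)"
  have IH: "1 \<le> P" "P - 1 \<le> e * (Q - 1)"
    using insert by (auto simp: P_def Q_def)
  have h: "0 \<le> h j" "0 \<le> e * h j"
    using insert.prems[of j] assms(3) by auto
  have "P * (1 + e * h j) - 1 = (P - 1) + e * h j + (P - 1) * (e * h j)"
    by (simp add: algebra_simps)
  also have "(P - 1) * (e * h j) \<le> (e * (Q - 1)) * (e * h j)"
    using IH h by (intro mult_right_mono) auto
  also have "(e * (Q - 1)) * (e * h j) \<le> (e * (Q - 1)) * (1 * h j)"
    using IH h assms(3,4) by (intro mult_left_mono mult_right_mono) auto
  finally have "P * (1 + e * h j) - 1 \<le> e * (Q * (1 + h j) - 1)"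
    using IH(2) by (simp add: algebra_simps)
  moreover have "1 \<le> P * (1 + e * h j)"
    using mult_mono[of 1 P 1 "1 + e * h j"] IH(1) h(2) by simp
  ultimately show ?case
    using insert.hyps by (simp add: P_def Q_def mult.commute)
qed simp

lemma one_plus_sum_le_prod:
  fixes h :: "'i \<Rightarrow> real"
  assumes "finite I" "\<And>i. i \<in> I \<Longrightarrow> 0 \<le> h i"
  shows "1 + (\<Sum>i\<in>I. h i) \<le> (\<Prod>i\<in>I. 1 + h i)"
  using assms
proof (induction I rule: finite_induct)
  case (insert j I)
  have "0 \<le> (\<Sum>i\<in>I. h i)" "0 \<le> h j"
    using insert.prems by (auto intro: sum_nonneg)
  then have "1 + (h j + (\<Sum>i\<in>I. h i)) \<le> (1 + h j) * (1 + (\<Sum>i\<in>I. h i))"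
    by (simp add: algebra_simps)
  also have "\<dots> \<le> (1 + h j) * (\<Prod>i\<in>I. 1 + h i)"
    using insert by (intro mult_left_mono) auto
  finally show ?case
    using insert.hyps by simp
qed simp

lemma prod_perturb_derivative:
  fixes h :: "'i \<Rightarrow> real"
  assumes "finite I"
  shows "((\<lambda>e. \<Prod>i\<in>I. 1 + e * h i) has_field_derivative (\<Sum>i\<in>I. h i)) (at 0)"
  using assms
proof (induction I rule: finite_induct)
  case (insert j I)
  have "((\<lambda>e. (1 + e * h j) * (\<Prod>i\<in>I. 1 + e * h i)) has_field_derivative
      ((1 + 0 * h j) * (\<Sum>i\<in>I. h i) + h j * (\<Prod>i\<in>I. 1 + 0 * h i))) (at 0)"
    by (rule DERIV_mult'[OF _ insert.IH]) (auto intro!: derivative_eq_intros)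
  then show ?case
    using insert.hyps by (simp add: add.commute)
qed simp

lemma SUP_min_real: "(SUP k. min (h::ennreal) (ennreal (real (Suc k)))) = h"
proof (rule antisym)
  show "(SUP k. min h (ennreal (real (Suc k)))) \<le> h" by (rule SUP_least) simp
  show "h \<le> (SUP k. min h (ennreal (real (Suc k))))"
  proof (cases h)
    case (real r)
    obtain k :: nat where "r \<le> real k" using real_arch_simple by blast
    then have "r \<le> real (Suc k)" by simp
    then have "h \<le> ennreal (real (Suc k))" unfolding real by (rule ennreal_leI)
    then have "h = min h (ennreal (real (Suc k)))" by (simp add: min_absorb1)
    also have "\<dots> \<le> (SUP k. min h (ennreal (real (Suc k))))" by (rule SUP_upper) simp
    finally show ?thesis .
  next
    case top
    have "(SUP k. of_nat k :: ennreal) \<le> (SUP k. min h (ennreal (real (Suc k))))"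
    proof (rule SUP_mono)
      fix k :: nat
      have "(of_nat k :: ennreal) = ennreal (real k)" by (simp add: ennreal_of_nat_eq_real_of_nat)
      also have "\<dots> \<le> min h (ennreal (real (Suc k)))" using top by (simp add: ennreal_leI del: of_nat_Suc)
      finally show "\<exists>m\<in>UNIV. (of_nat k :: ennreal) \<le> min h (ennreal (real (Suc m)))" by blast
    qed
    then show ?thesis unfolding ennreal_SUP_of_nat_eq_top top .
  qed
qed

section \<open>Finite kernels\<close>

text \<open>The Giry monad only speaks of kernels of mass at most one. A finite kernel is reduced to that case
  by normalisation, since the normalising factor is itself measurable.\<close>

lemma measurable_nn_integral_finite_kernel:
  assumes gen: "sets N = sigma_sets (space N) G" "Int_stable G" "G \<subseteq> Pow (space N)"
    and sets_\<kappa>: "\<And>x. x \<in> space M \<Longrightarrow> sets (\<kappa> x) = sets N"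
    and fin: "\<And>x. x \<in> space M \<Longrightarrow> emeasure (\<kappa> x) (space N) < \<infinity>"
    and meas: "\<And>B. B \<in> G \<Longrightarrow> (\<lambda>x. emeasure (\<kappa> x) B) \<in> borel_measurable M"
    and total [measurable]: "(\<lambda>x. emeasure (\<kappa> x) (space N)) \<in> borel_measurable M"
    and f: "(\<lambda>(x, y). f x y) \<in> borel_measurable (M \<Otimes>\<^sub>M N)"
  shows "(\<lambda>x. \<integral>\<^sup>+y. f x y \<partial>\<kappa> x) \<in> borel_measurable M"
proof (cases "space N = {}")
  case True
  have "(\<integral>\<^sup>+y. f x y \<partial>\<kappa> x) = 0" if "x \<in> space M" for x
  proof -
    have "space (\<kappa> x) = {}"
      using sets_eq_imp_space_eq[OF sets_\<kappa>[OF that]] True by simp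
    then show ?thesis
      by (simp add: nn_integral_empty)
  qed
  then show ?thesis
    by (simp cong: measurable_cong)
next
  case False
  \<comment> \<open>normalising by \<open>1 + \<kappa> x(N)\<close> rather than by \<open>\<kappa> x(N)\<close> avoids dividing by zero\<close>
  define c where "c x = 1 + emeasure (\<kappa> x) (space N)" for x
  define \<kappa>' where "\<kappa>' x = scale_measure (1 / c x) (\<kappa> x)" for x
  have [measurable]: "c \<in> borel_measurable M"
    unfolding c_def by measurable
  have c: "c x \<noteq> 0" "c x \<noteq> top" if "x \<in> space M" for x
    using fin[OF that] by (auto simp: c_def)
  have \<kappa>': "\<kappa>' \<in> M \<rightarrow>\<^sub>M subprob_algebra N"
  proof (rule measurable_subprob_algebra_generated[OF gen])
    fix x assume x: "x \<in> space M"
    show "sets (\<kappa>' x) = sets N"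
      using sets_\<kappa>[OF x] by (simp add: \<kappa>'_def)
    have sp: "space (\<kappa> x) = space N"
      using sets_\<kappa>[OF x] by (rule sets_eq_imp_space_eq)
    show "subprob_space (\<kappa>' x)"
    proof (rule subprob_spaceI)
      show "emeasure (\<kappa>' x) (space (\<kappa>' x)) \<le> 1"
        using c[OF x] fin[OF x]
        by (auto simp: \<kappa>'_def space_scale_measure sp c_def ennreal_divide_times add_pos_nonneg intro!: divide_le_posI_ennreal)
      show "space (\<kappa>' x) \<noteq> {}"
        using False by (simp add: \<kappa>'_def space_scale_measure sp)
    qed
  next
    show "(\<lambda>x. emeasure (\<kappa>' x) B) \<in> borel_measurable M" if "B \<in> G" for B
      using meas[OF that] by (simp add: \<kappa>'_def)
    show "(\<lambda>x. emeasure (\<kappa>' x) (space N)) \<in> borel_measurable M"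
      by (simp add: \<kappa>'_def)
  qed
  have [measurable]: "(\<lambda>x. \<integral>\<^sup>+y. f x y \<partial>\<kappa>' x) \<in> borel_measurable M"
    by (rule nn_integral_measurable_subprob_algebra2[OF f \<kappa>'])
  have "(\<lambda>x. c x * (\<integral>\<^sup>+y. f x y \<partial>\<kappa>' x)) \<in> borel_measurable M"
    by measurable
  moreover have "c x * (\<integral>\<^sup>+y. f x y \<partial>\<kappa>' x) = (\<integral>\<^sup>+y. f x y \<partial>\<kappa> x)" if x: "x \<in> space M" for x
  proof -
    have "f x \<in> borel_measurable N"
      using measurable_Pair2[OF f x] by simp
    then have "f x \<in> borel_measurable (\<kappa> x)"
      using sets_\<kappa>[OF x] by (simp cong: measurable_cong_sets)
    then show ?thesis
      using c[OF x] by (simp add: \<kappa>'_def nn_integral_scale_measure mult.assoc[symmetric] ennreal_times_divide ennreal_divide_self less_top)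
  qed
  ultimately show ?thesis
    by (simp cong: measurable_cong)
qed

lemma emeasure_kernel_product_subprob:
  assumes \<kappa>: "\<kappa> \<in> M \<rightarrow>\<^sub>M subprob_algebra N"
    and B: "B \<in> sets (M \<Otimes>\<^sub>M N)"
  shows "emeasure (kernel_product M N \<kappa>) B = (\<integral>\<^sup>+x. emeasure (\<kappa> x) (Pair x -` B) \<partial>M)"
proof (rule emeasure_kernel_product[OF _ _ B])
  show "sets (\<kappa> x) = sets N" if "x \<in> space M" for x
    using sets_kernel[OF \<kappa> that] .
  fix B assume B: "B \<in> sets (M \<Otimes>\<^sub>M N)"
  have "(SIGMA x:space M. Pair x -` B) = B"
    using sets.sets_into_space[OF B] by (auto simp: space_pair_measure)
  with B show "(\<lambda>x. emeasure (\<kappa> x) (Pair x -` B)) \<in> borel_measurable M"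
    by (intro emeasure_measurable_subprob_algebra2[OF _ \<kappa>]) simp
qed

text \<open>Tonelli's theorem for \<open>M(dx) \<kappa>(x, dy)\<close>, by the usual induction over measurable functions.\<close>

lemma nn_integral_kernel_product:
  assumes \<kappa> [measurable]: "\<kappa> \<in> M \<rightarrow>\<^sub>M subprob_algebra N"
    and f: "f \<in> borel_measurable (M \<Otimes>\<^sub>M N)"
  shows "(\<integral>\<^sup>+z. f z \<partial>kernel_product M N \<kappa>) = (\<integral>\<^sup>+x. \<integral>\<^sup>+y. f (x, y) \<partial>\<kappa> x \<partial>M)"
  using f
proof induct
  case (cong f g)
  have "(\<integral>\<^sup>+z. f z \<partial>kernel_product M N \<kappa>) = (\<integral>\<^sup>+z. g z \<partial>kernel_product M N \<kappa>)"
    using cong by (intro nn_integral_cong) (simp add: space_pair_measure)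
  moreover have "(\<integral>\<^sup>+x. \<integral>\<^sup>+y. f (x, y) \<partial>\<kappa> x \<partial>M) = (\<integral>\<^sup>+x. \<integral>\<^sup>+y. g (x, y) \<partial>\<kappa> x \<partial>M)"
  proof (intro nn_integral_cong)
    fix x y assume "x \<in> space M" "y \<in> space (\<kappa> x)"
    then show "f (x, y) = g (x, y)"
      using cong(3)[of "(x, y)"] sets_eq_imp_space_eq[OF sets_kernel[OF \<kappa>]] by (auto simp: space_pair_measure)
  qed
  ultimately show ?case
    using cong by simp
next
  case (set B)
  have "(\<integral>\<^sup>+x. \<integral>\<^sup>+y. indicator B (x, y) \<partial>\<kappa> x \<partial>M) = (\<integral>\<^sup>+x. emeasure (\<kappa> x) (Pair x -` B) \<partial>M)"
  proof (intro nn_integral_cong)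
    fix x assume x: "x \<in> space M"
    have "Pair x -` B \<in> sets (\<kappa> x)"
      using sets_Pair1[OF set, of x] sets_kernel[OF \<kappa> x] by simp
    then show "(\<integral>\<^sup>+y. indicator B (x, y) \<partial>\<kappa> x) = emeasure (\<kappa> x) (Pair x -` B)"
      by (subst nn_integral_indicator[symmetric]) (auto intro!: nn_integral_cong simp del: nn_integral_indicator split: split_indicator)
  qed
  then show ?case
    using set by (simp add: emeasure_kernel_product_subprob[OF \<kappa>])
next
  case (mult f c)
  have *: "(\<integral>\<^sup>+y. c * f (x, y) \<partial>\<kappa> x) = c * (\<integral>\<^sup>+y. f (x, y) \<partial>\<kappa> x)" if "x \<in> space M" for x
    using mult that by (intro nn_integral_cmult) (auto cong: measurable_cong_sets simp: sets_kernel[OF \<kappa>])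
  have m: "(\<lambda>x. \<integral>\<^sup>+y. f (x, y) \<partial>\<kappa> x) \<in> borel_measurable M"
    using mult by (intro nn_integral_measurable_subprob_algebra2) auto
  show ?case
    using mult m by (simp add: * nn_integral_cmult cong: nn_integral_cong)
next
  case (add f g)
  have *: "(\<integral>\<^sup>+y. f (x, y) + g (x, y) \<partial>\<kappa> x) = (\<integral>\<^sup>+y. f (x, y) \<partial>\<kappa> x) + (\<integral>\<^sup>+y. g (x, y) \<partial>\<kappa> x)"
    if "x \<in> space M" for x
    using add that by (intro nn_integral_add) (auto cong: measurable_cong_sets simp: sets_kernel[OF \<kappa>])
  have m: "(\<lambda>x. \<integral>\<^sup>+y. f (x, y) \<partial>\<kappa> x) \<in> borel_measurable M" "(\<lambda>x. \<integral>\<^sup>+y. g (x, y) \<partial>\<kappa> x) \<in> borel_measurable M"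
    using add by (auto intro!: nn_integral_measurable_subprob_algebra2)
  show ?case
    using add m by (simp add: * nn_integral_add cong: nn_integral_cong)
next
  case (seq F)
  have *: "(\<integral>\<^sup>+y. (SUP i. F i) (x, y) \<partial>\<kappa> x) = (SUP i. \<integral>\<^sup>+y. F i (x, y) \<partial>\<kappa> x)"
    if "x \<in> space M" for x
    unfolding SUP_apply using seq that
    by (intro nn_integral_monotone_convergence_SUP)
       (auto cong: measurable_cong_sets simp: sets_kernel[OF \<kappa>] incseq_def le_fun_def)
  have m: "(\<lambda>x. \<integral>\<^sup>+y. F i (x, y) \<partial>\<kappa> x) \<in> borel_measurable M" for i
    using seq by (intro nn_integral_measurable_subprob_algebra2[OF _ \<kappa>]) auto
  have "(\<integral>\<^sup>+x. (SUP i. \<integral>\<^sup>+y. F i (x, y) \<partial>\<kappa> x) \<partial>M) = (SUP i. \<integral>\<^sup>+x. \<integral>\<^sup>+y. F i (x, y) \<partial>\<kappa> x \<partial>M)"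
    using seq m by (intro nn_integral_monotone_convergence_SUP) (auto simp: incseq_def le_fun_def intro!: nn_integral_mono)
  moreover have "(\<integral>\<^sup>+z. (SUP i. F i) z \<partial>kernel_product M N \<kappa>) = (SUP i. \<integral>\<^sup>+z. F i z \<partial>kernel_product M N \<kappa>)"
    unfolding SUP_apply using seq(1,4) by (intro nn_integral_monotone_convergence_SUP) (auto cong: measurable_cong_sets)
  ultimately show ?case
    using seq by (simp add: * cong: nn_integral_cong del: SUP_apply Sup_apply)
qed

lemma measurable_integral_kernel:
  fixes f :: "'a \<Rightarrow> 'b \<Rightarrow> real"
  assumes f [measurable]: "(\<lambda>(x, y). f x y) \<in> borel_measurable (M \<Otimes>\<^sub>M N)"
    and \<kappa> [measurable]: "\<kappa> \<in> M \<rightarrow>\<^sub>M subprob_algebra N"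
  shows "(\<lambda>x. \<integral>y. f x y \<partial>\<kappa> x) \<in> borel_measurable M"
proof -
  note integral_measurable_subprob_algebra [measurable] measurable_distr2 [measurable]
  have "(\<lambda>x. integral\<^sup>L (distr (\<kappa> x) (M \<Otimes>\<^sub>M N) (\<lambda>y. (x, y))) (\<lambda>(x, y). f x y)) \<in> borel_measurable M"
    by measurable
  then show ?thesis
    by (rule measurable_cong[THEN iffD1, rotated]) (simp add: integral_distr)
qed

text \<open>Fubini's theorem for signed integrands, from the nonnegative case applied to the positive and the
  negative part. A path on which a mark integral diverges carries no mass.\<close>

lemma integral_kernel_product:
  fixes f :: "'a \<times> 'b \<Rightarrow> real"
  assumes \<kappa> [measurable]: "\<kappa> \<in> M \<rightarrow>\<^sub>M subprob_algebra N"
    and f: "integrable (kernel_product M N \<kappa>) f"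
  shows "integrable M (\<lambda>x. \<integral>y. f (x, y) \<partial>\<kappa> x)"
    and "(\<integral>z. f z \<partial>kernel_product M N \<kappa>) = (\<integral>x. \<integral>y. f (x, y) \<partial>\<kappa> x \<partial>M)"
proof -
  have f_meas [measurable]: "f \<in> borel_measurable (M \<Otimes>\<^sub>M N)"
    using borel_measurable_integrable[OF f] by (simp cong: measurable_cong_sets)
  have sec: "(\<lambda>y. f (x, y)) \<in> borel_measurable (\<kappa> x)" if "x \<in> space M" for x
    using that by (auto cong: measurable_cong_sets simp: sets_kernel[OF \<kappa>])
  have m1 [measurable]: "(\<lambda>x. \<integral>\<^sup>+y. g (f (x, y)) \<partial>\<kappa> x) \<in> borel_measurable M"
    if [measurable]: "g \<in> borel_measurable borel" for g
    by (rule nn_integral_measurable_subprob_algebra2[OF _ \<kappa>]) measurable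
  have fin: "(\<integral>\<^sup>+x. \<integral>\<^sup>+y. ennreal \<bar>f (x, y)\<bar> \<partial>\<kappa> x \<partial>M) < \<infinity>"
    using f nn_integral_kernel_product[OF \<kappa>, of "\<lambda>z. ennreal \<bar>f z\<bar>"]
    by (simp add: integrable_iff_bounded)
  have AE_fin: "AE x in M. (\<integral>\<^sup>+y. ennreal \<bar>f (x, y)\<bar> \<partial>\<kappa> x) \<noteq> \<infinity>"
    by (rule nn_integral_noteq_infinite) (use m1[of "\<lambda>r. ennreal \<bar>r\<bar>"] fin in auto)
  define P where "P x = (\<integral>\<^sup>+y. ennreal (f (x, y)) \<partial>\<kappa> x)" for x
  define Q where "Q x = (\<integral>\<^sup>+y. ennreal (- f (x, y)) \<partial>\<kappa> x)" for x
  have [measurable]: "P \<in> borel_measurable M" "Q \<in> borel_measurable M"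
    unfolding P_def Q_def using m1[of ennreal] m1[of "\<lambda>r. ennreal (- r)"] by auto
  have PQ_le: "P x \<le> (\<integral>\<^sup>+y. ennreal \<bar>f (x, y)\<bar> \<partial>\<kappa> x)" "Q x \<le> (\<integral>\<^sup>+y. ennreal \<bar>f (x, y)\<bar> \<partial>\<kappa> x)" for x
    unfolding P_def Q_def by (auto intro!: nn_integral_mono ennreal_leI)
  have int_P: "(\<integral>\<^sup>+x. P x \<partial>M) < \<infinity>" and int_Q: "(\<integral>\<^sup>+x. Q x \<partial>M) < \<infinity>"
    by (rule le_less_trans[OF nn_integral_mono fin], rule PQ_le)+
  have eq: "AE x in M. (\<integral>y. f (x, y) \<partial>\<kappa> x) = enn2real (P x) - enn2real (Q x)"
    using AE_fin AE_space
  proof eventually_elim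
    case (elim x)
    then have "integrable (\<kappa> x) (\<lambda>y. f (x, y))"
      using sec by (auto simp: integrable_iff_bounded less_top)
    then show ?case
      unfolding P_def Q_def by (simp add: real_lebesgue_integral_def)
  qed
  have AE_PQ: "AE x in M. P x \<noteq> \<infinity>" "AE x in M. Q x \<noteq> \<infinity>"
    using int_P int_Q by (auto intro!: nn_integral_noteq_infinite simp del: infinity_ennreal_def simp: less_top[symmetric] infinity_ennreal_def[symmetric])
  have conv: "(\<integral>\<^sup>+x. ennreal (enn2real (P x)) \<partial>M) = (\<integral>\<^sup>+x. P x \<partial>M)"
    "(\<integral>\<^sup>+x. ennreal (enn2real (Q x)) \<partial>M) = (\<integral>\<^sup>+x. Q x \<partial>M)"
    by (rule nn_integral_cong_AE, use AE_PQ in eventually_elim, simp add: less_top)+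
  have iP: "integrable M (\<lambda>x. enn2real (P x))" and iQ: "integrable M (\<lambda>x. enn2real (Q x))"
    using int_P int_Q conv by (auto simp: integrable_iff_bounded)
  have meas: "(\<lambda>x. \<integral>y. f (x, y) \<partial>\<kappa> x) \<in> borel_measurable M"
    by (rule measurable_integral_kernel[OF _ \<kappa>]) measurable
  show "integrable M (\<lambda>x. \<integral>y. f (x, y) \<partial>\<kappa> x)"
    using integrable_cong_AE[THEN iffD2, OF meas _ eq] iP iQ by auto
  have "(\<integral>z. f z \<partial>kernel_product M N \<kappa>) = enn2real (\<integral>\<^sup>+x. P x \<partial>M) - enn2real (\<integral>\<^sup>+x. Q x \<partial>M)"
    using f by (simp add: real_lebesgue_integral_def nn_integral_kernel_product[OF \<kappa>] P_def Q_def)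
  also have "\<dots> = (\<integral>x. enn2real (P x) \<partial>M) - (\<integral>x. enn2real (Q x) \<partial>M)"
    using conv by (simp add: integral_eq_nn_integral)
  also have "\<dots> = (\<integral>x. enn2real (P x) - enn2real (Q x) \<partial>M)"
    using iP iQ by simp
  also have "\<dots> = (\<integral>x. \<integral>y. f (x, y) \<partial>\<kappa> x \<partial>M)"
    using eq meas by (intro integral_cong_AE) auto
  finally show "(\<integral>z. f z \<partial>kernel_product M N \<kappa>) = (\<integral>x. \<integral>y. f (x, y) \<partial>\<kappa> x \<partial>M)" .
qed

text \<open>Sums and products over the random but finite set of jumps are treated as limits of eventually
  constant sequences of sums and products over \<open>{1..k}\<close>.\<close>

lemma borel_measurable_eventually_const:
  fixes g :: "nat \<Rightarrow> 'a \<Rightarrow> 'b::{metric_space}"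
  assumes "\<And>k. g k \<in> borel_measurable N"
    and "\<And>x. x \<in> space N \<Longrightarrow> eventually (\<lambda>k. g k x = G x) sequentially"
  shows "G \<in> borel_measurable N"
  by (rule borel_measurable_LIMSEQ_metric[of g]) (use assms in \<open>auto intro: tendsto_eventually\<close>)

text \<open>The completion makes measurable whatever agrees almost everywhere with a Borel function. This is how
  the Hamiltonian, an infimum over an arbitrary set of controls, gets integrated.\<close>

lemma integral_completion_AE:
  fixes f g :: "real \<Rightarrow> real"
  assumes g: "g \<in> borel_measurable N" and eq: "AE x in N. f x = g x"
  shows "integral\<^sup>L (completion N) f = integral\<^sup>L N g"
proof -
  have eq': "AE x in completion N. f x = g x"
    by (rule AE_completion[OF eq])
  have g': "g \<in> borel_measurable (completion N)"
    by (rule measurable_completion[OF g])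
  have f': "f \<in> borel_measurable (completion N)"
  proof (rule measurableI)
    fix B :: "real set" assume B: "B \<in> sets borel"
    show "f -` B \<inter> space (completion N) \<in> sets (completion N)"
    proof (rule completion.in_sets_AE[OF _ measurable_sets[OF g' B]])
      show "AE x in completion N. (x \<in> g -` B \<inter> space (completion N)) = (x \<in> f -` B \<inter> space (completion N))"
        using eq' by eventually_elim simp
    qed simp
  qed simp
  have "integral\<^sup>L (completion N) f = integral\<^sup>L (completion N) g"
    by (rule integral_cong_AE[OF f' g' eq'])
  also have "\<dots> = integral\<^sup>L N g"
    by (rule integral_completion[OF g])
  finally show ?thesis .
qed

section \<open>Integration against a continuous increasing function\<close>

context
  fixes T :: real and a :: "real \<Rightarrow> real"
  assumes T: "0 < T" and mono: "mono_on {0..T} a" and cont: "continuous_on {0..T} a"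
begin

lemma sets_stieltjes [measurable_cong, simp]: "sets (stieltjes T a) = sets (time_space T)"
  by (simp add: stieltjes_def sets_restrict_space)

lemma space_stieltjes [simp]: "space (stieltjes T a) = {0..T}"
  by (simp add: stieltjes_def space_restrict_space)

lemma emeasure_stieltjes_Ioc:
  assumes "0 \<le> s" "s \<le> t" "t \<le> T"
  shows "emeasure (stieltjes T a) {s<..t} = ennreal (a t - a s)"
proof -
  have "emeasure (stieltjes T a) {s<..t} = emeasure (interval_measure (\<lambda>t. a (max 0 (min T t)))) {s<..t}"
    using assms unfolding stieltjes_def by (subst emeasure_restrict_space) auto
  also have "\<dots> = ennreal (a (max 0 (min T t)) - a (max 0 (min T s)))"
  proof (rule emeasure_interval_measure_Ioc[OF \<open>s \<le> t\<close>])
    show "a (max 0 (min T x)) \<le> a (max 0 (min T y))" if "x \<le> y" for x y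
      using that T by (intro mono_onD[OF mono]) auto
    have "continuous_on UNIV (\<lambda>t. a (max 0 (min T t)))"
      using T by (intro continuous_on_compose2[OF cont] continuous_intros) auto
    then show "continuous (at_right x) (\<lambda>t. a (max 0 (min T t)))" for x
      by (auto simp: continuous_on_eq_continuous_within intro: continuous_within_subset)
  qed
  finally show ?thesis
    using assms by (simp add: max_def min_def)
qed

lemma emeasure_stieltjes_singleton: "emeasure (stieltjes T a) {x} = 0"
proof -
  have c: "continuous_on UNIV (\<lambda>t. a (max 0 (min T t)))"
    using T by (intro continuous_on_compose2[OF cont] continuous_intros) auto
  have "emeasure (interval_measure (\<lambda>t. a (max 0 (min T t)))) {x .. x} = 0"
    using T c by (subst emeasure_interval_measure_Icc) (auto intro!: mono_onD[OF mono])
  moreover have "emeasure (stieltjes T a) {x} = (if x \<in> {0..T} then emeasure (interval_measure (\<lambda>t. a (max 0 (min T t)))) {x} else 0)"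
    unfolding stieltjes_def by (auto simp: emeasure_restrict_space emeasure_notin_sets sets_restrict_space_iff)
  ultimately show ?thesis
    by simp
qed

lemma AE_stieltjes_finite: "finite D \<Longrightarrow> AE t in stieltjes T a. t \<notin> D"
proof (induction D rule: finite_induct)
  case (insert x D)
  have "AE t in stieltjes T a. t \<noteq> x"
  proof (cases "x \<in> {0..T}")
    case True
    then have "{x} \<in> null_sets (stieltjes T a)"
      by (intro null_setsI) (auto simp: emeasure_stieltjes_singleton sets_restrict_space_iff)
    from AE_not_in[OF this] show ?thesis by simp
  qed (auto intro: AE_I2)
  with insert show ?case by auto
qed simp

lemma emeasure_stieltjes_Icc:
  assumes "0 \<le> t" "t \<le> T"
  shows "emeasure (stieltjes T a) {0..t} = ennreal (a t - a 0)"
proof -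
  have "emeasure (stieltjes T a) ({0} \<union> {0<..t}) = emeasure (stieltjes T a) {0} + emeasure (stieltjes T a) {0<..t}"
    using assms T by (intro plus_emeasure[symmetric]) (auto simp: sets_restrict_space_iff)
  moreover have "{0} \<union> {0<..t} = {0..t}"
    using assms by auto
  ultimately show ?thesis
    using assms by (simp add: emeasure_stieltjes_Ioc emeasure_stieltjes_singleton)
qed

lemma finite_measure_stieltjes: "finite_measure (stieltjes T a)"
  using emeasure_stieltjes_Icc[of T] T by (intro finite_measureI) simp

end

text \<open>Initial intervals suffice to test kernels into \<open>[0, T]\<close>, because their mass under \<open>dA\<close> is
  directly given by \<open>A\<close>.\<close>

lemma time_space_generator:
  assumes "0 < T"
  shows "sets (time_space T) = sigma_sets {0..T} ((\<lambda>b. {0..b}) ` {0..T})"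
    and "Int_stable ((\<lambda>b. {0..b::real}) ` {0..T})"
proof -
  show "Int_stable ((\<lambda>b. {0..b::real}) ` {0..T})"
    unfolding Int_stable_def
  proof (intro ballI)
    fix A B assume "A \<in> (\<lambda>b. {0..b::real}) ` {0..T}" "B \<in> (\<lambda>b. {0..b}) ` {0..T}"
    then obtain a b where "a \<in> {0..T}" "b \<in> {0..T}" "A = {0..a}" "B = {0..b}"
      by blast
    then have "A \<inter> B = {0..min a b}" "min a b \<in> {0..T}"
      by auto
    then show "A \<inter> B \<in> (\<lambda>b. {0..b}) ` {0..T}"
      by blast
  qed
  have sp: "(\<lambda>b. {0..b}) ` {0..T} \<subseteq> Pow {0..T}"
    by auto
  have borel: "sets (borel :: real measure) = sigma_sets UNIV (range (\<lambda>b::real. {..b}))"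
    unfolding borel_eq_atMost by (rule sets_measure_of) simp
  have "sets (time_space T) = (\<inter>) {0..T} ` sigma_sets UNIV (range (\<lambda>b::real. {..b}))"
    by (simp only: sets_restrict_space borel)
  also have "\<dots> = sigma_sets {0..T} ((\<inter>) {0..T} ` range (\<lambda>b::real. {..b}))"
  proof (rule sigma_sets_Int)
    show "{0..T} \<in> sigma_sets UNIV (range (\<lambda>b::real. {..b}))"
      using borel by (metis atLeastAtMost_borel)
  qed simp
  also have "\<dots> = sigma_sets {0..T} ((\<lambda>b. {0..b}) ` {0..T})"
  proof (intro sigma_sets_eqI)
    fix B assume "B \<in> (\<inter>) {0..T} ` range (\<lambda>b::real. {..b})"
    then obtain b where B: "B = {0..T} \<inter> {..b}" by blast
    show "B \<in> sigma_sets {0..T} ((\<lambda>b. {0..b}) ` {0..T})"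
    proof (cases "0 \<le> b")
      case True
      then have "B = {0..min b T}" "min b T \<in> {0..T}" using B assms by auto
      then show ?thesis by (intro sigma_sets.Basic) blast
    next
      case False
      then have "B = {}" using B by auto
      then show ?thesis by (simp only: sigma_sets.Empty)
    qed
  next
    fix B assume "B \<in> (\<lambda>b. {0..b}) ` {0..T}"
    then obtain b where "b \<in> {0..T}" "B = {0..b}" by blast
    then have "B = {0..T} \<inter> {..b}" by auto
    then show "B \<in> sigma_sets {0..T} ((\<inter>) {0..T} ` range (\<lambda>b::real. {..b}))"
      by (intro sigma_sets.Basic) blast
  qed
  finally show "sets (time_space T) = sigma_sets {0..T} ((\<lambda>b. {0..b}) ` {0..T})" .
qed

text \<open>The integral over \<open>(-\<infinity>, t]\<close>. As \<open>m\<close> lives on \<open>[0, T]\<close> and does not charge \<open>0\<close>, this is the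
  integral over \<open>(0, t]\<close>.\<close>

definition primitive :: "real measure \<Rightarrow> (real \<Rightarrow> real) \<Rightarrow> real \<Rightarrow> real" where
  "primitive m f t = (\<integral>s. indicator {..t} s * f s \<partial>m)"

locale atomless_time_measure =
  finite_measure m for m :: "real measure" +
  fixes T :: real
  assumes sets_m: "sets m = sets (time_space T)"
    and atomless: "\<And>x. AE y in m. y \<noteq> x"
begin

lemma id_borel: "(\<lambda>x. x) \<in> borel_measurable m"
  by (subst measurable_cong_sets[OF sets_m refl]) (rule measurable_restrict_space1, simp)

lemma indicator_atMost [measurable]: "(indicator {..t} :: real \<Rightarrow> real) \<in> borel_measurable m"
  by (rule measurable_compose[OF id_borel]) simp

lemma pred_less_const [measurable]: "Measurable.pred m (\<lambda>y. y < x)"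
  by (rule measurable_compose[OF id_borel]) simp

lemma fst_borel: "fst \<in> borel_measurable (m \<Otimes>\<^sub>M m)" and snd_borel: "snd \<in> borel_measurable (m \<Otimes>\<^sub>M m)"
  by (rule measurable_compose[OF measurable_fst id_borel], rule measurable_compose[OF measurable_snd id_borel])

lemma pred_le [measurable]: "Measurable.pred (m \<Otimes>\<^sub>M m) (\<lambda>z. snd z \<le> fst z)"
  using fst_borel snd_borel by simp

lemma pred_ge [measurable]: "Measurable.pred (m \<Otimes>\<^sub>M m) (\<lambda>z. fst z \<le> snd z)"
  using fst_borel snd_borel by simp

lemma pred_less [measurable]: "Measurable.pred (m \<Otimes>\<^sub>M m) (\<lambda>z. snd z < fst z)"
  using fst_borel snd_borel by simp

abbreviation "prim \<equiv> primitive m"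

lemma integrable_prim:
  fixes f :: "real \<Rightarrow> real"
  shows "integrable m f \<Longrightarrow> integrable m (\<lambda>s. indicator {..t} s * f s)"
  by (rule Bochner_Integration.integrable_bound[where f=f]) (auto split: split_indicator)

lemma measurable_prim [measurable]:
  assumes [measurable]: "f \<in> borel_measurable m"
  shows "prim f \<in> borel_measurable m"
proof -
  have "(\<lambda>t. \<integral>s. (if s \<le> t then f s else 0) \<partial>m) \<in> borel_measurable m"
    by (rule borel_measurable_lebesgue_integral) measurable
  then show ?thesis
    unfolding primitive_def by (simp add: indicator_def if_distrib[where f="\<lambda>x. x * _"] cong: if_cong)
qed

lemma abs_prim_le:
  assumes [measurable]: "f \<in> borel_measurable m" and f: "\<And>s. s \<in> space m \<Longrightarrow> \<bar>f s\<bar> \<le> K"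
  shows "\<bar>prim f t\<bar> \<le> K * measure m (space m)"
proof -
  have i: "integrable m f"
    using f by (intro integrable_const_bound[where B=K]) auto
  have "\<bar>prim f t\<bar> \<le> (\<integral>s. \<bar>indicator {..t} s * f s\<bar> \<partial>m)"
    unfolding primitive_def by (rule integral_abs_bound)
  also have "\<dots> \<le> (\<integral>s. K \<partial>m)"
  proof (intro integral_mono integrable_abs integrable_prim i integrable_const)
    fix s assume "s \<in> space m"
    then have "\<bar>f s\<bar> \<le> K" by (rule f)
    moreover from this have "0 \<le> K" by linarith
    ultimately show "\<bar>indicator {..t} s * f s\<bar> \<le> K"
      by (simp split: split_indicator)
  qed
  finally show ?thesis by (simp add: mult.commute)
qed

text \<open>Integration by parts. By Fubini's theorem the product is an integral over a square; it is cut along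
  the diagonal, which is a null set because \<open>m\<close> has no atoms.\<close>

lemma prim_mult:
  assumes [measurable]: "f \<in> borel_measurable m" "g \<in> borel_measurable m"
    and f: "\<And>s. s \<in> space m \<Longrightarrow> \<bar>f s\<bar> \<le> K" and g: "\<And>s. s \<in> space m \<Longrightarrow> \<bar>g s\<bar> \<le> L"
  shows "prim f t * prim g t = prim (\<lambda>s. prim f s * g s + f s * prim g s) t"
proof -
  interpret P: pair_sigma_finite m m
    by unfold_locales
  interpret PP: finite_measure "m \<Otimes>\<^sub>M m"
    by (rule finite_measure_pair_measure) unfold_locales
  have i: "integrable m f" "integrable m g"
    using integrable_const_bound[where f=f and B=K] integrable_const_bound[where f=g and B=L] f g by auto
  let ?h = "\<lambda>x y. indicator {..t} x * f x * (indicator {..t} y * g y)"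
  have bnd: "\<bar>?h x y\<bar> \<le> \<bar>K\<bar> * \<bar>L\<bar>" if "x \<in> space m" "y \<in> space m" for x y
    using f[OF that(1)] g[OF that(2)] by (auto simp: abs_mult split: split_indicator intro!: mult_mono)
  have ih: "integrable (m \<Otimes>\<^sub>M m) (\<lambda>(x, y). c x y * ?h x y)"
    if [measurable]: "case_prod c \<in> borel_measurable (m \<Otimes>\<^sub>M m)" and "\<And>x y. c x y \<in> {0, 1::real}" for c
  proof (rule PP.integrable_const_bound[where B="\<bar>K\<bar> * \<bar>L\<bar>"])
    have "\<bar>c x y * ?h x y\<bar> \<le> \<bar>K\<bar> * \<bar>L\<bar>" if "x \<in> space m" "y \<in> space m" for x y
      using bnd[OF that] \<open>\<And>x y. c x y \<in> {0, 1::real}\<close>[of x y] by (auto simp: abs_mult)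
    then show "AE x in m \<Otimes>\<^sub>M m. norm (case x of (x, y) \<Rightarrow> c x y * ?h x y) \<le> \<bar>K\<bar> * \<bar>L\<bar>"
      by (intro AE_I2) (auto simp: space_pair_measure)
    show "(\<lambda>(x, y). c x y * ?h x y) \<in> borel_measurable (m \<Otimes>\<^sub>M m)"
      by measurable
  qed
  \<comment> \<open>the two halves of the square, the diagonal belonging to the first\<close>
  let ?c = "\<lambda>x y. of_bool (x \<le> y) :: real" and ?d = "\<lambda>x y. of_bool (y < x) :: real"
  have c: "integrable (m \<Otimes>\<^sub>M m) (\<lambda>(x, y). ?c x y * ?h x y)"
    by (rule ih) (auto simp: of_bool_def split_beta')
  have d: "integrable (m \<Otimes>\<^sub>M m) (\<lambda>(x, y). ?d x y * ?h x y)"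
    by (rule ih) (auto simp: of_bool_def split_beta')
  have "prim f t * prim g t = (\<integral>x. indicator {..t} x * f x * prim g t \<partial>m)"
    unfolding primitive_def by simp
  also have "\<dots> = (\<integral>x. \<integral>y. ?h x y \<partial>m \<partial>m)"
    unfolding primitive_def by simp
  also have "\<dots> = (\<integral>(x, y). ?h x y \<partial>(m \<Otimes>\<^sub>M m))"
    using P.integral_fst'[of "\<lambda>(x, y). ?h x y"] ih[of "\<lambda>_ _. 1"] by simp
  also have "\<dots> = (\<integral>z. (case z of (x, y) \<Rightarrow> ?c x y * ?h x y) + (case z of (x, y) \<Rightarrow> ?d x y * ?h x y) \<partial>(m \<Otimes>\<^sub>M m))"
    by (intro Bochner_Integration.integral_cong) auto
  also have "\<dots> = (\<integral>(x, y). ?c x y * ?h x y \<partial>(m \<Otimes>\<^sub>M m)) + (\<integral>(x, y). ?d x y * ?h x y \<partial>(m \<Otimes>\<^sub>M m))"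
    using c d by (rule Bochner_Integration.integral_add)
  also have "(\<integral>(x, y). ?c x y * ?h x y \<partial>(m \<Otimes>\<^sub>M m)) = (\<integral>y. \<integral>x. ?c x y * ?h x y \<partial>m \<partial>m)"
    using P.integral_snd[of "\<lambda>x y. ?c x y * ?h x y"] c by simp
  also have "\<dots> = (\<integral>y. indicator {..t} y * (prim f y * g y) \<partial>m)"
  proof (intro Bochner_Integration.integral_cong refl)
    fix y
    have "(\<integral>x. ?c x y * ?h x y \<partial>m) = (\<integral>x. indicator {..y} x * f x * (indicator {..t} y * g y) \<partial>m)"
      by (intro Bochner_Integration.integral_cong) (auto split: split_indicator)
    then show "(\<integral>x. ?c x y * ?h x y \<partial>m) = indicator {..t} y * (prim f y * g y)"
      by (simp add: primitive_def)
  qed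
  also have "(\<integral>(x, y). ?d x y * ?h x y \<partial>(m \<Otimes>\<^sub>M m)) = (\<integral>x. \<integral>y. ?d x y * ?h x y \<partial>m \<partial>m)"
    using P.integral_fst'[OF d] by simp
  also have "\<dots> = (\<integral>x. indicator {..t} x * (f x * prim g x) \<partial>m)"
  proof (intro Bochner_Integration.integral_cong refl)
    fix x
    have "(\<integral>y. ?d x y * ?h x y \<partial>m) = (\<integral>y. indicator {..x} y * g y * (indicator {..t} x * f x) \<partial>m)"
    proof (intro integral_cong_AE)
      show "AE y in m. ?d x y * ?h x y = indicator {..x} y * g y * (indicator {..t} x * f x)"
        using atomless[of x] by eventually_elim (auto split: split_indicator)
    qed auto
    then show "(\<integral>y. ?d x y * ?h x y \<partial>m) = indicator {..t} x * (f x * prim g x)"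
      by (simp add: primitive_def)
  qed
  also have "(\<integral>y. indicator {..t} y * (prim f y * g y) \<partial>m) + (\<integral>x. indicator {..t} x * (f x * prim g x) \<partial>m)
      = (\<integral>y. indicator {..t} y * (prim f y * g y) + indicator {..t} y * (f y * prim g y) \<partial>m)"
  proof (rule Bochner_Integration.integral_add[symmetric]; rule integrable_prim)
    show "integrable m (\<lambda>y. prim f y * g y)"
      by (intro integrable_const_bound[where B="(K * measure m (space m)) * L"] AE_I2)
         (auto simp: abs_mult intro!: mult_mono' abs_prim_le f g)
    show "integrable m (\<lambda>y. f y * prim g y)"
      by (intro integrable_const_bound[where B="K * (L * measure m (space m))"] AE_I2)
         (auto simp: abs_mult intro!: mult_mono' abs_prim_le f g)
  qed
  finally show ?thesis
    by (simp add: primitive_def distrib_left)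
qed

lemma prim_power:
  fixes h :: "real \<Rightarrow> real"
  assumes [measurable]: "h \<in> borel_measurable m" and h: "\<And>s. s \<in> space m \<Longrightarrow> \<bar>h s\<bar> \<le> K"
  shows "prim h t ^ Suc n = prim (\<lambda>s. real (Suc n) * (prim h s) ^ n * h s) t"
proof (induction n arbitrary: t)
  case 0
  then show ?case by simp
next
  case (Suc n)
  let ?g = "\<lambda>s. real (Suc n) * (prim h s) ^ n * h s"
  have g: "\<bar>?g s\<bar> \<le> real (Suc n) * (K * measure m (space m)) ^ n * K" if "s \<in> space m" for s
  proof -
    have "\<bar>?g s\<bar> = real (Suc n) * \<bar>prim h s\<bar> ^ n * \<bar>h s\<bar>"
      by (simp add: abs_mult power_abs)
    also have "\<dots> \<le> real (Suc n) * (K * measure m (space m)) ^ n * K"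
      using h[OF that] abs_prim_le[OF assms] by (intro mult_mono' power_mono) auto
    finally show ?thesis .
  qed
  have "prim h t ^ Suc (Suc n) = prim h t * prim ?g t"
    using Suc.IH[of t] by simp
  also have "\<dots> = prim (\<lambda>s. prim h s * ?g s + h s * prim ?g s) t"
    by (rule prim_mult[OF _ _ h g]) auto
  also have "(\<lambda>s. prim h s * ?g s + h s * prim ?g s) = (\<lambda>s. real (Suc (Suc n)) * prim h s ^ Suc n * h s)"
  proof
    fix s
    have "h s * prim ?g s = h s * prim h s ^ Suc n"
      by (simp only: Suc.IH)
    then show "prim h s * ?g s + h s * prim ?g s = real (Suc (Suc n)) * prim h s ^ Suc n * h s"
      by (simp only:) (simp add: algebra_simps)
  qed
  finally show ?case .
qed

text \<open>The chain rule for the exponential, summed from the rule for powers. The exponential series converges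
  uniformly here, since primitives of bounded functions are bounded.\<close>

lemma prim_exp:
  assumes [measurable]: "h \<in> borel_measurable m" and h: "\<And>s. s \<in> space m \<Longrightarrow> \<bar>h s\<bar> \<le> K"
  shows "prim (\<lambda>s. exp (prim h s) * h s) t = exp (prim h t) - 1"
proof -
  define C where "C = K * measure m (space m)"
  have bnd: "\<bar>prim h s\<bar> \<le> C" for s
    unfolding C_def by (rule abs_prim_le[OF _ h]) auto
  then have "0 \<le> C" by (meson abs_ge_zero order_trans)
  let ?f = "\<lambda>n s. indicator {..t} s * (prim h s ^ n /\<^sub>R fact n * h s)"
  have f_le: "\<bar>?f n s\<bar> \<le> C ^ n /\<^sub>R fact n * \<bar>K\<bar>" if "s \<in> space m" for n s
  proof -
    have "\<bar>?f n s\<bar> \<le> \<bar>prim h s ^ n /\<^sub>R fact n * h s\<bar>"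
      by (simp split: split_indicator)
    also have "\<dots> = (\<bar>prim h s\<bar> ^ n /\<^sub>R fact n) * \<bar>h s\<bar>"
      by (simp add: abs_mult power_abs)
    also have "\<dots> \<le> C ^ n /\<^sub>R fact n * \<bar>K\<bar>"
      using h[OF that] bnd[of s] \<open>0 \<le> C\<close> by (intro mult_mono scaleR_left_mono power_mono) auto
    finally show ?thesis .
  qed
  have [measurable]: "?f n \<in> borel_measurable m" for n
    by measurable
  have int_f: "integrable m (?f n)" for n
    by (rule integrable_const_bound[where B="C ^ n /\<^sub>R fact n * \<bar>K\<bar>"])
       (simp_all only: real_norm_def f_le AE_I2 \<open>?f n \<in> borel_measurable m\<close>)
  have sums: "(\<lambda>n. ?f n s) sums (indicator {..t} s * (exp (prim h s) * h s))" for s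
    by (intro sums_mult sums_mult2 exp_converges)
  have summ: "summable (\<lambda>n. \<integral>s. norm (?f n s) \<partial>m)"
  proof (rule summable_comparison_test'[where N=0 and g="\<lambda>n. C ^ n /\<^sub>R fact n * (\<bar>K\<bar> * measure m (space m))"])
    show "summable (\<lambda>n. C ^ n /\<^sub>R fact n * (\<bar>K\<bar> * measure m (space m)))"
      by (rule summable_mult2[OF sums_summable[OF exp_converges]])
    fix n :: nat
    have "(\<integral>s. norm (?f n s) \<partial>m) \<le> (\<integral>s. C ^ n /\<^sub>R fact n * \<bar>K\<bar> \<partial>m)"
    proof (rule integral_mono)
      show "integrable m (\<lambda>s. norm (?f n s))"
        by (rule integrable_norm[OF int_f])
    qed (simp_all only: real_norm_def f_le integrable_const)
    also have "\<dots> = C ^ n /\<^sub>R fact n * (\<bar>K\<bar> * measure m (space m))"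
      by simp
    finally show "norm (\<integral>s. norm (?f n s) \<partial>m) \<le> C ^ n /\<^sub>R fact n * (\<bar>K\<bar> * measure m (space m))"
      by (simp only: real_norm_def abs_of_nonneg[OF Bochner_Integration.integral_nonneg[OF abs_ge_zero]])
  qed
  have nsum: "AE s in m. summable (\<lambda>n. norm (?f n s))"
  proof (rule AE_I2)
    fix s assume s: "s \<in> space m"
    show "summable (\<lambda>n. norm (?f n s))"
    proof (rule summable_comparison_test'[where N=0 and g="\<lambda>n. C ^ n /\<^sub>R fact n * \<bar>K\<bar>"])
      show "summable (\<lambda>n. C ^ n /\<^sub>R fact n * \<bar>K\<bar>)"
        by (rule summable_mult2[OF sums_summable[OF exp_converges]])
      show "norm (norm (?f n s)) \<le> C ^ n /\<^sub>R fact n * \<bar>K\<bar>" for n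
        using f_le[OF s, of n] by (simp only: real_norm_def abs_abs)
    qed
  qed
  have "(\<lambda>n. integral\<^sup>L m (?f n)) sums (\<integral>s. (\<Sum>n. ?f n s) \<partial>m)"
    by (rule sums_integral[OF int_f nsum summ])
  moreover have "(\<integral>s. (\<Sum>n. ?f n s) \<partial>m) = prim (\<lambda>s. exp (prim h s) * h s) t"
    unfolding primitive_def[of m "\<lambda>s. exp (prim h s) * h s"] sums_unique[OF sums] ..
  moreover have "integral\<^sup>L m (?f n) = prim h t ^ Suc n /\<^sub>R fact (Suc n)" for n
  proof -
    have "?f n s = inverse (fact (Suc n)) * (indicator {..t} s * (real (Suc n) * prim h s ^ n * h s))" for s
    proof -
      have "inverse (fact (Suc n)) * real (Suc n) = inverse (fact n :: real)"
        unfolding fact_Suc by (simp del: of_nat_Suc)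
      then have "prim h s ^ n /\<^sub>R fact n * h s = inverse (fact (Suc n)) * real (Suc n) * prim h s ^ n * h s"
        by (simp only: real_scaleR_def)
      then show ?thesis
        by (simp only: mult_ac)
    qed
    then have "integral\<^sup>L m (?f n) = inverse (fact (Suc n)) * prim (\<lambda>s. real (Suc n) * prim h s ^ n * h s) t"
      unfolding primitive_def[of m "\<lambda>s. real (Suc n) * prim h s ^ n * h s"] by (simp only: integral_mult_right_zero)
    then show ?thesis
      by (simp only: prim_power[OF assms] real_scaleR_def)
  qed
  ultimately have 1: "(\<lambda>n. prim h t ^ Suc n /\<^sub>R fact (Suc n)) sums prim (\<lambda>s. exp (prim h s) * h s) t"
    by (simp only:)
  have "(\<lambda>n. (prim h t) ^ n /\<^sub>R fact n) sums ((exp (prim h t) - 1) + (prim h t) ^ 0 /\<^sub>R fact 0)"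
    using exp_converges[of "prim h t"] by simp
  then have 2: "(\<lambda>n. prim h t ^ Suc n /\<^sub>R fact (Suc n)) sums (exp (prim h t) - 1)"
    by (rule sums_Suc_iff[THEN iffD2])
  show ?thesis
    by (rule sums_unique2[OF 1 2])
qed

text \<open>The stochastic exponential solves its equation path by path: \<open>L\<close> equal to \<open>exp (prim h)\<close> times
  the product of the \<open>r i\<close> over the jumps so far changes by \<open>L_ (r n - 1)\<close> at the jump times
  and by \<open>L_ h dm\<close> between them. Instead of integrating from jump to jump, the product over the
  jumps before \<open>s\<close> is written as \<open>1\<close> plus increments that switch on at the jump times, so that only
  the integrals of \<open>exp (prim h) h\<close> over \<open>(\<tau> n, T]\<close> are needed.\<close>

lemma exp_jump_formula:
  fixes \<tau> :: "nat \<Rightarrow> real" and r :: "nat \<Rightarrow> real"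
  assumes [measurable]: "h \<in> borel_measurable m" and h: "\<And>s. s \<in> space m \<Longrightarrow> \<bar>h s\<bar> \<le> K"
    and \<tau>: "\<And>i j. i \<in> {1..k} \<Longrightarrow> j \<in> {1..k} \<Longrightarrow> \<tau> i < \<tau> j \<longleftrightarrow> i < j"
  shows "exp (prim h T) * (\<Prod>n=1..k. r n)
    = 1 + (\<Sum>n=1..k. exp (prim h (\<tau> n)) * (\<Prod>i\<in>{i\<in>{1..k}. \<tau> i < \<tau> n}. r i) * (r n - 1))
        + (\<integral>s. exp (prim h s) * (\<Prod>i\<in>{i\<in>{1..k}. \<tau> i < s}. r i) * h s \<partial>m)"
proof -
  define \<pi> where "\<pi> n = (\<Prod>i=1..n. r i)" for n
  define f where "f s = exp (prim h s) * h s" for s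
  have [measurable]: "f \<in> borel_measurable m"
    unfolding f_def by measurable
  have sp: "s \<le> T" if "s \<in> space m" for s
    using that sets_eq_imp_space_eq[OF sets_m] by auto
  have f_le: "\<bar>f s\<bar> \<le> exp (K * measure m (space m)) * K" if "s \<in> space m" for s
    unfolding f_def abs_mult abs_exp_cancel
    using abs_prim_le[OF assms(1) h, of s] h[OF that] by (intro mult_mono) auto
  have f_int: "integrable m f"
    by (rule integrable_const_bound[where B="exp (K * measure m (space m)) * K"]) (use f_le in auto)
  have prim_f: "prim f t = exp (prim h t) - 1" for t
    unfolding f_def by (rule prim_exp[OF assms(1) h])
  have f_total: "(\<integral>s. f s \<partial>m) = exp (prim h T) - 1"
    unfolding prim_f[symmetric] primitive_def[of m f] using sp
    by (intro Bochner_Integration.integral_cong) auto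
  have after: "(\<integral>s. indicator {t<..} s * f s \<partial>m) = exp (prim h T) - exp (prim h t)" for t
  proof -
    have "(\<integral>s. indicator {t<..} s * f s \<partial>m) = (\<integral>s. f s - indicator {..t} s * f s \<partial>m)"
      by (intro Bochner_Integration.integral_cong) (auto split: split_indicator)
    also have "\<dots> = exp (prim h T) - exp (prim h t)"
      using f_int integrable_prim[OF f_int] prim_f[of t] f_total by (simp add: primitive_def)
    finally show ?thesis .
  qed
  have step: "\<pi> n - \<pi> (n - 1) = \<pi> (n - 1) * (r n - 1)" if "1 \<le> n" for n
  proof -
    obtain n' where "n = Suc n'" using \<open>1 \<le> n\<close> by (cases n) auto
    then show ?thesis by (simp add: \<pi>_def algebra_simps)
  qed
  have tele: "\<pi> j = 1 + (\<Sum>n=1..j. \<pi> n - \<pi> (n - 1))" for j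
    by (induction j) (auto simp: \<pi>_def)
  have prod_eq: "(\<Prod>i\<in>{i\<in>{1..k}. \<tau> i < s}. r i) = 1 + (\<Sum>n=1..k. (\<pi> n - \<pi> (n - 1)) * indicator {\<tau> n<..} s)" for s
  proof -
    \<comment> \<open>the jumps before \<open>s\<close> form an initial segment\<close>
    obtain j where j: "{i\<in>{1..k}. \<tau> i < s} = {1..j}"
    proof (cases "{i\<in>{1..k}. \<tau> i < s} = {}")
      case True
      then show ?thesis using that[of 0] by simp
    next
      case False
      define D where "D = {i\<in>{1..k}. \<tau> i < s}"
      have "finite D" "D \<noteq> {}" using False by (simp_all add: D_def)
      then have Max: "Max D \<in> D" by (rule Max_in)
      have "i \<in> D" if "1 \<le> i" "i \<le> Max D" for i
      proof (cases "i = Max D")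
        case False
        then have "\<tau> i < \<tau> (Max D)"
          using that Max \<tau>[of i "Max D"] by (simp add: D_def)
        then show ?thesis
          using that Max by (simp add: D_def)
      qed (use Max in simp)
      moreover have "1 \<le> i \<and> i \<le> Max D" if "i \<in> D" for i
        using Max_ge[OF \<open>finite D\<close> that] that by (simp add: D_def)
      ultimately have "D = {1..Max D}"
        by (meson atLeastAtMost_iff subsetI subset_antisym)
      then have "{i\<in>{1..k}. \<tau> i < s} = {1..Max D}"
        by (simp only: D_def)
      then show ?thesis by (rule that)
    qed
    have "(\<Prod>i\<in>{i\<in>{1..k}. \<tau> i < s}. r i) = 1 + (\<Sum>n\<in>{i\<in>{1..k}. \<tau> i < s}. \<pi> n - \<pi> (n - 1))"
      unfolding j using tele[of j] by (simp add: \<pi>_def)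
    also have "(\<Sum>n\<in>{i\<in>{1..k}. \<tau> i < s}. \<pi> n - \<pi> (n - 1)) = (\<Sum>n=1..k. if \<tau> n < s then \<pi> n - \<pi> (n - 1) else 0)"
      by (rule sum.inter_filter) simp
    also have "\<dots> = (\<Sum>n=1..k. (\<pi> n - \<pi> (n - 1)) * indicator {\<tau> n<..} s)"
      by (intro sum.cong) auto
    finally show ?thesis .
  qed
  have [measurable]: "(indicator {t<..} :: real \<Rightarrow> real) \<in> borel_measurable m" for t
    by (rule measurable_compose[OF id_borel]) simp
  have ind_int: "integrable m (\<lambda>s. indicator {t<..} s * f s)" for t
    by (rule Bochner_Integration.integrable_bound[OF f_int]) (auto split: split_indicator)
  have jump: "exp (prim h (\<tau> n)) * (\<Prod>i\<in>{i\<in>{1..k}. \<tau> i < \<tau> n}. r i) * (r n - 1)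
      = exp (prim h (\<tau> n)) * (\<pi> n - \<pi> (n - 1))" if "n \<in> {1..k}" for n
  proof -
    have "{i\<in>{1..k}. \<tau> i < \<tau> n} = {1..n - 1}"
    proof (intro set_eqI iffI)
      fix i assume "i \<in> {i\<in>{1..k}. \<tau> i < \<tau> n}"
      then show "i \<in> {1..n - 1}" using \<tau>[of i n] that by simp
    next
      fix i assume "i \<in> {1..n - 1}"
      then show "i \<in> {i\<in>{1..k}. \<tau> i < \<tau> n}" using \<tau>[of i n] that by auto
    qed
    then show ?thesis
      using step[of n] that by (simp only: \<pi>_def[symmetric] atLeastAtMost_iff mult.assoc)
  qed
  have "(\<integral>s. exp (prim h s) * (\<Prod>i\<in>{i\<in>{1..k}. \<tau> i < s}. r i) * h s \<partial>m)
      = (\<integral>s. f s + (\<Sum>n=1..k. (\<pi> n - \<pi> (n - 1)) * (indicator {\<tau> n<..} s * f s)) \<partial>m)"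
  proof (intro Bochner_Integration.integral_cong refl)
    fix s
    have "exp (prim h s) * (\<Prod>i\<in>{i\<in>{1..k}. \<tau> i < s}. r i) * h s
        = f s * (1 + (\<Sum>n=1..k. (\<pi> n - \<pi> (n - 1)) * indicator {\<tau> n<..} s))"
      unfolding prod_eq f_def by (simp only: mult_ac)
    also have "\<dots> = f s + (\<Sum>n=1..k. (\<pi> n - \<pi> (n - 1)) * (indicator {\<tau> n<..} s * f s))"
      unfolding distrib_left sum_distrib_left by (simp only: mult_1_right mult_ac)
    finally show "exp (prim h s) * (\<Prod>i\<in>{i\<in>{1..k}. \<tau> i < s}. r i) * h s
        = f s + (\<Sum>n=1..k. (\<pi> n - \<pi> (n - 1)) * (indicator {\<tau> n<..} s * f s))" .
  qed
  also have "\<dots> = exp (prim h T) - 1 + (\<Sum>n=1..k. (\<pi> n - \<pi> (n - 1)) * (exp (prim h T) - exp (prim h (\<tau> n))))"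
  proof -
    have sum_int: "integrable m (\<lambda>s. \<Sum>n=1..k. (\<pi> n - \<pi> (n - 1)) * (indicator {\<tau> n<..} s * f s))"
      by (intro Bochner_Integration.integrable_sum integrable_mult_right ind_int)
    have "(\<integral>s. (\<Sum>n=1..k. (\<pi> n - \<pi> (n - 1)) * (indicator {\<tau> n<..} s * f s)) \<partial>m)
        = (\<Sum>n=1..k. \<integral>s. (\<pi> n - \<pi> (n - 1)) * (indicator {\<tau> n<..} s * f s) \<partial>m)"
      by (rule Bochner_Integration.integral_sum) (intro integrable_mult_right ind_int)
    then show ?thesis
      unfolding Bochner_Integration.integral_add[OF f_int sum_int]
      by (simp only: f_total after integral_mult_right_zero)
  qed
  also have "\<dots> = exp (prim h T) * \<pi> k - 1 - (\<Sum>n=1..k. exp (prim h (\<tau> n)) * (\<pi> n - \<pi> (n - 1)))"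
  proof -
    have "(\<Sum>n=1..k. (\<pi> n - \<pi> (n - 1)) * (exp (prim h T) - exp (prim h (\<tau> n))))
        = exp (prim h T) * (\<Sum>n=1..k. \<pi> n - \<pi> (n - 1)) - (\<Sum>n=1..k. exp (prim h (\<tau> n)) * (\<pi> n - \<pi> (n - 1)))"
      unfolding sum_distrib_left sum_subtractf[symmetric] by (intro sum.cong refl) (simp add: algebra_simps)
    moreover have "(\<Sum>n=1..k. \<pi> n - \<pi> (n - 1)) = \<pi> k - 1"
      using tele[of k] by linarith
    ultimately show ?thesis
      by (simp add: right_diff_distrib)
  qed
  finally have *: "(\<integral>s. exp (prim h s) * (\<Prod>i\<in>{i\<in>{1..k}. \<tau> i < s}. r i) * h s \<partial>m)
      = exp (prim h T) * \<pi> k - 1 - (\<Sum>n=1..k. exp (prim h (\<tau> n)) * (\<pi> n - \<pi> (n - 1)))" .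
  have "(\<Sum>n=1..k. exp (prim h (\<tau> n)) * (\<Prod>i\<in>{i\<in>{1..k}. \<tau> i < \<tau> n}. r i) * (r n - 1))
      = (\<Sum>n=1..k. exp (prim h (\<tau> n)) * (\<pi> n - \<pi> (n - 1)))"
    by (intro sum.cong refl jump)
  then show ?thesis
    unfolding * \<pi>_def[symmetric] by linarith
qed

end

lemma atomless_time_measure_stieltjes:
  assumes "0 < T" "mono_on {0..T} a" "continuous_on {0..T} a"
  shows "atomless_time_measure (stieltjes T a) T"
proof -
  interpret finite_measure "stieltjes T a"
    by (rule finite_measure_stieltjes[OF assms])
  show ?thesis
    by unfold_locales (use AE_stieltjes_finite[OF assms, of "{_}"] sets_stieltjes[OF assms] in auto)
qed

section \<open>Predictability\<close>

context marked_point_process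
begin

abbreviation "\<P> \<equiv> predictable_sigma (space M) F T"

lemma filtration_F: "filtration (space M) F"
  using F_filtration by (simp add: mpp_filtration_def mpp_adapted_def)

lemma space_F: "space (F t) = space M"
  using filtration.space_F[OF filtration_F] .

lemma sets_F_mono: "s \<le> t \<Longrightarrow> sets (F s) \<subseteq> sets (F t)"
  using filtration.sets_F_mono[OF filtration_F] .

lemma stopping_time_S: "1 \<le> n \<Longrightarrow> stopping_time F (S n)"
  using F_filtration by (simp add: mpp_filtration_def mpp_adapted_def)

lemma X_pre_sigma: "1 \<le> n \<Longrightarrow> X n \<in> filtration.pre_sigma (space M) F (S n) \<rightarrow>\<^sub>M borel"
  using F_filtration by (simp add: mpp_filtration_def mpp_adapted_def)

text \<open>All the \<open>S n\<close> with \<open>n \<ge> 1\<close> being positive, the filtration that is trivial at time \<open>0\<close> and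
  contains every event afterwards is a competitor in the minimality of \<open>F\<close>. In particular
  \<open>F\<close> is trivial at time \<open>0\<close>, and all its events are measurable.\<close>

lemma sets_F_subset: "sets (F t) \<subseteq> sets (if t = 0 then sigma (space M) {} else M)"
proof -
  define G where "G t = (if t = 0 then sigma (space M) {} else M)" for t :: ennreal
  have filt: "filtration (space M) G"
  proof
    show "space (G i) = space M" for i
      by (simp add: G_def space_measure_of_conv)
    show "sets (G i) \<le> sets (G j)" if "i \<le> j" for i j
      using that by (auto simp: G_def sigma_sets_empty_eq)
  qed
  have st: "stopping_time G (S n)" if n: "1 \<le> n" for n
  proof
    fix t :: ennreal
    show "Measurable.pred (G t) (\<lambda>\<omega>. S n \<omega> \<le> t)"
    proof (cases "t = 0")
      case True
      have "S n \<omega> \<noteq> 0" if "\<omega> \<in> space M" for \<omega>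
        using S_range[OF that n] by auto
      then have "{\<omega> \<in> space M. S n \<omega> \<le> t} = {}"
        using True by auto
      then show ?thesis
        unfolding pred_def filtration.space_F[OF filt] by (simp only: sets.empty_sets)
    next
      case False
      with S_measurable[of n] show ?thesis
        by (simp add: G_def)
    qed
  qed
  have X: "X n \<in> filtration.pre_sigma (space M) G (S n) \<rightarrow>\<^sub>M borel" if n: "1 \<le> n" for n
  proof (rule measurableI)
    fix B :: "'k set" assume B: "B \<in> sets borel"
    have "X n -` B \<inter> space M \<in> sets (filtration.pre_sigma (space M) G (S n))"
    proof (rule filtration.sets_pre_sigmaI[OF filt st[OF n]])
      fix t
      have "{\<omega> \<in> X n -` B \<inter> space M. S n \<omega> \<le> t} = (X n -` B \<inter> space M) \<inter> {\<omega> \<in> space M. S n \<omega> \<le> t}"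
        by auto
      moreover have "{\<omega> \<in> space M. S n \<omega> \<le> t} \<in> sets (G t)"
        using st[OF n] filtration.space_F[OF filt] by (auto simp: stopping_time_def pred_def)
      moreover have "{\<omega> \<in> space M. S n \<omega> \<le> 0} = {}"
        using S_range[OF _ n] by force
      moreover have "{\<omega> \<in> X n -` B \<inter> space M. S n \<omega> \<le> 0} = {}"
        using \<open>{\<omega> \<in> space M. S n \<omega> \<le> 0} = {}\<close> by blast
      ultimately show "{\<omega> \<in> X n -` B \<inter> space M. S n \<omega> \<le> t} \<in> sets (G t)"
        using measurable_sets[OF X_measurable[of n] B]
        by (cases "t = 0") (simp_all only: sets.empty_sets, simp add: G_def sets.Int)
    qed
    then show "X n -` B \<inter> space (filtration.pre_sigma (space M) G (S n)) \<in> sets (filtration.pre_sigma (space M) G (S n))"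
      by (simp add: filtration.space_pre_sigma[OF filt])
  qed simp
  have "mpp_adapted (space M) S X G"
    using filt st X by (simp add: mpp_adapted_def)
  then have "sets (F t) \<subseteq> sets (G t)"
    using F_filtration by (simp only: mpp_filtration_def)
  then show ?thesis
    by (simp only: G_def)
qed

lemma sets_F_0: "B \<in> sets (F 0) \<Longrightarrow> B = {} \<or> B = space M"
  using sets_F_subset[of 0] by (auto simp: sigma_sets_empty_eq)

lemma sets_F_M: "sets (F t) \<subseteq> sets M"
  using sets_F_subset[of t] by (cases "t = 0") (auto simp: sigma_sets_empty_eq)

abbreviation "rectangles \<equiv> {B \<times> {0} | B. B \<in> sets (F 0)} \<union>
      {B \<times> {s<..t} | B s t. 0 \<le> s \<and> s \<le> t \<and> t \<le> T \<and> B \<in> sets (F (ennreal s))}"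

lemma rectangles_Pow: "rectangles \<subseteq> Pow (space M \<times> {0..T})"
  using T_pos sets.sets_into_space[of _ "F _"] by (fastforce simp: space_F)

lemma space_P: "space \<P> = space M \<times> {0..T}"
  unfolding predictable_sigma_def by (simp add: space_measure_of_conv)

lemma rectangle_0_sets: "B \<in> sets (F 0) \<Longrightarrow> B \<times> {0} \<in> sets \<P>"
  unfolding predictable_sigma_def by (subst sets_measure_of[OF rectangles_Pow]) (blast intro: sigma_sets.Basic)

lemma rectangle_sets:
  "B \<in> sets (F (ennreal s)) \<Longrightarrow> 0 \<le> s \<Longrightarrow> s \<le> t \<Longrightarrow> t \<le> T \<Longrightarrow> B \<times> {s<..t} \<in> sets \<P>"
  unfolding predictable_sigma_def by (subst sets_measure_of[OF rectangles_Pow]) (blast intro: sigma_sets.Basic)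

lemma measurable_P_I:
  assumes "f \<in> space N \<rightarrow> space M \<times> {0..T}"
    and "\<And>B. B \<in> sets (F 0) \<Longrightarrow> f -` (B \<times> {0}) \<inter> space N \<in> sets N"
    and "\<And>B s t. 0 \<le> s \<Longrightarrow> s \<le> t \<Longrightarrow> t \<le> T \<Longrightarrow> B \<in> sets (F (ennreal s)) \<Longrightarrow> f -` (B \<times> {s<..t}) \<inter> space N \<in> sets N"
  shows "f \<in> N \<rightarrow>\<^sub>M \<P>"
  unfolding predictable_sigma_def by (rule measurable_measure_of[OF rectangles_Pow assms(1)]) (use assms(2,3) in blast)

text \<open>Predictable sets are jointly measurable. Measurability of paths and of random variables is read off
  from this by freezing one coordinate.\<close>

lemma measurable_pair_P: "(\<lambda>x. x) \<in> M \<Otimes>\<^sub>M time_space T \<rightarrow>\<^sub>M \<P>"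
proof (rule measurable_P_I)
  show "(\<lambda>x. x) \<in> space (M \<Otimes>\<^sub>M time_space T) \<rightarrow> space M \<times> {0..T}"
    by (simp add: space_pair_measure)
  fix B assume "B \<in> sets (F 0)"
  then have "B \<times> {0} \<in> sets (M \<Otimes>\<^sub>M time_space T)"
    using T_pos sets_F_M by (intro pair_measureI) (auto simp: sets_restrict_space_iff)
  then show "(\<lambda>x. x) -` (B \<times> {0}) \<inter> space (M \<Otimes>\<^sub>M time_space T) \<in> sets (M \<Otimes>\<^sub>M time_space T)"
    by auto
next
  fix B s t assume "0 \<le> s" "s \<le> t" "t \<le> T" "B \<in> sets (F (ennreal s))"
  then have "B \<times> {s<..t} \<in> sets (M \<Otimes>\<^sub>M time_space T)"
    using T_pos sets_F_M by (intro pair_measureI) (auto simp: sets_restrict_space_iff)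
  then show "(\<lambda>x. x) -` (B \<times> {s<..t}) \<inter> space (M \<Otimes>\<^sub>M time_space T) \<in> sets (M \<Otimes>\<^sub>M time_space T)"
    by auto
qed

lemma measurable_P_imp: "f \<in> \<P> \<rightarrow>\<^sub>M N \<Longrightarrow> f \<in> M \<Otimes>\<^sub>M time_space T \<rightarrow>\<^sub>M N"
  by (rule measurable_compose[OF measurable_pair_P])

lemma measurable_PK_imp:
  assumes "f \<in> \<P> \<Otimes>\<^sub>M K \<rightarrow>\<^sub>M N"
  shows "f \<in> (M \<Otimes>\<^sub>M time_space T) \<Otimes>\<^sub>M K \<rightarrow>\<^sub>M N"
proof -
  have "(\<lambda>z. (fst z, snd z)) \<in> (M \<Otimes>\<^sub>M time_space T) \<Otimes>\<^sub>M K \<rightarrow>\<^sub>M \<P> \<Otimes>\<^sub>M K"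
    by (intro measurable_Pair measurable_compose[OF measurable_fst measurable_pair_P] measurable_snd)
  from measurable_compose[OF this assms] show ?thesis by simp
qed

lemma measurable_time_section: "\<omega> \<in> space M \<Longrightarrow> Pair \<omega> \<in> time_space T \<rightarrow>\<^sub>M \<P>"
  using measurable_compose[OF measurable_Pair1' measurable_pair_P] by simp

lemma measurable_event_section: "t \<in> {0..T} \<Longrightarrow> (\<lambda>\<omega>. (\<omega>, t)) \<in> M \<rightarrow>\<^sub>M \<P>"
  using measurable_compose[OF measurable_Pair2' measurable_pair_P, of t] by simp

lemma initial_strip_sets:
  assumes "B \<in> sets (F 0)" "0 \<le> t" "t \<le> T"
  shows "B \<times> {0..t} \<in> sets \<P>"
proof -
  have "B \<times> {0..t} = B \<times> {0} \<union> B \<times> {0<..t}"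
    using assms by auto
  with rectangle_0_sets[OF assms(1)] rectangle_sets[of B 0 t] assms show ?thesis
    by simp
qed

lemma space_sets_F: "space M \<in> sets (F t)"
  using sets.top[of "F t"] by (simp add: space_F)

text \<open>Stopping at a deterministic time \<open>b\<close> preserves predictability, even jointly in \<open>b\<close>: whether
  \<open>min t b\<close> exceeds \<open>s\<close> only involves events of \<open>F s\<close> when \<open>t\<close> does.\<close>

lemma measurable_P_min:
  "(\<lambda>((\<omega>, t), b). (\<omega>, min t b)) \<in> \<P> \<Otimes>\<^sub>M time_space T \<rightarrow>\<^sub>M \<P>" (is "?f \<in> ?N \<rightarrow>\<^sub>M _")
proof (rule measurable_P_I)
  have sp: "space ?N = (space M \<times> {0..T}) \<times> {0..T}"
    by (simp add: space_pair_measure space_P)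
  show "?f \<in> space ?N \<rightarrow> space M \<times> {0..T}"
    unfolding sp by auto
  {
    fix B assume B: "B \<in> sets (F 0)"
    then have "B \<subseteq> space M"
      using sets.sets_into_space[OF B] by (simp add: space_F)
    then have "?f -` (B \<times> {0}) \<inter> space ?N = (B \<times> {0}) \<times> {0..T} \<union> (B \<times> {0..T}) \<times> {0}"
      unfolding sp using T_pos by (auto simp: min_def split: if_splits)
    also have "\<dots> \<in> sets ?N"
      using rectangle_0_sets[OF B] initial_strip_sets[OF B] T_pos
      by (intro sets.Un pair_measureI) (auto simp: sets_restrict_space_iff)
    finally show "?f -` (B \<times> {0}) \<inter> space ?N \<in> sets ?N" .
  }
  fix B s t assume st: "0 \<le> s" "s \<le> t" "t \<le> T" and B: "B \<in> sets (F (ennreal s))"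
  then have "B \<subseteq> space M"
    using sets.sets_into_space[OF B] by (simp add: space_F)
  then have "?f -` (B \<times> {s<..t}) \<inter> space ?N
      = ((B \<times> {s<..T}) \<times> {s<..T}) \<inter> ((space M \<times> {0..t}) \<times> {0..T} \<union> (space M \<times> {0..T}) \<times> {0..t})"
    unfolding sp using st by (auto simp: min_def split: if_splits)
  also have "\<dots> \<in> sets ?N"
    using rectangle_sets[OF B, of T] initial_strip_sets[OF space_sets_F, of t] initial_strip_sets[OF space_sets_F, of T] st
    by (intro sets.Un sets.Int pair_measureI) (auto simp: sets_restrict_space_iff)
  finally show "?f -` (B \<times> {s<..t}) \<inter> space ?N \<in> sets ?N" .
qed

section \<open>Integrals against the compensator\<close>

lemma A_conds: "\<omega> \<in> space M \<Longrightarrow> mono_on {0..T} (A \<omega>)" "\<omega> \<in> space M \<Longrightarrow> continuous_on {0..T} (A \<omega>)"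
  using A_mono A_continuous by auto

lemma A_nonneg: "\<omega> \<in> space M \<Longrightarrow> t \<in> {0..T} \<Longrightarrow> 0 \<le> A \<omega> t"
  using mono_onD[OF A_mono, of \<omega> 0 t] A_0 by auto

lemma A_le: "\<omega> \<in> space M \<Longrightarrow> s \<in> {0..T} \<Longrightarrow> t \<in> {0..T} \<Longrightarrow> s \<le> t \<Longrightarrow> A \<omega> s \<le> A \<omega> t"
  using mono_onD[OF A_mono] by blast

lemma A_measurable: "t \<in> {0..T} \<Longrightarrow> (\<lambda>\<omega>. A \<omega> t) \<in> borel_measurable M"
  using measurable_compose[OF measurable_event_section A_predictable] by simp

abbreviation "dA \<omega> \<equiv> stieltjes T (A \<omega>)"

lemma sets_dA: "\<omega> \<in> space M \<Longrightarrow> sets (dA \<omega>) = sets (time_space T)"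
  using sets_stieltjes[OF T_pos A_conds] by simp

lemma space_dA: "\<omega> \<in> space M \<Longrightarrow> space (dA \<omega>) = {0..T}"
  using space_stieltjes[OF T_pos A_conds] by simp

lemma emeasure_dA_Icc: "\<omega> \<in> space M \<Longrightarrow> 0 \<le> t \<Longrightarrow> t \<le> T \<Longrightarrow> emeasure (dA \<omega>) {0..t} = ennreal (A \<omega> t)"
  using emeasure_stieltjes_Icc[OF T_pos A_conds] by (simp add: A_0)

lemma measure_dA_space: "\<omega> \<in> space M \<Longrightarrow> measure (dA \<omega>) (space (dA \<omega>)) = A \<omega> T"
  using emeasure_dA_Icc[of \<omega> T] T_pos A_nonneg[of \<omega> T] by (simp add: measure_def space_dA)

lemma emeasure_dA_space: "\<omega> \<in> space M \<Longrightarrow> emeasure (dA \<omega>) (space (dA \<omega>)) = ennreal (A \<omega> T)"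
  using emeasure_dA_Icc[of \<omega> T] T_pos by (simp add: space_dA)

lemma atomless_dA: "\<omega> \<in> space M \<Longrightarrow> atomless_time_measure (dA \<omega>) T"
  using atomless_time_measure_stieltjes[OF T_pos A_conds] by simp

lemma measurable_dA: "\<omega> \<in> space M \<Longrightarrow> measurable (dA \<omega>) N = measurable (time_space T) N"
  by (rule measurable_cong_sets[OF sets_dA refl])

lemma integral_indicator_dA:
  assumes \<omega>: "\<omega> \<in> space M" and t: "t \<in> {0..T}"
  shows "(\<integral>s. indicator {..t} s \<partial>dA \<omega>) = A \<omega> t"
proof -
  have "(\<integral>s. indicator {..t} s \<partial>dA \<omega>) = (\<integral>s. indicator {0..t} s \<partial>dA \<omega> :: real)"
    by (intro Bochner_Integration.integral_cong) (auto simp: space_dA[OF \<omega>] split: split_indicator)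
  also have "\<dots> = measure (dA \<omega>) {0..t}"
    using t by (subst Bochner_Integration.integral_indicator) (auto simp: space_dA[OF \<omega>] Int_absorb2)
  also have "\<dots> = A \<omega> t"
    using t emeasure_dA_Icc[OF \<omega>, of t] A_nonneg[OF \<omega> t] by (simp add: measure_def)
  finally show ?thesis .
qed

lemma measurable_nn_integral_dA:
  assumes "(\<lambda>(\<omega>, t). f \<omega> t) \<in> borel_measurable (M \<Otimes>\<^sub>M time_space T)"
  shows "(\<lambda>\<omega>. \<integral>\<^sup>+t. f \<omega> t \<partial>dA \<omega>) \<in> borel_measurable M"
proof (rule measurable_nn_integral_finite_kernel[where N="time_space T" and G="(\<lambda>b. {0..b}) ` {0..T}"])
  show "sets (time_space T) = sigma_sets (space (time_space T)) ((\<lambda>b. {0..b}) ` {0..T})"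
    using time_space_generator(1)[OF T_pos] by simp
  have "(\<lambda>\<omega>. emeasure (dA \<omega>) {0..b}) \<in> borel_measurable M" if "b \<in> {0..T}" for b
    using A_measurable[OF that] that by (simp add: emeasure_dA_Icc cong: measurable_cong)
  then show "\<And>B. B \<in> (\<lambda>b. {0..b}) ` {0..T} \<Longrightarrow> (\<lambda>\<omega>. emeasure (dA \<omega>) B) \<in> borel_measurable M"
    and "(\<lambda>\<omega>. emeasure (dA \<omega>) (space (time_space T))) \<in> borel_measurable M"
    using T_pos by auto
  show "emeasure (dA \<omega>) (space (time_space T)) < \<infinity>" if "\<omega> \<in> space M" for \<omega>
    using that emeasure_dA_Icc[of \<omega> T] T_pos by simp
qed (use assms time_space_generator(2)[OF T_pos] sets_dA in auto)

text \<open>Bochner integrals depend measurably on \<open>\<omega>\<close> without any integrability, because the paths on which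
  the integral takes its default value form a measurable set.\<close>

lemma measurable_integral_dA:
  fixes f :: "'a \<Rightarrow> real \<Rightarrow> real"
  assumes f: "(\<lambda>(\<omega>, t). f \<omega> t) \<in> borel_measurable (M \<Otimes>\<^sub>M time_space T)"
  shows "(\<lambda>\<omega>. \<integral>t. f \<omega> t \<partial>dA \<omega>) \<in> borel_measurable M"
proof -
  have nn: "(\<lambda>\<omega>. \<integral>\<^sup>+t. g (f \<omega> t) \<partial>dA \<omega>) \<in> borel_measurable M" if "g \<in> borel_measurable borel" for g
    using measurable_compose[OF f that] by (intro measurable_nn_integral_dA) (simp add: split_beta')
  have [measurable]: "(\<lambda>\<omega>. \<integral>\<^sup>+t. ennreal (f \<omega> t) \<partial>dA \<omega>) \<in> borel_measurable M"
    "(\<lambda>\<omega>. \<integral>\<^sup>+t. ennreal (- f \<omega> t) \<partial>dA \<omega>) \<in> borel_measurable M"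
    "(\<lambda>\<omega>. \<integral>\<^sup>+t. ennreal \<bar>f \<omega> t\<bar> \<partial>dA \<omega>) \<in> borel_measurable M"
    using nn[of ennreal] nn[of "\<lambda>r. ennreal (- r)"] nn[of "\<lambda>r. ennreal \<bar>r\<bar>"] by auto
  have "(\<lambda>\<omega>. if (\<integral>\<^sup>+t. ennreal \<bar>f \<omega> t\<bar> \<partial>dA \<omega>) < \<infinity>
      then enn2real (\<integral>\<^sup>+t. ennreal (f \<omega> t) \<partial>dA \<omega>) - enn2real (\<integral>\<^sup>+t. ennreal (- f \<omega> t) \<partial>dA \<omega>) else 0)
      \<in> borel_measurable M"
    by measurable
  then show ?thesis
  proof (rule measurable_cong[THEN iffD1, rotated])
    fix \<omega> assume \<omega>: "\<omega> \<in> space M"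
    have m: "(\<lambda>t. f \<omega> t) \<in> borel_measurable (dA \<omega>)"
      unfolding measurable_dA[OF \<omega>] using measurable_Pair2[OF f \<omega>] by simp
    show "(if (\<integral>\<^sup>+t. ennreal \<bar>f \<omega> t\<bar> \<partial>dA \<omega>) < \<infinity>
      then enn2real (\<integral>\<^sup>+t. ennreal (f \<omega> t) \<partial>dA \<omega>) - enn2real (\<integral>\<^sup>+t. ennreal (- f \<omega> t) \<partial>dA \<omega>) else 0)
      = (\<integral>t. f \<omega> t \<partial>dA \<omega>)"
      using m by (auto simp: real_lebesgue_integral_def integrable_iff_bounded not_integrable_integral_eq)
  qed
qed

text \<open>The indefinite integral of a predictable process against \<open>dA\<close> is predictable. Up to time \<open>t\<close> the
  integrand \<open>h \<omega> s\<close> coincides with \<open>h \<omega> (min t s)\<close>, which depends on \<open>(\<omega>, t)\<close> in a predictable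
  way; and \<open>dA\<close> restricted to \<open>[0, t]\<close> gives \<open>[0, b]\<close> the predictable mass \<open>A \<omega> (min t b)\<close>.\<close>

lemma predictable_nn_integral_dA:
  assumes h: "(\<lambda>(\<omega>, t). h \<omega> t) \<in> borel_measurable \<P>"
  shows "(\<lambda>(\<omega>, t). \<integral>\<^sup>+s. indicator {..t} s * h \<omega> s \<partial>dA \<omega>) \<in> borel_measurable \<P>"
proof -
  define \<kappa> where "\<kappa> = (\<lambda>(\<omega>, t). density (dA \<omega>) (indicator {..t}))"
  have ind: "indicator {..t} \<in> borel_measurable (dA \<omega>)" if "\<omega> \<in> space M" for \<omega> and t :: real
    unfolding measurable_dA[OF that] by (rule measurable_restrict_space1) simp
  have em: "emeasure (\<kappa> (\<omega>, t)) {0..b} = ennreal (A \<omega> (min t b))"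
    if "\<omega> \<in> space M" "t \<in> {0..T}" "b \<in> {0..T}" for \<omega> t b
  proof -
    have "emeasure (\<kappa> (\<omega>, t)) {0..b} = (\<integral>\<^sup>+s. indicator {..t} s * indicator {0..b} s \<partial>dA \<omega>)"
      unfolding \<kappa>_def using that by (simp add: ind emeasure_density sets_dA sets_restrict_space_iff)
    also have "\<dots> = (\<integral>\<^sup>+s. indicator {0..min t b} s \<partial>dA \<omega>)"
      by (intro nn_integral_cong) (auto split: split_indicator)
    also have "\<dots> = emeasure (dA \<omega>) {0..min t b}"
      using that by (intro nn_integral_indicator) (auto simp: sets_dA sets_restrict_space_iff)
    finally show ?thesis
      using emeasure_dA_Icc[OF that(1), of "min t b"] that by (simp add: min.coboundedI1)
  qed
  have Amin: "(\<lambda>(\<omega>, t). ennreal (A \<omega> (min t b))) \<in> borel_measurable \<P>" if "b \<in> {0..T}" for b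
  proof -
    have "(\<lambda>z. (z, b)) \<in> \<P> \<rightarrow>\<^sub>M \<P> \<Otimes>\<^sub>M time_space T"
      using that by (intro measurable_Pair2') simp
    from measurable_compose[OF measurable_compose[OF this measurable_P_min] A_predictable]
    show ?thesis by (simp add: split_beta')
  qed
  have "(\<lambda>z. \<integral>\<^sup>+s. h (fst z) (min (snd z) s) \<partial>\<kappa> z) \<in> borel_measurable \<P>"
  proof (rule measurable_nn_integral_finite_kernel[where N="time_space T" and G="(\<lambda>b. {0..b}) ` {0..T}"])
    show "sets (time_space T) = sigma_sets (space (time_space T)) ((\<lambda>b. {0..b}) ` {0..T})"
      using time_space_generator(1)[OF T_pos] by simp
    have *: "(\<lambda>z. emeasure (\<kappa> z) {0..b}) \<in> borel_measurable \<P>" if "b \<in> {0..T}" for b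
      by (rule measurable_cong[THEN iffD2, OF _ Amin[OF that]]) (use em that in \<open>auto simp: space_P\<close>)
    then show "\<And>B. B \<in> (\<lambda>b. {0..b}) ` {0..T} \<Longrightarrow> (\<lambda>z. emeasure (\<kappa> z) B) \<in> borel_measurable \<P>"
      and "(\<lambda>z. emeasure (\<kappa> z) (space (time_space T))) \<in> borel_measurable \<P>"
      using T_pos by auto
    show "emeasure (\<kappa> z) (space (time_space T)) < \<infinity>" if "z \<in> space \<P>" for z
      using that em[of "fst z" "snd z" T] T_pos by (auto simp: space_P)
    show "sets (\<kappa> z) = sets (time_space T)" if "z \<in> space \<P>" for z
      using that by (auto simp: \<kappa>_def space_P sets_dA)
    show "(\<lambda>(z, s). h (fst z) (min (snd z) s)) \<in> borel_measurable (\<P> \<Otimes>\<^sub>M time_space T)"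
      using measurable_compose[OF measurable_P_min h] by (simp add: split_beta')
  qed (use time_space_generator(2)[OF T_pos] in auto)
  moreover have "(\<integral>\<^sup>+s. h (fst z) (min (snd z) s) \<partial>\<kappa> z) = (case z of (\<omega>, t) \<Rightarrow> \<integral>\<^sup>+s. indicator {..t} s * h \<omega> s \<partial>dA \<omega>)"
    if z_P: "z \<in> space \<P>" for z
  proof -
    obtain \<omega> t where z: "z = (\<omega>, t)" "\<omega> \<in> space M" "t \<in> {0..T}"
      using z_P by (cases z) (auto simp: space_P)
    have "(\<lambda>s. ((\<omega>, t), s)) \<in> time_space T \<rightarrow>\<^sub>M \<P> \<Otimes>\<^sub>M time_space T"
      using z_P z by (intro measurable_Pair1') simp
    from measurable_compose[OF measurable_compose[OF this measurable_P_min] h]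
    have "(\<lambda>s. h \<omega> (min t s)) \<in> borel_measurable (dA \<omega>)"
      by (simp add: measurable_dA z)
    then have "(\<integral>\<^sup>+s. h \<omega> (min t s) \<partial>\<kappa> (\<omega>, t)) = (\<integral>\<^sup>+s. indicator {..t} s * h \<omega> (min t s) \<partial>dA \<omega>)"
      unfolding \<kappa>_def by (simp add: nn_integral_density ind z)
    also have "\<dots> = (\<integral>\<^sup>+s. indicator {..t} s * h \<omega> s \<partial>dA \<omega>)"
      by (intro nn_integral_cong) (auto split: split_indicator simp: min_def)
    finally show ?thesis
      by (simp add: z)
  qed
  ultimately show ?thesis
    by (simp cong: measurable_cong)
qed

lemma measurable_time_path:
  assumes "(\<lambda>(\<omega>, t). h \<omega> t) \<in> borel_measurable \<P>" "\<omega> \<in> space M"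
  shows "h \<omega> \<in> borel_measurable (dA \<omega>)"
  unfolding measurable_dA[OF assms(2)]
  using measurable_compose[OF measurable_time_section[OF assms(2)] assms(1)] by simp

lemma A_path_measurable: "\<omega> \<in> space M \<Longrightarrow> A \<omega> \<in> borel_measurable (dA \<omega>)"
  by (rule measurable_time_path[OF A_predictable])

lemma integrable_dA_bounded:
  fixes h :: "real \<Rightarrow> real"
  assumes "\<omega> \<in> space M" "h \<in> borel_measurable (dA \<omega>)" "\<And>t. t \<in> {0..T} \<Longrightarrow> \<bar>h t\<bar> \<le> K"
  shows "integrable (dA \<omega>) h"
proof -
  interpret atomless_time_measure "dA \<omega>" T by (rule atomless_dA[OF assms(1)])
  show ?thesis
    by (rule integrable_const_bound[where B=K]) (use assms in \<open>auto simp: space_dA\<close>)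
qed

lemma integrable_dA_const: "\<omega> \<in> space M \<Longrightarrow> integrable (dA \<omega>) (\<lambda>_. c::real)"
  by (rule integrable_dA_bounded[where K="\<bar>c\<bar>"]) auto

lemma AE_dA_not_in: "\<omega> \<in> space M \<Longrightarrow> finite E \<Longrightarrow> AE t in dA \<omega>. t \<notin> E"
  using AE_stieltjes_finite[OF T_pos A_conds] by blast

text \<open>As \<open>predictable_fun\<close>, but with values in any topological space: real and extended nonnegative
  integrands occur side by side.\<close>

abbreviation "predictable_field H \<equiv> (\<lambda>((\<omega>, t), x). H \<omega> t x) \<in> borel_measurable (\<P> \<Otimes>\<^sub>M borel)"

lemma predictable_field_const: "predictable_field (\<lambda>_ _ _. c)"
  by (simp add: split_beta')

lemma measurable_field_ennreal:
  fixes R :: "'a \<Rightarrow> real \<Rightarrow> 'k \<Rightarrow> real"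
  shows "predictable_field R \<Longrightarrow> predictable_field (\<lambda>\<omega> t x. ennreal (R \<omega> t x))"
  using measurable_compose[OF _ measurable_ennreal, of "\<lambda>((\<omega>, t), x). R \<omega> t x"] by (simp add: split_beta')

lemma measurable_field_abs:
  fixes Z :: "'a \<Rightarrow> real \<Rightarrow> 'k \<Rightarrow> real"
  assumes Z: "predictable_field Z"
  shows "predictable_field (\<lambda>\<omega> t x. ennreal \<bar>Z \<omega> t x\<bar>)"
proof -
  have "(\<lambda>z. ennreal \<bar>Z (fst (fst z)) (snd (fst z)) (snd z)\<bar>) \<in> borel_measurable (\<P> \<Otimes>\<^sub>M borel)"
    using Z by (intro measurable_compose[OF _ measurable_ennreal] borel_measurable_abs) (simp add: split_beta')
  then show ?thesis by (simp add: split_beta')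
qed

lemma measurable_field_times:
  fixes R H :: "'a \<Rightarrow> real \<Rightarrow> 'k \<Rightarrow> ennreal"
  shows "predictable_field R \<Longrightarrow> predictable_field H \<Longrightarrow> predictable_field (\<lambda>\<omega> t x. R \<omega> t x * H \<omega> t x)"
  using borel_measurable_times_ennreal[of "\<lambda>((\<omega>, t), x). R \<omega> t x" _ "\<lambda>((\<omega>, t), x). H \<omega> t x"] by (simp add: split_beta')

lemma \<phi>_subprob: "(\<lambda>(\<omega>, t). \<phi> \<omega> t) \<in> \<P> \<rightarrow>\<^sub>M subprob_algebra borel"
  by (rule measurable_prob_algebraD[OF \<phi>_kernel])

lemma \<phi>_section: "\<omega> \<in> space M \<Longrightarrow> \<phi> \<omega> \<in> dA \<omega> \<rightarrow>\<^sub>M subprob_algebra borel"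
  using measurable_compose[OF measurable_time_section \<phi>_subprob] by (simp add: measurable_dA)

lemma prob_\<phi>: "\<omega> \<in> space M \<Longrightarrow> t \<in> {0..T} \<Longrightarrow> prob_space (\<phi> \<omega> t)"
  and sets_\<phi>: "\<omega> \<in> space M \<Longrightarrow> t \<in> {0..T} \<Longrightarrow> sets (\<phi> \<omega> t) = sets borel"
  using measurable_space[OF \<phi>_kernel, of "(\<omega>, t)"] by (auto simp: space_P space_prob_algebra)

lemma measurable_field_section:
  assumes "predictable_field H" "\<omega> \<in> space M"
  shows "(\<lambda>(t, x). H \<omega> t x) \<in> borel_measurable (dA \<omega> \<Otimes>\<^sub>M borel)"
proof -
  have "(\<lambda>z. ((\<omega>, fst z), snd z)) \<in> time_space T \<Otimes>\<^sub>M borel \<rightarrow>\<^sub>M \<P> \<Otimes>\<^sub>M borel"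
    by (intro measurable_Pair measurable_compose[OF measurable_fst measurable_time_section[OF assms(2)]] measurable_snd)
  from measurable_compose[OF this assms(1)] show ?thesis
    by (simp add: split_beta' measurable_cong_sets[OF sets_pair_measure_cong[OF sets_dA[OF assms(2)] refl] refl])
qed

lemma measurable_mark_section:
  assumes "predictable_field H" "\<omega> \<in> space M" "t \<in> {0..T}"
  shows "(\<lambda>x. H \<omega> t x) \<in> borel_measurable (\<phi> \<omega> t)"
  using measurable_Pair2[OF assms(1), of "(\<omega>, t)"] assms
  by (simp add: space_P measurable_cong_sets[OF sets_\<phi> refl])

lemma predictable_mark_nn_integral:
  fixes H :: "'a \<Rightarrow> real \<Rightarrow> 'k \<Rightarrow> ennreal"
  assumes "predictable_field H"
  shows "(\<lambda>(\<omega>, t). \<integral>\<^sup>+x. H \<omega> t x \<partial>\<phi> \<omega> t) \<in> borel_measurable \<P>"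
  using nn_integral_measurable_subprob_algebra2[of "\<lambda>z x. H (fst z) (snd z) x" \<P> borel, OF _ \<phi>_subprob] assms
  by (simp add: split_beta')

lemma predictable_mark_integral:
  fixes H :: "'a \<Rightarrow> real \<Rightarrow> 'k \<Rightarrow> real"
  assumes "predictable_field H"
  shows "(\<lambda>(\<omega>, t). \<integral>x. H \<omega> t x \<partial>\<phi> \<omega> t) \<in> borel_measurable \<P>"
  using measurable_integral_kernel[of "\<lambda>z x. H (fst z) (snd z) x" \<P> borel, OF _ \<phi>_subprob] assms
  by (simp add: split_beta')

lemma nn_integral_compensator:
  fixes H :: "'a \<Rightarrow> real \<Rightarrow> 'k \<Rightarrow> ennreal"
  assumes "predictable_field H" "\<omega> \<in> space M"
  shows "(\<integral>\<^sup>+(t, x). H \<omega> t x \<partial>compensator T A \<phi> \<omega>) = (\<integral>\<^sup>+t. \<integral>\<^sup>+x. H \<omega> t x \<partial>\<phi> \<omega> t \<partial>dA \<omega>)"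
  unfolding compensator_def
  using nn_integral_kernel_product[OF \<phi>_section measurable_field_section[OF assms]] assms(2) by simp

lemma measurable_compensator_integral:
  fixes H :: "'a \<Rightarrow> real \<Rightarrow> 'k \<Rightarrow> ennreal"
  assumes "predictable_field H"
  shows "(\<lambda>\<omega>. \<integral>\<^sup>+t. \<integral>\<^sup>+x. H \<omega> t x \<partial>\<phi> \<omega> t \<partial>dA \<omega>) \<in> borel_measurable M"
  by (rule measurable_nn_integral_dA) (rule measurable_P_imp[OF predictable_mark_nn_integral[OF assms]])

section \<open>Jump times\<close>

definition jumps :: "'a \<Rightarrow> nat set" where
  "jumps \<omega> = {n. 1 \<le> n \<and> S n \<omega> \<le> ennreal T}"

text \<open>Meaningful on \<open>jumps \<omega>\<close>, where \<open>S n \<omega>\<close> is finite.\<close>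

definition \<tau> :: "nat \<Rightarrow> 'a \<Rightarrow> real" where
  "\<tau> n \<omega> = enn2real (S n \<omega>)"

lemma S_le: "\<omega> \<in> space M \<Longrightarrow> i \<le> j \<Longrightarrow> S i \<omega> \<le> S j \<omega>"
  by (rule lift_Suc_mono_le[of "\<lambda>n. S n \<omega>"]) (auto intro: S_mono)

lemma S_less: "\<omega> \<in> space M \<Longrightarrow> i < j \<Longrightarrow> S i \<omega> \<le> ennreal T \<Longrightarrow> S i \<omega> < S j \<omega>"
  using S_strict[of \<omega> i] S_le[of \<omega> "Suc i" j] by auto

text \<open>Non-explosion leaves finitely many jumps up to time \<open>T\<close>, numbered without gaps.\<close>

lemma jumps_interval:
  assumes "\<omega> \<in> space M"
  obtains m where "jumps \<omega> = {1..m}"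
proof -
  obtain k where k: "ennreal T < S k \<omega>"
    using non_explosive[OF assms] by blast
  define m where "m = (LEAST k. ennreal T < S (Suc k) \<omega>)"
  have "\<exists>k. ennreal T < S (Suc k) \<omega>"
    using k S_mono[OF assms, of k] by (auto intro: less_le_trans)
  then have m: "ennreal T < S (Suc m) \<omega>"
    unfolding m_def by (rule LeastI_ex)
  have "n \<in> jumps \<omega> \<longleftrightarrow> n \<in> {1..m}" for n
  proof
    assume "n \<in> jumps \<omega>"
    then have "1 \<le> n" "S n \<omega> \<le> ennreal T" by (auto simp: jumps_def)
    moreover have "\<not> Suc m \<le> n"
      using S_le[OF assms, of "Suc m" n] m calculation(2) by auto
    ultimately show "n \<in> {1..m}" by simp
  next
    assume "n \<in> {1..m}"
    then have "n - 1 < m" "Suc (n - 1) = n" by auto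
    then show "n \<in> jumps \<omega>"
      using not_less_Least[of "n - 1" "\<lambda>k. ennreal T < S (Suc k) \<omega>"] \<open>n \<in> {1..m}\<close>
      by (auto simp: jumps_def m_def not_less)
  qed
  then show ?thesis
    using that by blast
qed

lemma finite_jumps: "\<omega> \<in> space M \<Longrightarrow> finite (jumps \<omega>)"
  using jumps_interval by (metis finite_atLeastAtMost)

lemma S_eq_\<tau>:
  assumes "\<omega> \<in> space M" "n \<in> jumps \<omega>"
  shows "S n \<omega> = ennreal (\<tau> n \<omega>)" and "0 < \<tau> n \<omega>" and "\<tau> n \<omega> \<le> T"
proof -
  have n: "1 \<le> n" "S n \<omega> \<le> ennreal T" using assms(2) by (auto simp: jumps_def)
  then have "S n \<omega> < top" using le_less_trans ennreal_less_top by blast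
  then show 1: "S n \<omega> = ennreal (\<tau> n \<omega>)" by (simp add: \<tau>_def)
  have "0 < S n \<omega>" using S_range[OF assms(1) n(1)] by auto
  then show "0 < \<tau> n \<omega>" unfolding 1 by simp
  show "\<tau> n \<omega> \<le> T" using n(2) T_pos unfolding 1 by (simp add: ennreal_le_iff)
qed

lemma \<tau>_in: "\<omega> \<in> space M \<Longrightarrow> n \<in> jumps \<omega> \<Longrightarrow> \<tau> n \<omega> \<in> {0..T}"
  using S_eq_\<tau>(2,3)[of \<omega> n] by auto

lemma \<tau>_less_iff: "\<omega> \<in> space M \<Longrightarrow> n \<in> jumps \<omega> \<Longrightarrow> 0 \<le> s \<Longrightarrow> S n \<omega> < ennreal s \<longleftrightarrow> \<tau> n \<omega> < s"
  using S_eq_\<tau>[of \<omega> n] by (simp add: ennreal_less_iff)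

lemma \<tau>_strict:
  assumes "\<omega> \<in> space M" "i \<in> jumps \<omega>" "j \<in> jumps \<omega>" "i < j"
  shows "\<tau> i \<omega> < \<tau> j \<omega>"
proof -
  have "S i \<omega> < S j \<omega>"
    using assms by (intro S_less) (auto simp: jumps_def)
  then show ?thesis
    using S_eq_\<tau>[OF assms(1,2)] S_eq_\<tau>[OF assms(1,3)] by (simp add: ennreal_less_iff)
qed

lemma \<tau>_less_iff_index:
  assumes "\<omega> \<in> space M" "i \<in> jumps \<omega>" "j \<in> jumps \<omega>"
  shows "\<tau> i \<omega> < \<tau> j \<omega> \<longleftrightarrow> i < j"
  using \<tau>_strict[OF assms] \<tau>_strict[OF assms(1,3,2)] by (metis less_asym less_irrefl linorder_neqE_nat)

lemma past_jumps_eq: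
  assumes "\<omega> \<in> space M" "n \<in> jumps \<omega>"
  shows "{i\<in>jumps \<omega>. \<tau> i \<omega> < \<tau> n \<omega>} = {1..<n}"
proof -
  obtain k where k: "jumps \<omega> = {1..k}" by (rule jumps_interval[OF assms(1)])
  show ?thesis
    using \<tau>_less_iff_index[OF assms(1) _ assms(2)] assms(2) unfolding k by auto
qed

lemma jump_measure_map:
  "\<omega> \<in> space M \<Longrightarrow> (\<lambda>n. (enn2real (S n \<omega>), X n \<omega>)) \<in> count_space {n. 1 \<le> n \<and> S n \<omega> \<le> ennreal T} \<rightarrow>\<^sub>M time_space T \<Otimes>\<^sub>M borel"
  using S_eq_\<tau>[of \<omega>] by (auto simp: space_pair_measure jumps_def \<tau>_def intro: less_imp_le)

lemma nn_integral_jump_measure: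
  assumes "\<omega> \<in> space M" "f \<in> borel_measurable (time_space T \<Otimes>\<^sub>M borel)"
  shows "(\<integral>\<^sup>+z. f z \<partial>jump_measure T S X \<omega>) = (\<Sum>n\<in>jumps \<omega>. f (\<tau> n \<omega>, X n \<omega>))"
  unfolding jump_measure_def
  using assms finite_jumps[OF assms(1)]
  by (subst nn_integral_distr[OF jump_measure_map]) (auto simp: nn_integral_count_space_finite jumps_def \<tau>_def)

lemma integral_jump_measure:
  fixes f :: "_ \<Rightarrow> real"
  assumes "\<omega> \<in> space M" "f \<in> borel_measurable (time_space T \<Otimes>\<^sub>M borel)"
  shows "(\<integral>z. f z \<partial>jump_measure T S X \<omega>) = (\<Sum>n\<in>jumps \<omega>. f (\<tau> n \<omega>, X n \<omega>))"
  unfolding jump_measure_def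
  using assms finite_jumps[OF assms(1)]
  by (subst integral_distr[OF jump_measure_map]) (auto simp: lebesgue_integral_count_space_finite jumps_def \<tau>_def)

lemma compensation_sum:
  fixes H :: "'a \<Rightarrow> real \<Rightarrow> 'k \<Rightarrow> ennreal"
  assumes "predictable_field H"
  shows "(\<integral>\<^sup>+\<omega>. (\<Sum>n\<in>jumps \<omega>. H \<omega> (\<tau> n \<omega>) (X n \<omega>)) \<partial>M) = (\<integral>\<^sup>+\<omega>. \<integral>\<^sup>+t. \<integral>\<^sup>+x. H \<omega> t x \<partial>\<phi> \<omega> t \<partial>dA \<omega> \<partial>M)"
proof -
  have "(\<integral>\<^sup>+(t, x). H \<omega> t x \<partial>jump_measure T S X \<omega>) = (\<Sum>n\<in>jumps \<omega>. H \<omega> (\<tau> n \<omega>) (X n \<omega>))"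
    if "\<omega> \<in> space M" for \<omega>
    using nn_integral_jump_measure[OF that, of "\<lambda>(t, x). H \<omega> t x"] measurable_field_section[OF assms that]
    by (simp add: measurable_cong_sets[OF sets_pair_measure_cong[OF sets_dA[OF that] refl] refl])
  then show ?thesis
    using compensation[OF assms] by (simp add: nn_integral_compensator[OF assms] cong: nn_integral_cong)
qed

lemma measurable_jump_value:
  assumes H: "predictable_field H" and n: "1 \<le> n"
  shows "(\<lambda>\<omega>. if n \<in> jumps \<omega> then H \<omega> (\<tau> n \<omega>) (X n \<omega>) else c) \<in> borel_measurable M"
proof -
  have [measurable]: "S n \<in> borel_measurable M" "X n \<in> M \<rightarrow>\<^sub>M borel"
    by (rule S_measurable X_measurable)+
  have "(\<lambda>\<omega>. min T (enn2real (S n \<omega>))) \<in> M \<rightarrow>\<^sub>M time_space T"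
    using T_pos by (intro measurable_restrict_space2) auto
  then have "(\<lambda>\<omega>. ((\<omega>, min T (enn2real (S n \<omega>))), X n \<omega>)) \<in> M \<rightarrow>\<^sub>M (M \<Otimes>\<^sub>M time_space T) \<Otimes>\<^sub>M borel"
    by measurable
  from measurable_compose[OF this measurable_PK_imp[OF H]]
  have [measurable]: "(\<lambda>\<omega>. H \<omega> (min T (enn2real (S n \<omega>))) (X n \<omega>)) \<in> borel_measurable M"
    by simp
  have "(\<lambda>\<omega>. if S n \<omega> \<le> ennreal T then H \<omega> (min T (enn2real (S n \<omega>))) (X n \<omega>) else c) \<in> borel_measurable M"
    by measurable
  moreover have "(if S n \<omega> \<le> ennreal T then H \<omega> (min T (enn2real (S n \<omega>))) (X n \<omega>) else c)
      = (if n \<in> jumps \<omega> then H \<omega> (\<tau> n \<omega>) (X n \<omega>) else c)" if "\<omega> \<in> space M" for \<omega>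
    using n S_eq_\<tau>(3)[OF that, of n] by (auto simp: jumps_def \<tau>_def)
  ultimately show ?thesis
    by (simp cong: measurable_cong)
qed

text \<open>The indicator of \<open>{S n < s}\<close>, restricted to an event of the past of \<open>S n\<close>, is left-continuous and
  adapted in \<open>s\<close>, hence predictable; explicitly, a rational time fits between \<open>S n\<close> and \<open>s\<close>.\<close>

lemma strict_past_sets:
  assumes C: "C \<subseteq> space M" and n: "1 \<le> n"
    and adapted: "\<And>q. 0 \<le> q \<Longrightarrow> q \<le> T \<Longrightarrow> {\<omega> \<in> C. S n \<omega> \<le> ennreal q} \<in> sets (F (ennreal q))"
  shows "{(\<omega>, s) \<in> space \<P>. \<omega> \<in> C \<and> S n \<omega> < ennreal s} \<in> sets \<P>"
proof -
  define Q where "Q = {q \<in> \<rat>. 0 \<le> q \<and> q \<le> T}"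
  have "countable Q" unfolding Q_def by (rule countable_subset[OF _ countable_rat]) auto
  have "{(\<omega>, s) \<in> space \<P>. \<omega> \<in> C \<and> S n \<omega> < ennreal s} = (\<Union>q\<in>Q. {\<omega> \<in> C. S n \<omega> \<le> ennreal q} \<times> {q<..T})"
  proof (intro set_eqI iffI; clarsimp)
    fix \<omega> s assume *: "(\<omega>, s) \<in> space \<P>" "\<omega> \<in> C" "S n \<omega> < ennreal s"
    then have s: "0 \<le> s" "s \<le> T" by (auto simp: space_P)
    have fin: "S n \<omega> = ennreal (enn2real (S n \<omega>))"
      using *(3) less_trans[OF _ ennreal_less_top] by simp
    then have "enn2real (S n \<omega>) < s"
      using *(3) s by (metis ennreal_less_iff enn2real_nonneg)
    then obtain q where q: "q \<in> \<rat>" "enn2real (S n \<omega>) < q" "q < s"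
      using Rats_dense_in_real by blast
    then have "0 \<le> q" using enn2real_nonneg[of "S n \<omega>"] by linarith
    have "S n \<omega> \<le> ennreal q"
      using q(2) fin by (metis ennreal_leI less_imp_le)
    then show "\<exists>q\<in>Q. S n \<omega> \<le> ennreal q \<and> q < s \<and> s \<le> T"
      using q s \<open>0 \<le> q\<close> unfolding Q_def by (intro bexI[of _ q]) auto
  next
    fix \<omega> s q assume *: "q \<in> Q" "\<omega> \<in> C" "S n \<omega> \<le> ennreal q" "q < s" "s \<le> T"
    then have "ennreal q < ennreal s" by (auto simp: Q_def ennreal_less_iff)
    then show "(\<omega>, s) \<in> space \<P> \<and> S n \<omega> < ennreal s"
      using * C by (auto simp: space_P Q_def)
  qed
  also have "\<dots> \<in> sets \<P>"
  proof (rule sets.countable_UN''[OF \<open>countable Q\<close>])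
    fix q assume "q \<in> Q"
    then show "{\<omega> \<in> C. S n \<omega> \<le> ennreal q} \<times> {q<..T} \<in> sets \<P>"
      using adapted by (intro rectangle_sets) (auto simp: Q_def)
  qed
  finally show ?thesis .
qed

lemma stopped_event_sets: "1 \<le> n \<Longrightarrow> {\<omega> \<in> space M. S n \<omega> \<le> t} \<in> sets (F t)"
  using stopping_timeD[OF stopping_time_S, of n t] by (simp add: pred_def space_F)

text \<open>What happened at the \<open>n\<close>-th jump is known strictly afterwards. The map \<open>(\<omega>, s) \<mapsto> ((\<omega>, S n), X n)\<close>
  on \<open>{S n < s}\<close> is measurable for the predictable sets, as the preimage of a predictable rectangle
  is an event of the past of \<open>S n\<close> seen after time \<open>S n\<close>.\<close>

lemma predictable_jump_value:
  assumes H: "predictable_field H" and n: "1 \<le> n"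
  shows "(\<lambda>(\<omega>, s). if S n \<omega> < ennreal s then H \<omega> (\<tau> n \<omega>) (X n \<omega>) else c) \<in> borel_measurable \<P>"
proof -
  define D where "D = {(\<omega>, s) \<in> space \<P>. \<omega> \<in> space M \<and> S n \<omega> < ennreal s}"
  have D: "D \<in> sets \<P>"
    unfolding D_def by (rule strict_past_sets[OF subset_refl n stopped_event_sets[OF n]])
  let ?N = "restrict_space \<P> D"
  have sp: "space ?N = D"
    using D by simp
  have pre: "E \<in> sets ?N"
    if "E = {(\<omega>, s) \<in> space \<P>. \<omega> \<in> C \<and> S n \<omega> < ennreal s}" "C \<subseteq> space M"
      "\<And>q. 0 \<le> q \<Longrightarrow> q \<le> T \<Longrightarrow> {\<omega> \<in> C. S n \<omega> \<le> ennreal q} \<in> sets (F (ennreal q))"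
    for E C
    unfolding that(1) using strict_past_sets[OF that(2) n that(3)] D that(2)
    by (subst sets_restrict_space_iff) (auto simp: D_def)
  have pos: "0 < enn2real (S n \<omega>)" "enn2real (S n \<omega>) \<le> T" if "(\<omega>, s) \<in> D" for \<omega> s
  proof -
    have "S n \<omega> \<le> ennreal T"
      using that by (auto simp: D_def space_P intro: order_trans[OF less_imp_le ennreal_leI])
    then have "n \<in> jumps \<omega>" using n by (simp add: jumps_def)
    then show "0 < enn2real (S n \<omega>)" "enn2real (S n \<omega>) \<le> T"
      using S_eq_\<tau>[of \<omega> n] that by (auto simp: D_def \<tau>_def space_P)
  qed
  have S_iff: "S n \<omega> \<le> ennreal q \<longleftrightarrow> enn2real (S n \<omega>) \<le> q" if "(\<omega>, s) \<in> D" "0 \<le> q" for \<omega> s q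
  proof -
    have "S n \<omega> = ennreal (enn2real (S n \<omega>))"
      using that less_trans[OF _ ennreal_less_top] by (auto simp: D_def)
    then show ?thesis
      using that(2) by (metis ennreal_le_iff)
  qed
  have t: "(\<lambda>(\<omega>, s). (\<omega>, enn2real (S n \<omega>))) \<in> ?N \<rightarrow>\<^sub>M \<P>" (is "?t \<in> _")
  proof (rule measurable_P_I)
    show "?t \<in> space ?N \<rightarrow> space M \<times> {0..T}"
      unfolding sp using pos by (force simp: D_def space_P)
    show "?t -` (B \<times> {0}) \<inter> space ?N \<in> sets ?N" for B
    proof -
      have "?t -` (B \<times> {0}) \<inter> space ?N = {}"
        unfolding sp using pos by (auto; fastforce)
      then show ?thesis by (simp only: sets.empty_sets)
    qed
    fix B a b assume ab: "0 \<le> a" "a \<le> b" "b \<le> T" and B: "B \<in> sets (F (ennreal a))"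
    let ?C = "{\<omega> \<in> B. \<not> S n \<omega> \<le> ennreal a \<and> S n \<omega> \<le> ennreal b}"
    have BM: "B \<subseteq> space M" using sets.sets_into_space[OF B] by (simp add: space_F)
    show "?t -` (B \<times> {a<..b}) \<inter> space ?N \<in> sets ?N"
    proof (rule pre[of _ ?C])
      have "(\<omega>, s) \<in> ?t -` (B \<times> {a<..b}) \<inter> D \<longleftrightarrow> (\<omega>, s) \<in> {(\<omega>, s) \<in> space \<P>. \<omega> \<in> ?C \<and> S n \<omega> < ennreal s}" for \<omega> s
        using S_iff[of \<omega> s a] S_iff[of \<omega> s b] ab BM by (auto simp: D_def)
      then show "?t -` (B \<times> {a<..b}) \<inter> space ?N = {(\<omega>, s) \<in> space \<P>. \<omega> \<in> ?C \<and> S n \<omega> < ennreal s}"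
        unfolding sp by (auto simp: set_eq_iff)
      show "?C \<subseteq> space M" using BM by auto
      fix q assume q: "0 \<le> q" "q \<le> T"
      show "{\<omega> \<in> ?C. S n \<omega> \<le> ennreal q} \<in> sets (F (ennreal q))"
      proof (cases "a \<le> q")
        case True
        have "{\<omega> \<in> ?C. S n \<omega> \<le> ennreal q}
          = B \<inter> {\<omega> \<in> space M. S n \<omega> \<le> ennreal (min b q)} - {\<omega> \<in> space M. S n \<omega> \<le> ennreal a}"
          using BM q ab by (auto simp: min_def ennreal_leI intro: order_trans)
        moreover have "B \<in> sets (F (ennreal q))"
          using B sets_F_mono[of "ennreal a" "ennreal q"] True by (auto simp: ennreal_leI)
        moreover have "{\<omega> \<in> space M. S n \<omega> \<le> ennreal (min b q)} \<in> sets (F (ennreal q))"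
          using stopped_event_sets[OF n, of "ennreal (min b q)"] sets_F_mono[of "ennreal (min b q)" "ennreal q"]
          by (auto simp: ennreal_leI)
        moreover have "{\<omega> \<in> space M. S n \<omega> \<le> ennreal a} \<in> sets (F (ennreal q))"
          using stopped_event_sets[OF n, of "ennreal a"] sets_F_mono[of "ennreal a" "ennreal q"] True
          by (auto simp: ennreal_leI)
        ultimately show ?thesis by auto
      next
        case False
        then have "{\<omega> \<in> ?C. S n \<omega> \<le> ennreal q} = {}"
          using ennreal_leI[of q a] by (auto dest: order_trans)
        then show ?thesis by (simp only: sets.empty_sets)
      qed
    qed
  qed
  have x: "(\<lambda>(\<omega>, s). X n \<omega>) \<in> ?N \<rightarrow>\<^sub>M borel" (is "?x \<in> _")
  proof (rule measurableI)
    fix B :: "'k set" assume B: "B \<in> sets borel"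
    show "?x -` B \<inter> space ?N \<in> sets ?N"
    proof (rule pre[of _ "X n -` B \<inter> space M"])
      show "?x -` B \<inter> space ?N = {(\<omega>, s) \<in> space \<P>. \<omega> \<in> X n -` B \<inter> space M \<and> S n \<omega> < ennreal s}"
        unfolding sp by (auto simp: D_def)
      have "X n -` B \<inter> space M \<in> sets (filtration.pre_sigma (space M) F (S n))"
        using measurable_sets[OF X_pre_sigma[OF n] B] by (simp add: filtration.space_pre_sigma[OF filtration_F])
      then show "{\<omega> \<in> X n -` B \<inter> space M. S n \<omega> \<le> ennreal q} \<in> sets (F (ennreal q))" for q
        by (rule filtration.sets_pre_sigmaD[OF filtration_F stopping_time_S[OF n]])
    qed simp
  qed simp
  have "(\<lambda>z. (?t z, ?x z)) \<in> ?N \<rightarrow>\<^sub>M \<P> \<Otimes>\<^sub>M borel"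
    using t x by (rule measurable_Pair)
  from measurable_compose[OF this H]
  have 1: "(\<lambda>(\<omega>, s). H \<omega> (\<tau> n \<omega>) (X n \<omega>)) \<in> borel_measurable ?N"
    by (simp add: split_beta' \<tau>_def)
  have "(\<lambda>z. if z \<in> D then (case z of (\<omega>, s) \<Rightarrow> H \<omega> (\<tau> n \<omega>) (X n \<omega>)) else c) \<in> borel_measurable \<P>"
    using 1 D by (subst measurable_If_restrict_space_iff) (simp_all add: pred_def Int_def[symmetric] Collect_conj_eq sets.Int_space_eq1)
  then show ?thesis
    by (rule measurable_cong[THEN iffD1, rotated]) (auto simp: D_def space_P split: if_splits)
qed

lemma measurable_jump_sum:
  fixes H :: "'a \<Rightarrow> real \<Rightarrow> 'k \<Rightarrow> real"
  assumes "predictable_field H"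
  shows "(\<lambda>\<omega>. \<Sum>n\<in>jumps \<omega>. H \<omega> (\<tau> n \<omega>) (X n \<omega>)) \<in> borel_measurable M"
proof (rule borel_measurable_eventually_const)
  show "(\<lambda>\<omega>. \<Sum>n=1..k. if n \<in> jumps \<omega> then H \<omega> (\<tau> n \<omega>) (X n \<omega>) else 0) \<in> borel_measurable M" for k
    by (intro borel_measurable_sum measurable_jump_value[OF assms]) simp
  fix \<omega> assume "\<omega> \<in> space M"
  then obtain m where m: "jumps \<omega> = {1..m}" by (rule jumps_interval)
  show "\<forall>\<^sub>F k in sequentially. (\<Sum>n=1..k. if n \<in> jumps \<omega> then H \<omega> (\<tau> n \<omega>) (X n \<omega>) else 0) = (\<Sum>n\<in>jumps \<omega>. H \<omega> (\<tau> n \<omega>) (X n \<omega>))"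
    using eventually_ge_at_top[of m]
    by eventually_elim (auto simp: m intro!: sum.mono_neutral_cong_right)
qed

lemma measurable_jump_sum_ennreal:
  fixes H :: "'a \<Rightarrow> real \<Rightarrow> 'k \<Rightarrow> ennreal"
  assumes "predictable_field H"
  shows "(\<lambda>\<omega>. \<Sum>n\<in>jumps \<omega>. H \<omega> (\<tau> n \<omega>) (X n \<omega>)) \<in> borel_measurable M"
proof -
  have "(\<lambda>\<omega>. \<Sum>n. if n + 1 \<in> jumps \<omega> then H \<omega> (\<tau> (n + 1) \<omega>) (X (n + 1) \<omega>) else 0) \<in> borel_measurable M"
    by (intro borel_measurable_suminf_order measurable_jump_value[OF assms]) simp
  moreover have "(\<Sum>n. if n + 1 \<in> jumps \<omega> then H \<omega> (\<tau> (n + 1) \<omega>) (X (n + 1) \<omega>) else 0) = (\<Sum>n\<in>jumps \<omega>. H \<omega> (\<tau> n \<omega>) (X n \<omega>))"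
    if \<omega>: "\<omega> \<in> space M" for \<omega>
  proof -
    obtain m where m: "jumps \<omega> = {1..m}" using \<omega> by (rule jumps_interval)
    have "(\<Sum>n. if n + 1 \<in> jumps \<omega> then H \<omega> (\<tau> (n + 1) \<omega>) (X (n + 1) \<omega>) else 0)
        = (\<Sum>n<m. H \<omega> (\<tau> (n + 1) \<omega>) (X (n + 1) \<omega>))"
      by (subst suminf_finite[of "{..<m}"]) (auto simp: m)
    also have "\<dots> = (\<Sum>n\<in>jumps \<omega>. H \<omega> (\<tau> n \<omega>) (X n \<omega>))"
      unfolding m using sum.shift_bounds_nat_ivl[of "\<lambda>n. H \<omega> (\<tau> n \<omega>) (X n \<omega>)" 0 1 m]
      by (simp add: atLeast0LessThan atLeastLessThanSuc_atLeastAtMost[symmetric])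
    finally show ?thesis .
  qed
  ultimately show ?thesis by (simp cong: measurable_cong)
qed

lemma measurable_jump_prod:
  fixes H :: "'a \<Rightarrow> real \<Rightarrow> 'k \<Rightarrow> real"
  assumes "predictable_field H"
  shows "(\<lambda>\<omega>. \<Prod>n\<in>jumps \<omega>. H \<omega> (\<tau> n \<omega>) (X n \<omega>)) \<in> borel_measurable M"
proof (rule borel_measurable_eventually_const)
  show "(\<lambda>\<omega>. \<Prod>n=1..k. if n \<in> jumps \<omega> then H \<omega> (\<tau> n \<omega>) (X n \<omega>) else 1) \<in> borel_measurable M" for k
    by (intro borel_measurable_prod measurable_jump_value[OF assms]) simp
  fix \<omega> assume "\<omega> \<in> space M"
  then obtain m where m: "jumps \<omega> = {1..m}" by (rule jumps_interval)
  show "\<forall>\<^sub>F k in sequentially. (\<Prod>n=1..k. if n \<in> jumps \<omega> then H \<omega> (\<tau> n \<omega>) (X n \<omega>) else 1) = (\<Prod>n\<in>jumps \<omega>. H \<omega> (\<tau> n \<omega>) (X n \<omega>))"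
    using eventually_ge_at_top[of m]
    by eventually_elim (auto simp: m intro!: prod.mono_neutral_cong_right)
qed

lemma measurable_power_jumps: "(\<lambda>\<omega>. (c::real) ^ card (jumps \<omega>)) \<in> borel_measurable M"
  using measurable_jump_prod[OF predictable_field_const[of c]] by simp

lemma predictable_jump_prod:
  fixes H :: "'a \<Rightarrow> real \<Rightarrow> 'k \<Rightarrow> real"
  assumes "predictable_field H"
  shows "(\<lambda>(\<omega>, s). \<Prod>n\<in>{n \<in> jumps \<omega>. \<tau> n \<omega> < s}. H \<omega> (\<tau> n \<omega>) (X n \<omega>)) \<in> borel_measurable \<P>"
proof (rule borel_measurable_eventually_const)
  show "(\<lambda>z. \<Prod>n=1..k. case z of (\<omega>, s) \<Rightarrow> if S n \<omega> < ennreal s then H \<omega> (\<tau> n \<omega>) (X n \<omega>) else 1) \<in> borel_measurable \<P>" for k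
    by (intro borel_measurable_prod predictable_jump_value[OF assms]) simp
  fix z assume "z \<in> space \<P>"
  then obtain \<omega> s where z: "z = (\<omega>, s)" and \<omega>: "\<omega> \<in> space M" and s: "0 \<le> s" "s \<le> T"
    by (cases z) (auto simp: space_P)
  obtain m where m: "jumps \<omega> = {1..m}" using \<omega> by (rule jumps_interval)
  have iff: "1 \<le> n \<and> S n \<omega> < ennreal s \<longleftrightarrow> n \<in> jumps \<omega> \<and> \<tau> n \<omega> < s" for n
  proof -
    have "n \<in> jumps \<omega>" if "1 \<le> n" "S n \<omega> < ennreal s"
      using that s order_trans[OF less_imp_le[OF that(2)] ennreal_leI[OF s(2)]] by (simp add: jumps_def)
    then show ?thesis
      using \<tau>_less_iff[OF \<omega> _ s(1), of n] by (auto simp: jumps_def)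
  qed
  show "\<forall>\<^sub>F k in sequentially. (\<Prod>n=1..k. case z of (\<omega>, s) \<Rightarrow> if S n \<omega> < ennreal s then H \<omega> (\<tau> n \<omega>) (X n \<omega>) else 1)
     = (case z of (\<omega>, s) \<Rightarrow> \<Prod>n\<in>{n \<in> jumps \<omega>. \<tau> n \<omega> < s}. H \<omega> (\<tau> n \<omega>) (X n \<omega>))"
    using eventually_ge_at_top[of m]
  proof eventually_elim
    case (elim k)
    have "(\<Prod>n=1..k. if S n \<omega> < ennreal s then H \<omega> (\<tau> n \<omega>) (X n \<omega>) else 1)
        = (\<Prod>n\<in>{n \<in> {1..k}. S n \<omega> < ennreal s}. H \<omega> (\<tau> n \<omega>) (X n \<omega>))"
      by (rule prod.inter_filter[symmetric]) simp
    also have "{n \<in> {1..k}. S n \<omega> < ennreal s} = {n \<in> jumps \<omega>. \<tau> n \<omega> < s}"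
      using iff m elim by (auto simp: set_eq_iff)
    finally show ?case by (simp add: z)
  qed
qed

section \<open>Stochastic exponentials\<close>

text \<open>The bounded predictable factors by which the compensator can be multiplied. The condition is only
  imposed on \<open>\<Omega> \<times> [0, T]\<close>, outside of which predictability says nothing.\<close>

definition intensity :: "real \<Rightarrow> ('a \<Rightarrow> real \<Rightarrow> 'k \<Rightarrow> real) \<Rightarrow> bool" where
  "intensity C R \<longleftrightarrow> predictable_field R \<and>
     (\<forall>\<omega>\<in>space M. \<forall>t\<in>{0..T}. \<forall>x. 0 \<le> R \<omega> t x \<and> R \<omega> t x \<le> C)"

definition mark_mean :: "('a \<Rightarrow> real \<Rightarrow> 'k \<Rightarrow> real) \<Rightarrow> 'a \<Rightarrow> real \<Rightarrow> real" where
  "mark_mean R \<omega> t = (\<integral>x. R \<omega> t x \<partial>\<phi> \<omega> t)"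

definition log_drift :: "('a \<Rightarrow> real \<Rightarrow> 'k \<Rightarrow> real) \<Rightarrow> 'a \<Rightarrow> real \<Rightarrow> real" where
  "log_drift R \<omega> t = primitive (dA \<omega>) (\<lambda>s. 1 - mark_mean R \<omega> s) t"

text \<open>The left limit at \<open>t\<close> of the stochastic exponential of \<open>\<integral>\<integral> (R - 1) d(\<mu> - \<nu>)\<close>: jumps at time \<open>t\<close> itself
  do not count. As a left limit it is predictable and may be put into the compensation formula.\<close>

definition density_left :: "('a \<Rightarrow> real \<Rightarrow> 'k \<Rightarrow> real) \<Rightarrow> 'a \<Rightarrow> real \<Rightarrow> real" where
  "density_left R \<omega> t = exp (log_drift R \<omega> t) * (\<Prod>n\<in>{n\<in>jumps \<omega>. \<tau> n \<omega> < t}. R \<omega> (\<tau> n \<omega>) (X n \<omega>))"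

text \<open>The terminal value of the same stochastic exponential.\<close>

definition jump_density :: "('a \<Rightarrow> real \<Rightarrow> 'k \<Rightarrow> real) \<Rightarrow> 'a \<Rightarrow> real" where
  "jump_density R \<omega> = exp (log_drift R \<omega> T) * (\<Prod>n\<in>jumps \<omega>. R \<omega> (\<tau> n \<omega>) (X n \<omega>))"

lemma intensityD:
  assumes "intensity C R"
  shows "predictable_field R"
    and "\<omega> \<in> space M \<Longrightarrow> t \<in> {0..T} \<Longrightarrow> 0 \<le> R \<omega> t x"
    and "\<omega> \<in> space M \<Longrightarrow> t \<in> {0..T} \<Longrightarrow> R \<omega> t x \<le> C"
  using assms by (auto simp: intensity_def)

lemma intensity_mult:
  assumes "intensity C R" "intensity C' R'" "0 \<le> C" "0 \<le> C'"
  shows "intensity (C * C') (\<lambda>\<omega> t x. R \<omega> t x * R' \<omega> t x)"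
  unfolding intensity_def
proof (intro conjI ballI allI)
  show "predictable_field (\<lambda>\<omega> t x. R \<omega> t x * R' \<omega> t x)"
    using borel_measurable_times[OF intensityD(1)[OF assms(1)] intensityD(1)[OF assms(2)]] by (simp add: split_beta')
  fix \<omega> t x assume "\<omega> \<in> space M" "t \<in> {0..T}"
  note b = intensityD(2,3)[OF assms(1) this, of x] intensityD(2,3)[OF assms(2) this, of x]
  show "0 \<le> R \<omega> t x * R' \<omega> t x" using b by simp
  show "R \<omega> t x * R' \<omega> t x \<le> C * C'" using b assms(3) by (intro mult_mono) auto
qed

lemma integrable_mark:
  assumes "intensity C R" "\<omega> \<in> space M" "t \<in> {0..T}"
  shows "integrable (\<phi> \<omega> t) (R \<omega> t)"
proof -
  interpret \<phi>: prob_space "\<phi> \<omega> t" by (rule prob_\<phi>[OF assms(2,3)])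
  show ?thesis
    using intensityD(2,3)[OF assms(1,2,3)]
    by (intro \<phi>.integrable_const_bound[where B=C] AE_I2 measurable_mark_section[OF intensityD(1)[OF assms(1)] assms(2,3)]) simp
qed

lemma mark_mean_bounds:
  assumes "intensity C R" "\<omega> \<in> space M" "t \<in> {0..T}"
  shows "0 \<le> mark_mean R \<omega> t" and "mark_mean R \<omega> t \<le> C"
proof -
  interpret \<phi>: prob_space "\<phi> \<omega> t" by (rule prob_\<phi>[OF assms(2,3)])
  show "0 \<le> mark_mean R \<omega> t"
    unfolding mark_mean_def by (intro Bochner_Integration.integral_nonneg intensityD(2)[OF assms])
  show "mark_mean R \<omega> t \<le> C"
    unfolding mark_mean_def
    by (intro \<phi>.integral_le_const integrable_mark[OF assms] AE_I2 intensityD(3)[OF assms])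
qed

lemma mark_mean_const:
  assumes "\<omega> \<in> space M" "t \<in> {0..T}" "\<And>x. R \<omega> t x = c"
  shows "mark_mean R \<omega> t = c"
  using prob_space.prob_space[OF prob_\<phi>[OF assms(1,2)]] assms(3) by (simp add: mark_mean_def)

lemma ennreal_mark_mean:
  assumes "intensity C R" "\<omega> \<in> space M" "t \<in> {0..T}"
  shows "(\<integral>\<^sup>+x. ennreal (R \<omega> t x) \<partial>\<phi> \<omega> t) = ennreal (mark_mean R \<omega> t)"
  unfolding mark_mean_def
  by (intro nn_integral_eq_integral integrable_mark[OF assms] AE_I2 intensityD(2)[OF assms])

lemma predictable_mark_mean:
  "intensity C R \<Longrightarrow> (\<lambda>(\<omega>, t). mark_mean R \<omega> t) \<in> borel_measurable \<P>"
  unfolding mark_mean_def by (rule predictable_mark_integral[OF intensityD(1)])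

lemma integrable_mark_mean:
  assumes "intensity C R" "\<omega> \<in> space M"
  shows "integrable (dA \<omega>) (mark_mean R \<omega>)"
  using mark_mean_bounds[OF assms]
  by (intro integrable_dA_bounded[OF assms(2) measurable_time_path[OF predictable_mark_mean[OF assms(1)] assms(2)], where K=C]) auto

lemma primitive_terminal: "\<omega> \<in> space M \<Longrightarrow> primitive (dA \<omega>) f T = (\<integral>s. f s \<partial>dA \<omega>)"
  unfolding primitive_def by (intro Bochner_Integration.integral_cong) (auto simp: space_dA)

lemma log_drift_terminal: "\<omega> \<in> space M \<Longrightarrow> log_drift R \<omega> T = (\<integral>s. 1 - mark_mean R \<omega> s \<partial>dA \<omega>)"
  unfolding log_drift_def by (rule primitive_terminal)

text \<open>This form exhibits \<open>log_drift\<close> as a difference of increasing predictable processes and bounds it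
  by \<open>A\<close>.\<close>

lemma log_drift_eq:
  assumes R: "intensity C R" and \<omega>: "\<omega> \<in> space M" and t: "t \<in> {0..T}"
  shows "log_drift R \<omega> t = A \<omega> t - enn2real (\<integral>\<^sup>+s. indicator {..t} s * ennreal (mark_mean R \<omega> s) \<partial>dA \<omega>)"
proof -
  interpret atomless_time_measure "dA \<omega>" T by (rule atomless_dA[OF \<omega>])
  note mm = measurable_time_path[OF predictable_mark_mean[OF R] \<omega>]
  have i: "integrable (dA \<omega>) (mark_mean R \<omega>)"
    using mark_mean_bounds[OF R \<omega>] by (intro integrable_dA_bounded[OF \<omega> mm, where K=C]) auto
  have "log_drift R \<omega> t = (\<integral>s. indicator {..t} s - indicator {..t} s * mark_mean R \<omega> s \<partial>dA \<omega>)"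
    unfolding log_drift_def primitive_def by (simp add: right_diff_distrib)
  also have "\<dots> = (\<integral>s. indicator {..t} s \<partial>dA \<omega>) - (\<integral>s. indicator {..t} s * mark_mean R \<omega> s \<partial>dA \<omega>)"
    using integrable_prim[of "\<lambda>_. 1"] integrable_prim[OF i] by (intro Bochner_Integration.integral_diff) auto
  also have "(\<integral>s. indicator {..t} s \<partial>dA \<omega>) = A \<omega> t"
    by (rule integral_indicator_dA[OF \<omega> t])
  also have "(\<integral>s. indicator {..t} s * mark_mean R \<omega> s \<partial>dA \<omega>) = enn2real (\<integral>\<^sup>+s. ennreal (indicator {..t} s * mark_mean R \<omega> s) \<partial>dA \<omega>)"
  proof (rule integral_eq_nn_integral)
    show "(\<lambda>s. indicator {..t} s * mark_mean R \<omega> s) \<in> borel_measurable (dA \<omega>)"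
      using mm by simp
    show "AE s in dA \<omega>. 0 \<le> indicator {..t} s * mark_mean R \<omega> s"
      using mark_mean_bounds(1)[OF R \<omega>] by (intro AE_I2) (auto simp: space_dA[OF \<omega>])
  qed
  also have "(\<integral>\<^sup>+s. ennreal (indicator {..t} s * mark_mean R \<omega> s) \<partial>dA \<omega>) = (\<integral>\<^sup>+s. indicator {..t} s * ennreal (mark_mean R \<omega> s) \<partial>dA \<omega>)"
    by (intro nn_integral_cong) (auto split: split_indicator)
  finally show ?thesis .
qed

lemma log_drift_le: "intensity C R \<Longrightarrow> \<omega> \<in> space M \<Longrightarrow> t \<in> {0..T} \<Longrightarrow> log_drift R \<omega> t \<le> A \<omega> t"
  by (simp add: log_drift_eq enn2real_nonneg)

lemma log_drift_const:
  assumes "\<omega> \<in> space M" "\<And>s. s \<in> {0..T} \<Longrightarrow> mark_mean R \<omega> s = c"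
  shows "log_drift R \<omega> T = (1 - c) * A \<omega> T"
proof -
  have "log_drift R \<omega> T = (\<integral>s. 1 - c \<partial>dA \<omega>)"
    unfolding log_drift_def primitive_terminal[OF assms(1)]
    using assms by (intro Bochner_Integration.integral_cong) (auto simp: space_dA)
  then show ?thesis
    by (simp add: measure_dA_space[OF assms(1)])
qed

lemma log_drift_nonpos:
  assumes "\<omega> \<in> space M" "\<And>s. s \<in> {0..T} \<Longrightarrow> 1 \<le> mark_mean R \<omega> s"
  shows "log_drift R \<omega> t \<le> 0"
proof -
  have "0 \<le> (\<integral>s. - (indicator {..t} s * (1 - mark_mean R \<omega> s)) \<partial>dA \<omega>)"
    using assms by (intro integral_nonneg_AE AE_I2) (auto simp: space_dA split: split_indicator)
  then show ?thesis
    by (simp add: log_drift_def primitive_def)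
qed

lemma predictable_log_drift:
  assumes R: "intensity C R"
  shows "(\<lambda>(\<omega>, t). log_drift R \<omega> t) \<in> borel_measurable \<P>"
proof -
  have "(\<lambda>(\<omega>, s). ennreal (mark_mean R \<omega> s)) \<in> borel_measurable \<P>"
    using measurable_compose[OF predictable_mark_mean[OF R] measurable_ennreal] by (simp add: split_beta')
  from measurable_compose[OF predictable_nn_integral_dA[OF this] borel_measurable_enn2real[OF measurable_ident]]
  have "(\<lambda>(\<omega>, t). A \<omega> t - enn2real (\<integral>\<^sup>+s. indicator {..t} s * ennreal (mark_mean R \<omega> s) \<partial>dA \<omega>)) \<in> borel_measurable \<P>"
    using borel_measurable_diff[OF A_predictable] by (simp add: split_beta')
  then show ?thesis
    by (rule measurable_cong[THEN iffD1, rotated]) (auto simp: space_P log_drift_eq[OF R])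
qed

lemma predictable_density_left:
  assumes R: "intensity C R"
  shows "(\<lambda>(\<omega>, t). density_left R \<omega> t) \<in> borel_measurable \<P>"
  unfolding density_left_def
  using borel_measurable_times[OF measurable_compose[OF predictable_log_drift[OF R] borel_measurable_exp] predictable_jump_prod[OF intensityD(1)[OF R]]]
  by (simp add: split_beta')

lemma density_left_bounds:
  assumes R: "intensity C R" and C: "1 \<le> C" and \<omega>: "\<omega> \<in> space M" and t: "t \<in> {0..T}"
  shows "0 \<le> density_left R \<omega> t" and "density_left R \<omega> t \<le> exp (A \<omega> T) * C ^ card (jumps \<omega>)"
proof -
  have b: "0 \<le> R \<omega> (\<tau> n \<omega>) (X n \<omega>) \<and> R \<omega> (\<tau> n \<omega>) (X n \<omega>) \<le> C" if "n \<in> jumps \<omega>" for n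
    using intensityD(2,3)[OF R \<omega> \<tau>_in[OF \<omega> that]] by simp
  then show "0 \<le> density_left R \<omega> t"
    unfolding density_left_def by (intro mult_nonneg_nonneg prod_nonneg) auto
  have "log_drift R \<omega> t \<le> A \<omega> T"
    using log_drift_le[OF R \<omega> t] A_le[OF \<omega> t, of T] t by auto
  then show "density_left R \<omega> t \<le> exp (A \<omega> T) * C ^ card (jumps \<omega>)"
    unfolding density_left_def using b C finite_jumps[OF \<omega>]
    by (intro mult_mono prod_le_power_card) (auto intro!: prod_nonneg)
qed

lemma jump_density_bounds:
  assumes R: "intensity C R" and C: "1 \<le> C" and \<omega>: "\<omega> \<in> space M"
  shows "0 \<le> jump_density R \<omega>" and "jump_density R \<omega> \<le> exp (A \<omega> T) * C ^ card (jumps \<omega>)"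
proof -
  have b: "0 \<le> R \<omega> (\<tau> n \<omega>) (X n \<omega>) \<and> R \<omega> (\<tau> n \<omega>) (X n \<omega>) \<le> C" if "n \<in> jumps \<omega>" for n
    using intensityD(2,3)[OF R \<omega> \<tau>_in[OF \<omega> that]] by simp
  then show "0 \<le> jump_density R \<omega>"
    unfolding jump_density_def by (intro mult_nonneg_nonneg prod_nonneg) auto
  have "log_drift R \<omega> T \<le> A \<omega> T"
    using log_drift_le[OF R \<omega>, of T] T_pos by auto
  then show "jump_density R \<omega> \<le> exp (A \<omega> T) * C ^ card (jumps \<omega>)"
    unfolding jump_density_def using b C finite_jumps[OF \<omega>]
    by (intro mult_mono prod_le_power_card) (auto intro!: prod_nonneg)
qed

lemma measurable_jump_density:
  assumes R: "intensity C R"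
  shows "jump_density R \<in> borel_measurable M"
proof -
  have "(\<lambda>\<omega>. log_drift R \<omega> T) \<in> borel_measurable M"
    using measurable_compose[OF measurable_event_section predictable_log_drift[OF R], of T] T_pos by simp
  then show ?thesis
    using measurable_jump_prod[OF intensityD(1)[OF R]]
    unfolding jump_density_def[abs_def] by (intro borel_measurable_times measurable_compose[OF _ borel_measurable_exp])
qed

text \<open>The equation of the stochastic exponential, with \<open>d\<mu>\<close> and \<open>d\<nu>\<close> separated.\<close>

lemma jump_density_formula:
  assumes R: "intensity C R" and C: "1 \<le> C" and \<omega>: "\<omega> \<in> space M"
  shows "jump_density R \<omega> = 1 + (\<Sum>n\<in>jumps \<omega>. density_left R \<omega> (\<tau> n \<omega>) * (R \<omega> (\<tau> n \<omega>) (X n \<omega>) - 1))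
    + (\<integral>s. density_left R \<omega> s * (1 - mark_mean R \<omega> s) \<partial>dA \<omega>)"
proof -
  interpret atomless_time_measure "dA \<omega>" T by (rule atomless_dA[OF \<omega>])
  obtain k where k: "jumps \<omega> = {1..k}" by (rule jumps_interval[OF \<omega>])
  have m: "(\<lambda>s. 1 - mark_mean R \<omega> s) \<in> borel_measurable (dA \<omega>)"
    using measurable_time_path[OF predictable_mark_mean[OF R] \<omega>] by simp
  have "\<bar>1 - mark_mean R \<omega> s\<bar> \<le> C" if "s \<in> space (dA \<omega>)" for s
    using mark_mean_bounds[OF R \<omega>, of s] that C by (auto simp: space_dA[OF \<omega>])
  from exp_jump_formula[OF m this, where \<tau>="\<lambda>n. \<tau> n \<omega>" and k=k and r="\<lambda>n. R \<omega> (\<tau> n \<omega>) (X n \<omega>)"]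
  show ?thesis
    using \<tau>_less_iff_index[OF \<omega>] by (simp add: jump_density_def density_left_def log_drift_def k)
qed

text \<open>The compensation formula as an equality of real expectations, whose terms can be subtracted.\<close>

lemma compensation_real:
  fixes H :: "'a \<Rightarrow> real \<Rightarrow> 'k \<Rightarrow> real"
  assumes H: "predictable_field H" and pos: "\<And>\<omega> t x. \<omega> \<in> space M \<Longrightarrow> t \<in> {0..T} \<Longrightarrow> 0 \<le> H \<omega> t x"
    and fin: "(\<integral>\<^sup>+\<omega>. \<integral>\<^sup>+t. \<integral>\<^sup>+x. ennreal (H \<omega> t x) \<partial>\<phi> \<omega> t \<partial>dA \<omega> \<partial>M) < \<infinity>"
  shows "integrable M (\<lambda>\<omega>. \<Sum>n\<in>jumps \<omega>. H \<omega> (\<tau> n \<omega>) (X n \<omega>))"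
    and "integrable M (\<lambda>\<omega>. enn2real (\<integral>\<^sup>+t. \<integral>\<^sup>+x. ennreal (H \<omega> t x) \<partial>\<phi> \<omega> t \<partial>dA \<omega>))"
    and "(\<integral>\<omega>. (\<Sum>n\<in>jumps \<omega>. H \<omega> (\<tau> n \<omega>) (X n \<omega>)) \<partial>M) = (\<integral>\<omega>. enn2real (\<integral>\<^sup>+t. \<integral>\<^sup>+x. ennreal (H \<omega> t x) \<partial>\<phi> \<omega> t \<partial>dA \<omega>) \<partial>M)"
proof -
  define V where "V \<omega> = (\<integral>\<^sup>+t. \<integral>\<^sup>+x. ennreal (H \<omega> t x) \<partial>\<phi> \<omega> t \<partial>dA \<omega>)" for \<omega>
  have H': "predictable_field (\<lambda>\<omega> t x. ennreal (H \<omega> t x))"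
    by (rule measurable_field_ennreal[OF H])
  have [measurable]: "V \<in> borel_measurable M"
    unfolding V_def by (rule measurable_compensator_integral[OF H'])
  have [measurable]: "(\<lambda>\<omega>. \<Sum>n\<in>jumps \<omega>. H \<omega> (\<tau> n \<omega>) (X n \<omega>)) \<in> borel_measurable M"
    by (rule measurable_jump_sum[OF H])
  have "AE \<omega> in M. V \<omega> \<noteq> \<infinity>"
    using fin by (intro nn_integral_noteq_infinite) (auto simp: V_def[symmetric] less_top)
  then have conv: "(\<integral>\<^sup>+\<omega>. ennreal (enn2real (V \<omega>)) \<partial>M) = (\<integral>\<^sup>+\<omega>. V \<omega> \<partial>M)"
    by (intro nn_integral_cong_AE) (auto elim!: eventually_mono simp: less_top)
  have sum_nn: "ennreal (\<Sum>n\<in>jumps \<omega>. H \<omega> (\<tau> n \<omega>) (X n \<omega>)) = (\<Sum>n\<in>jumps \<omega>. ennreal (H \<omega> (\<tau> n \<omega>) (X n \<omega>)))"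
    and sum_pos: "0 \<le> (\<Sum>n\<in>jumps \<omega>. H \<omega> (\<tau> n \<omega>) (X n \<omega>))" if "\<omega> \<in> space M" for \<omega>
    using pos[OF that \<tau>_in[OF that]] by (auto intro!: sum_nonneg)
  have eq: "(\<integral>\<^sup>+\<omega>. ennreal (\<Sum>n\<in>jumps \<omega>. H \<omega> (\<tau> n \<omega>) (X n \<omega>)) \<partial>M) = (\<integral>\<^sup>+\<omega>. V \<omega> \<partial>M)"
    using compensation_sum[OF H'] sum_nn by (simp add: V_def cong: nn_integral_cong)
  have "(\<integral>\<^sup>+\<omega>. ennreal \<bar>\<Sum>n\<in>jumps \<omega>. H \<omega> (\<tau> n \<omega>) (X n \<omega>)\<bar> \<partial>M) = (\<integral>\<^sup>+\<omega>. V \<omega> \<partial>M)"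
    unfolding eq[symmetric] using sum_pos by (intro nn_integral_cong) simp
  then show "integrable M (\<lambda>\<omega>. \<Sum>n\<in>jumps \<omega>. H \<omega> (\<tau> n \<omega>) (X n \<omega>))"
    using fin by (simp add: integrable_iff_bounded V_def)
  show "integrable M (\<lambda>\<omega>. enn2real (\<integral>\<^sup>+t. \<integral>\<^sup>+x. ennreal (H \<omega> t x) \<partial>\<phi> \<omega> t \<partial>dA \<omega>))"
    using fin conv unfolding V_def[symmetric] by (simp add: integrable_iff_bounded)
  show "(\<integral>\<omega>. (\<Sum>n\<in>jumps \<omega>. H \<omega> (\<tau> n \<omega>) (X n \<omega>)) \<partial>M) = (\<integral>\<omega>. enn2real (\<integral>\<^sup>+t. \<integral>\<^sup>+x. ennreal (H \<omega> t x) \<partial>\<phi> \<omega> t \<partial>dA \<omega>) \<partial>M)"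
    unfolding V_def[symmetric] using sum_pos eq conv
    by (simp add: integral_eq_nn_integral)
qed

text \<open>Taking expectations in the equation of the stochastic exponential, the jump part and the drift part
  cancel by compensation. The hypothesis makes all four terms finite, so that they may be separated.\<close>

lemma expectation_jump_density:
  assumes R: "intensity C R" and C: "1 \<le> C"
    and fin: "(\<integral>\<^sup>+\<omega>. \<integral>\<^sup>+t. ennreal (density_left R \<omega> t) \<partial>dA \<omega> \<partial>M) < \<infinity>"
  shows "integrable M (jump_density R)" and "(\<integral>\<omega>. jump_density R \<omega> \<partial>M) = 1"
proof -
  let ?\<Lambda> = "density_left R"
  \<comment> \<open>the integrands of the two jump terms; their mark integrals are the two drift terms\<close>
  define H1 where "H1 \<omega> t x = ?\<Lambda> \<omega> t * R \<omega> t x" for \<omega> t and x :: 'k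
  define H2 where "H2 \<omega> t x = ?\<Lambda> \<omega> t" for \<omega> t and x :: 'k
  note \<Lambda>_pos = density_left_bounds(1)[OF R C]
  have \<Lambda>_field: "(\<lambda>z. case fst z of (\<omega>, t) \<Rightarrow> ?\<Lambda> \<omega> t) \<in> borel_measurable (\<P> \<Otimes>\<^sub>M borel)"
    by (rule measurable_compose[OF measurable_fst predictable_density_left[OF R]])
  have H1: "predictable_field H1"
    unfolding H1_def using borel_measurable_times[OF \<Lambda>_field intensityD(1)[OF R]] by (simp add: split_beta')
  have H2: "predictable_field H2"
    unfolding H2_def using \<Lambda>_field by (simp add: split_beta')
  have pos1: "0 \<le> H1 \<omega> t x" and pos2: "0 \<le> H2 \<omega> t x" if "\<omega> \<in> space M" "t \<in> {0..T}" for \<omega> t x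
    using \<Lambda>_pos[OF that] intensityD(2)[OF R that] by (auto simp: H1_def H2_def)
  have in1: "(\<integral>\<^sup>+x. ennreal (H1 \<omega> t x) \<partial>\<phi> \<omega> t) = ennreal (?\<Lambda> \<omega> t * mark_mean R \<omega> t)"
    and in2: "(\<integral>\<^sup>+x. ennreal (H2 \<omega> t x) \<partial>\<phi> \<omega> t) = ennreal (?\<Lambda> \<omega> t)"
    if "\<omega> \<in> space M" "t \<in> {0..T}" for \<omega> t
  proof -
    interpret \<phi>: prob_space "\<phi> \<omega> t" by (rule prob_\<phi>[OF that])
    have "(\<integral>\<^sup>+x. ennreal (H1 \<omega> t x) \<partial>\<phi> \<omega> t) = (\<integral>\<^sup>+x. ennreal (?\<Lambda> \<omega> t) * ennreal (R \<omega> t x) \<partial>\<phi> \<omega> t)"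
      using \<Lambda>_pos[OF that] intensityD(2)[OF R that] by (intro nn_integral_cong) (simp add: H1_def ennreal_mult)
    also have "\<dots> = ennreal (?\<Lambda> \<omega> t) * ennreal (mark_mean R \<omega> t)"
      using measurable_mark_section[OF intensityD(1)[OF R] that]
      by (simp add: nn_integral_cmult ennreal_mark_mean[OF R that])
    finally show "(\<integral>\<^sup>+x. ennreal (H1 \<omega> t x) \<partial>\<phi> \<omega> t) = ennreal (?\<Lambda> \<omega> t * mark_mean R \<omega> t)"
      using \<Lambda>_pos[OF that] mark_mean_bounds(1)[OF R that] by (simp add: ennreal_mult)
    show "(\<integral>\<^sup>+x. ennreal (H2 \<omega> t x) \<partial>\<phi> \<omega> t) = ennreal (?\<Lambda> \<omega> t)"
      by (simp add: H2_def \<phi>.emeasure_space_1)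
  qed
  have out1: "(\<integral>\<^sup>+t. \<integral>\<^sup>+x. ennreal (H1 \<omega> t x) \<partial>\<phi> \<omega> t \<partial>dA \<omega>) = (\<integral>\<^sup>+t. ennreal (?\<Lambda> \<omega> t * mark_mean R \<omega> t) \<partial>dA \<omega>)"
    and out2: "(\<integral>\<^sup>+t. \<integral>\<^sup>+x. ennreal (H2 \<omega> t x) \<partial>\<phi> \<omega> t \<partial>dA \<omega>) = (\<integral>\<^sup>+t. ennreal (?\<Lambda> \<omega> t) \<partial>dA \<omega>)"
    if "\<omega> \<in> space M" for \<omega>
    using in1[OF that] in2[OF that] by (auto intro!: nn_integral_cong simp: space_dA[OF that])
  have \<Lambda>_time: "(\<lambda>t. ennreal (?\<Lambda> \<omega> t)) \<in> borel_measurable (dA \<omega>)" if "\<omega> \<in> space M" for \<omega>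
    using measurable_time_path[OF predictable_density_left[OF R] that] by simp
  have fin2: "(\<integral>\<^sup>+\<omega>. \<integral>\<^sup>+t. \<integral>\<^sup>+x. ennreal (H2 \<omega> t x) \<partial>\<phi> \<omega> t \<partial>dA \<omega> \<partial>M) < \<infinity>"
    using fin by (simp add: out2 cong: nn_integral_cong)
  have "(\<integral>\<^sup>+\<omega>. \<integral>\<^sup>+t. \<integral>\<^sup>+x. ennreal (H1 \<omega> t x) \<partial>\<phi> \<omega> t \<partial>dA \<omega> \<partial>M)
      \<le> (\<integral>\<^sup>+\<omega>. ennreal C * (\<integral>\<^sup>+t. ennreal (?\<Lambda> \<omega> t) \<partial>dA \<omega>) \<partial>M)"
  proof (intro nn_integral_mono)
    fix \<omega> assume \<omega>: "\<omega> \<in> space M"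
    have "(\<integral>\<^sup>+t. ennreal (?\<Lambda> \<omega> t * mark_mean R \<omega> t) \<partial>dA \<omega>) \<le> (\<integral>\<^sup>+t. ennreal C * ennreal (?\<Lambda> \<omega> t) \<partial>dA \<omega>)"
    proof (intro nn_integral_mono)
      fix t assume "t \<in> space (dA \<omega>)"
      then have t: "t \<in> {0..T}" by (simp add: space_dA[OF \<omega>])
      have "?\<Lambda> \<omega> t * mark_mean R \<omega> t \<le> C * ?\<Lambda> \<omega> t"
        using mult_left_mono[OF mark_mean_bounds(2)[OF R \<omega> t] \<Lambda>_pos[OF \<omega> t]] by (simp add: mult.commute)
      then show "ennreal (?\<Lambda> \<omega> t * mark_mean R \<omega> t) \<le> ennreal C * ennreal (?\<Lambda> \<omega> t)"
        using C \<Lambda>_pos[OF \<omega> t] by (simp add: ennreal_mult[symmetric] ennreal_leI)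
    qed
    also have "\<dots> = ennreal C * (\<integral>\<^sup>+t. ennreal (?\<Lambda> \<omega> t) \<partial>dA \<omega>)"
      by (rule nn_integral_cmult[OF \<Lambda>_time[OF \<omega>]])
    finally show "(\<integral>\<^sup>+t. \<integral>\<^sup>+x. ennreal (H1 \<omega> t x) \<partial>\<phi> \<omega> t \<partial>dA \<omega>) \<le> ennreal C * (\<integral>\<^sup>+t. ennreal (?\<Lambda> \<omega> t) \<partial>dA \<omega>)"
      by (simp add: out1[OF \<omega>])
  qed
  also have "\<dots> = ennreal C * (\<integral>\<^sup>+\<omega>. \<integral>\<^sup>+t. ennreal (?\<Lambda> \<omega> t) \<partial>dA \<omega> \<partial>M)"
  proof (rule nn_integral_cmult, rule measurable_nn_integral_dA, rule measurable_P_imp)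
    show "(\<lambda>(\<omega>, t). ennreal (?\<Lambda> \<omega> t)) \<in> borel_measurable \<P>"
      using measurable_compose[OF predictable_density_left[OF R] measurable_ennreal] by (simp add: split_beta')
  qed
  also have "\<dots> < \<infinity>"
    using fin by (simp add: ennreal_mult_less_top)
  finally have fin1: "(\<integral>\<^sup>+\<omega>. \<integral>\<^sup>+t. \<integral>\<^sup>+x. ennreal (H1 \<omega> t x) \<partial>\<phi> \<omega> t \<partial>dA \<omega> \<partial>M) < \<infinity>" .
  note c1 = compensation_real[OF H1 pos1 fin1] and c2 = compensation_real[OF H2 pos2 fin2]
  have path: "jump_density R \<omega> = 1 + (\<Sum>n\<in>jumps \<omega>. H1 \<omega> (\<tau> n \<omega>) (X n \<omega>)) - (\<Sum>n\<in>jumps \<omega>. H2 \<omega> (\<tau> n \<omega>) (X n \<omega>))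
      + enn2real (\<integral>\<^sup>+t. \<integral>\<^sup>+x. ennreal (H2 \<omega> t x) \<partial>\<phi> \<omega> t \<partial>dA \<omega>)
      - enn2real (\<integral>\<^sup>+t. \<integral>\<^sup>+x. ennreal (H1 \<omega> t x) \<partial>\<phi> \<omega> t \<partial>dA \<omega>)"
    if \<omega>: "\<omega> \<in> space M" for \<omega>
  proof -
    have m: "?\<Lambda> \<omega> \<in> borel_measurable (dA \<omega>)" "mark_mean R \<omega> \<in> borel_measurable (dA \<omega>)"
      by (intro measurable_time_path[OF _ \<omega>] predictable_density_left[OF R] predictable_mark_mean[OF R])+
    let ?K = "exp (A \<omega> T) * C ^ card (jumps \<omega>)"
    have i1: "integrable (dA \<omega>) (?\<Lambda> \<omega>)"
      using density_left_bounds[OF R C \<omega>] by (intro integrable_dA_bounded[OF \<omega> m(1), where K="?K"]) auto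
    have i2: "integrable (dA \<omega>) (\<lambda>t. ?\<Lambda> \<omega> t * mark_mean R \<omega> t)"
      using density_left_bounds[OF R C \<omega>] mark_mean_bounds[OF R \<omega>] m
      by (intro integrable_dA_bounded[OF \<omega>, where K="?K * C"]) (use C in \<open>auto simp: abs_mult intro!: mult_mono\<close>)
    have "(\<integral>s. ?\<Lambda> \<omega> s * (1 - mark_mean R \<omega> s) \<partial>dA \<omega>) = (\<integral>s. ?\<Lambda> \<omega> s \<partial>dA \<omega>) - (\<integral>s. ?\<Lambda> \<omega> s * mark_mean R \<omega> s \<partial>dA \<omega>)"
      using Bochner_Integration.integral_diff[OF i1 i2] by (simp add: right_diff_distrib)
    also have "(\<integral>s. ?\<Lambda> \<omega> s \<partial>dA \<omega>) = enn2real (\<integral>\<^sup>+t. \<integral>\<^sup>+x. ennreal (H2 \<omega> t x) \<partial>\<phi> \<omega> t \<partial>dA \<omega>)"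
      unfolding out2[OF \<omega>] using \<Lambda>_pos[OF \<omega>] m by (intro integral_eq_nn_integral AE_I2) (auto simp: space_dA[OF \<omega>])
    also have "(\<integral>s. ?\<Lambda> \<omega> s * mark_mean R \<omega> s \<partial>dA \<omega>) = enn2real (\<integral>\<^sup>+t. \<integral>\<^sup>+x. ennreal (H1 \<omega> t x) \<partial>\<phi> \<omega> t \<partial>dA \<omega>)"
      unfolding out1[OF \<omega>] using \<Lambda>_pos[OF \<omega>] mark_mean_bounds(1)[OF R \<omega>] m
      by (intro integral_eq_nn_integral AE_I2) (auto simp: space_dA[OF \<omega>])
    finally show ?thesis
      unfolding jump_density_formula[OF R C \<omega>]
      by (simp add: H1_def H2_def right_diff_distrib sum_subtractf)
  qed
  let ?rhs = "\<lambda>\<omega>. 1 + (\<Sum>n\<in>jumps \<omega>. H1 \<omega> (\<tau> n \<omega>) (X n \<omega>)) - (\<Sum>n\<in>jumps \<omega>. H2 \<omega> (\<tau> n \<omega>) (X n \<omega>))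
      + enn2real (\<integral>\<^sup>+t. \<integral>\<^sup>+x. ennreal (H2 \<omega> t x) \<partial>\<phi> \<omega> t \<partial>dA \<omega>)
      - enn2real (\<integral>\<^sup>+t. \<integral>\<^sup>+x. ennreal (H1 \<omega> t x) \<partial>\<phi> \<omega> t \<partial>dA \<omega>)"
  have "integrable M ?rhs"
    by (intro Bochner_Integration.integrable_add Bochner_Integration.integrable_diff c1(1,2) c2(1,2) integrable_const)
  then show "integrable M (jump_density R)"
    by (rule Bochner_Integration.integrable_cong[THEN iffD2, rotated 2]) (auto simp: path)
  have "(\<integral>\<omega>. jump_density R \<omega> \<partial>M) = (\<integral>\<omega>. ?rhs \<omega> \<partial>M)"
    by (intro Bochner_Integration.integral_cong refl path)
  also have "\<dots> = 1"
    by (simp only: Bochner_Integration.integral_add Bochner_Integration.integral_diff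
        Bochner_Integration.integrable_add Bochner_Integration.integrable_diff c1 c2 integrable_const)
       (simp add: prob_space)
  finally show "(\<integral>\<omega>. jump_density R \<omega> \<partial>M) = 1" .
qed

section \<open>Exponential moments of the number of jumps\<close>

text \<open>For the constant intensity \<open>c\<close> the stochastic exponential is \<open>c^N exp ((1 - c) A)\<close>, a supermartingale.
  To stay within reach of \<open>expectation_jump_density\<close>, the intensity \<open>c\<close> is switched
  to \<open>1\<close> once more than \<open>k\<close> jumps have occurred: then the exponential is bounded by \<open>c^(k+1)\<close>,
  it has expectation \<open>1\<close>, and it is unchanged on the event of at most \<open>k\<close> jumps. Let \<open>k\<close>
  tend to infinity.\<close>

lemma jump_moment:
  fixes c :: real
  assumes c: "1 \<le> c" and A: "integrable M (\<lambda>\<omega>. A \<omega> T)"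
  shows "(\<integral>\<^sup>+\<omega>. ennreal (c ^ card (jumps \<omega>) * exp ((1 - c) * A \<omega> T)) \<partial>M) \<le> 1"
proof -
  \<comment> \<open>\<open>p\<close> is \<open>2\<close> to the number of past jumps, a predictable way of counting them\<close>
  define p where "p \<omega> t = (\<Prod>n\<in>{n\<in>jumps \<omega>. \<tau> n \<omega> < t}. 2 :: real)" for \<omega> t
  define R where "R k \<omega> t x = (if p \<omega> t \<le> 2 ^ k then c else 1)" for k \<omega> t and x :: 'k
  have p_meas: "(\<lambda>(\<omega>, t). p \<omega> t) \<in> borel_measurable \<P>"
    unfolding p_def by (rule predictable_jump_prod[OF predictable_field_const])
  have R: "intensity c (R k)" for k
  proof -
    have [measurable]: "(\<lambda>z. case fst z of (\<omega>, t) \<Rightarrow> p \<omega> t) \<in> borel_measurable (\<P> \<Otimes>\<^sub>M (borel :: 'k measure))"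
      by (rule measurable_compose[OF measurable_fst p_meas])
    have "(\<lambda>z. if (case fst z of (\<omega>, t) \<Rightarrow> p \<omega> t) \<le> 2 ^ k then c else 1) \<in> borel_measurable (\<P> \<Otimes>\<^sub>M (borel :: 'k measure))"
      by measurable
    then show ?thesis
      unfolding intensity_def using c by (simp add: R_def split_beta')
  qed
  have mm: "mark_mean (R k) \<omega> t = (if p \<omega> t \<le> 2 ^ k then c else 1)" if "\<omega> \<in> space M" "t \<in> {0..T}" for k \<omega> t
    by (rule mark_mean_const[OF that]) (simp add: R_def)
  have bound: "density_left (R k) \<omega> t \<le> c ^ Suc k" if \<omega>: "\<omega> \<in> space M" and t: "t \<in> {0..T}" for k \<omega> t
  proof -
    have p_jump: "p \<omega> (\<tau> n \<omega>) \<le> 2 ^ k \<longleftrightarrow> n \<in> {1..Suc k}" if n: "n \<in> jumps \<omega>" for n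
    proof -
      have "p \<omega> (\<tau> n \<omega>) = 2 ^ (n - 1)"
        unfolding p_def past_jumps_eq[OF \<omega> n] by simp
      then show ?thesis
        using n by (auto simp: jumps_def)
    qed
    let ?I = "{n\<in>jumps \<omega>. \<tau> n \<omega> < t}"
    let ?f = "\<lambda>n. R k \<omega> (\<tau> n \<omega>) (X n \<omega>)"
    have "(\<Prod>n\<in>?I. ?f n) = (\<Prod>n\<in>?I \<inter> {1..Suc k}. ?f n)"
      using finite_jumps[OF \<omega>] p_jump by (intro prod.mono_neutral_right) (auto simp: R_def)
    also have "\<dots> \<le> c ^ card {1..Suc k}"
      using c by (intro prod_le_power_card) (auto simp: R_def)
    finally have "(\<Prod>n\<in>?I. ?f n) \<le> c ^ Suc k" by simp
    moreover have "log_drift (R k) \<omega> t \<le> 0"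
      using c by (intro log_drift_nonpos[OF \<omega>]) (simp add: mm[OF \<omega>])
    moreover have "0 \<le> (\<Prod>n\<in>?I. ?f n)"
      using c by (intro prod_nonneg) (auto simp: R_def)
    ultimately have "exp (log_drift (R k) \<omega> t) * (\<Prod>n\<in>?I. ?f n) \<le> 1 * c ^ Suc k"
      by (intro mult_mono) auto
    then show ?thesis
      by (simp add: density_left_def)
  qed
  have total: "(\<integral>\<^sup>+\<omega>. ennreal (jump_density (R k) \<omega>) \<partial>M) = 1" for k
  proof -
    have "(\<integral>\<^sup>+\<omega>. \<integral>\<^sup>+t. ennreal (density_left (R k) \<omega> t) \<partial>dA \<omega> \<partial>M) \<le> (\<integral>\<^sup>+\<omega>. ennreal (c ^ Suc k * A \<omega> T) \<partial>M)"
    proof (rule nn_integral_mono)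
      fix \<omega> assume \<omega>: "\<omega> \<in> space M"
      have "(\<integral>\<^sup>+t. ennreal (density_left (R k) \<omega> t) \<partial>dA \<omega>) \<le> (\<integral>\<^sup>+t. ennreal (c ^ Suc k) \<partial>dA \<omega>)"
        using bound[OF \<omega>] by (intro nn_integral_mono ennreal_leI) (simp add: space_dA[OF \<omega>])
      also have "\<dots> = ennreal (c ^ Suc k) * ennreal (A \<omega> T)"
        by (simp only: nn_integral_const emeasure_dA_space[OF \<omega>])
      also have "\<dots> = ennreal (c ^ Suc k * A \<omega> T)"
        using c A_nonneg[OF \<omega>, of T] T_pos by (simp add: ennreal_mult)
      finally show "(\<integral>\<^sup>+t. ennreal (density_left (R k) \<omega> t) \<partial>dA \<omega>) \<le> ennreal (c ^ Suc k * A \<omega> T)" .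
    qed
    also have "\<dots> < \<infinity>"
      using integrableD(2)[OF integrable_mult_right[OF A, of "c ^ Suc k"]] by (simp add: less_top)
    finally have fin: "(\<integral>\<^sup>+\<omega>. \<integral>\<^sup>+t. ennreal (density_left (R k) \<omega> t) \<partial>dA \<omega> \<partial>M) < \<infinity>" .
    show ?thesis
      using expectation_jump_density[OF R c fin] jump_density_bounds(1)[OF R c]
      by (subst nn_integral_eq_integral) (auto intro: AE_I2)
  qed
  define f where "f \<omega> = ennreal (c ^ card (jumps \<omega>) * exp ((1 - c) * A \<omega> T))" for \<omega>
  have [measurable]: "(\<lambda>\<omega>. A \<omega> T) \<in> borel_measurable M"
    using T_pos by (intro A_measurable) simp
  note measurable_power_jumps [measurable]
  have [measurable]: "f \<in> borel_measurable M"
    unfolding f_def by measurable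
  define E where "E k = {\<omega> \<in> space M. (2::real) ^ card (jumps \<omega>) \<le> 2 ^ k}" for k
  have [measurable]: "E k \<in> sets M" for k
    unfolding E_def by measurable
  have le1: "(\<integral>\<^sup>+\<omega>. f \<omega> * indicator (E k) \<omega> \<partial>M) \<le> 1" for k
  proof -
    have "(\<integral>\<^sup>+\<omega>. f \<omega> * indicator (E k) \<omega> \<partial>M) \<le> (\<integral>\<^sup>+\<omega>. ennreal (jump_density (R k) \<omega>) \<partial>M)"
    proof (rule nn_integral_mono)
      fix \<omega> assume \<omega>: "\<omega> \<in> space M"
      show "f \<omega> * indicator (E k) \<omega> \<le> ennreal (jump_density (R k) \<omega>)"
      proof (cases "\<omega> \<in> E k")
        case True
        then have card: "(2::real) ^ card (jumps \<omega>) \<le> 2 ^ k" by (simp add: E_def)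
        have p_le: "p \<omega> t \<le> 2 ^ k" for t
        proof -
          have "p \<omega> t \<le> 2 ^ card (jumps \<omega>)"
            unfolding p_def using finite_jumps[OF \<omega>] by (intro prod_le_power_card) auto
          then show ?thesis using card by linarith
        qed
        have "log_drift (R k) \<omega> T = (1 - c) * A \<omega> T"
          by (rule log_drift_const[OF \<omega>]) (simp add: mm[OF \<omega>] p_le)
        then have "f \<omega> = ennreal (jump_density (R k) \<omega>)"
          by (simp add: f_def jump_density_def R_def p_le mult.commute)
        then show ?thesis using True by simp
      qed simp
    qed
    then show ?thesis by (simp add: total)
  qed
  have "(\<integral>\<^sup>+\<omega>. f \<omega> \<partial>M) \<le> (\<integral>\<^sup>+\<omega>. (SUP k. f \<omega> * indicator (E k) \<omega>) \<partial>M)"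
  proof (rule nn_integral_mono)
    fix \<omega> assume "\<omega> \<in> space M"
    then have "f \<omega> = f \<omega> * indicator (E (card (jumps \<omega>))) \<omega>"
      by (simp add: E_def)
    also have "\<dots> \<le> (SUP k. f \<omega> * indicator (E k) \<omega>)"
      by (rule SUP_upper) simp
    finally show "f \<omega> \<le> (SUP k. f \<omega> * indicator (E k) \<omega>)" .
  qed
  also have "\<dots> = (SUP k. \<integral>\<^sup>+\<omega>. f \<omega> * indicator (E k) \<omega> \<partial>M)"
  proof (rule nn_integral_monotone_convergence_SUP)
    show "incseq (\<lambda>k \<omega>. f \<omega> * indicator (E k) \<omega>)"
      by (auto simp: incseq_def le_fun_def E_def split: split_indicator intro: order_trans[OF _ power_increasing])
  qed simp
  also have "\<dots> \<le> 1"
    using le1 by (rule SUP_least)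
  finally show ?thesis
    by (simp add: f_def)
qed

text \<open>An intensity bounded by \<open>C\<close> has a stochastic exponential below \<open>exp A C^N\<close> at all times, so that
  its integral against \<open>dA\<close> is at most \<open>A exp A C^N\<close>.\<close>

lemma expectation_jump_density_dominated:
  assumes R: "intensity C R" and C: "1 \<le> C" and \<kappa>: "1 < \<kappa>"
    and D: "integrable M (\<lambda>\<omega>. exp (\<kappa> * A \<omega> T) * C ^ card (jumps \<omega>))"
  shows "integrable M (jump_density R)" and "(\<integral>\<omega>. jump_density R \<omega> \<partial>M) = 1"
proof -
  have "(\<integral>\<^sup>+\<omega>. \<integral>\<^sup>+t. ennreal (density_left R \<omega> t) \<partial>dA \<omega> \<partial>M)
      \<le> (\<integral>\<^sup>+\<omega>. ennreal (1 / (\<kappa> - 1) * (exp (\<kappa> * A \<omega> T) * C ^ card (jumps \<omega>))) \<partial>M)"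
  proof (rule nn_integral_mono)
    fix \<omega> assume \<omega>: "\<omega> \<in> space M"
    have a: "0 \<le> A \<omega> T" using A_nonneg[OF \<omega>, of T] T_pos by simp
    have le: "exp (A \<omega> T) * C ^ card (jumps \<omega>) * A \<omega> T \<le> 1 / (\<kappa> - 1) * (exp (\<kappa> * A \<omega> T) * C ^ card (jumps \<omega>))"
      using mult_right_mono[OF mult_exp_le[OF \<kappa> a], of "C ^ card (jumps \<omega>)"] C by (simp add: mult_ac)
    have "(\<integral>\<^sup>+t. ennreal (density_left R \<omega> t) \<partial>dA \<omega>) \<le> (\<integral>\<^sup>+t. ennreal (exp (A \<omega> T) * C ^ card (jumps \<omega>)) \<partial>dA \<omega>)"
      using density_left_bounds(2)[OF R C \<omega>] by (intro nn_integral_mono ennreal_leI) (simp add: space_dA[OF \<omega>])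
    also have "\<dots> = ennreal (exp (A \<omega> T) * C ^ card (jumps \<omega>)) * ennreal (A \<omega> T)"
      by (simp only: nn_integral_const emeasure_dA_space[OF \<omega>])
    also have "\<dots> = ennreal (exp (A \<omega> T) * C ^ card (jumps \<omega>) * A \<omega> T)"
      using C a by (intro ennreal_mult[symmetric]) auto
    also have "\<dots> \<le> ennreal (1 / (\<kappa> - 1) * (exp (\<kappa> * A \<omega> T) * C ^ card (jumps \<omega>)))"
      using le by (rule ennreal_leI)
    finally show "(\<integral>\<^sup>+t. ennreal (density_left R \<omega> t) \<partial>dA \<omega>) \<le> ennreal (1 / (\<kappa> - 1) * (exp (\<kappa> * A \<omega> T) * C ^ card (jumps \<omega>)))" .
  qed
  also have "\<dots> < \<infinity>"
    using integrableD(2)[OF integrable_mult_right[OF D, of "1 / (\<kappa> - 1)"]]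
    by (simp add: less_top)
  finally have fin: "(\<integral>\<^sup>+\<omega>. \<integral>\<^sup>+t. ennreal (density_left R \<omega> t) \<partial>dA \<omega> \<partial>M) < \<infinity>" .
  show "integrable M (jump_density R)" "(\<integral>\<omega>. jump_density R \<omega> \<partial>M) = 1"
    by (rule expectation_jump_density[OF R C fin])+
qed

lemma jump_density_powr_le:
  assumes R: "intensity C R" and C: "1 < C" and q: "1 < q" and \<omega>: "\<omega> \<in> space M"
  shows "jump_density R \<omega> powr q \<le> exp (q * A \<omega> T) * (C powr q) ^ card (jumps \<omega>)"
proof -
  have "jump_density R \<omega> powr q \<le> (exp (A \<omega> T) * C ^ card (jumps \<omega>)) powr q"
    using jump_density_bounds[OF R _ \<omega>] C q by (intro powr_mono2) auto
  also have "\<dots> = exp (q * A \<omega> T) * (C powr q) ^ card (jumps \<omega>)"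
  proof -
    have "(C ^ card (jumps \<omega>)) powr q = (C powr q) ^ card (jumps \<omega>)"
      using C by (simp add: powr_realpow[symmetric] powr_powr mult.commute)
    then show ?thesis
      using C by (simp add: powr_mult exp_powr_real mult.commute)
  qed
  finally show ?thesis .
qed

text \<open>With \<open>q = p / (p - 1)\<close> and \<open>c = C powr q^2\<close>, the random variable is a product of the power
  \<open>1 / q\<close> of the stochastic exponential of the constant intensity \<open>c\<close> and of the power \<open>1 / p\<close> of
  \<open>exp (e A)\<close>, and Young's inequality separates them. Comparing exponents of \<open>exp A\<close> forces
  \<open>(1 - c) / q + e / p = q\<close>, and this \<open>e\<close> is the rate in the hypothesis.\<close>

lemma jump_exponential_moment:
  fixes p C :: real
  assumes p: "1 < p" and C: "1 < C"
    and exp_A: "integrable M (\<lambda>\<omega>. exp (((2 * p - 1) / (p - 1) + (p - 1) * C powr ((p / (p - 1))\<^sup>2)) * A \<omega> T))"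
  shows "integrable M (\<lambda>\<omega>. exp (p / (p - 1) * A \<omega> T) * (C powr (p / (p - 1))) ^ card (jumps \<omega>))"
proof -
  define q where "q = p / (p - 1)"
  define c where "c = C powr (q\<^sup>2)"
  define e where "e = (2 * p - 1) / (p - 1) + (p - 1) * c"
  have q: "1 < q" "1 / q + 1 / p = 1" using p by (auto simp: q_def field_simps)
  have c: "1 \<le> c" using C by (simp add: c_def ge_one_powr_ge_zero)
  have e: "1 \<le> e"
  proof -
    have "1 \<le> (2 * p - 1) / (p - 1)" using p by (simp add: field_simps)
    moreover have "0 \<le> (p - 1) * c" using p c by simp
    ultimately show ?thesis by (simp add: e_def)
  qed
  have exp_e: "integrable M (\<lambda>\<omega>. exp (e * A \<omega> T))"
    using exp_A by (simp add: e_def c_def q_def)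
  have [measurable]: "(\<lambda>\<omega>. A \<omega> T) \<in> borel_measurable M" using A_measurable[of T] T_pos by simp
  note measurable_power_jumps [measurable]
  have A_pos: "0 \<le> A \<omega> T" if "\<omega> \<in> space M" for \<omega>
    using A_nonneg[OF that, of T] T_pos by simp
  have int_A: "integrable M (\<lambda>\<omega>. A \<omega> T)"
  proof (rule Bochner_Integration.integrable_bound[OF exp_e])
    show "AE \<omega> in M. norm (A \<omega> T) \<le> norm (exp (e * A \<omega> T))"
    proof (rule AE_I2)
      fix \<omega> assume \<omega>: "\<omega> \<in> space M"
      have "A \<omega> T \<le> e * A \<omega> T" using mult_right_mono[OF e A_pos[OF \<omega>]] by simp
      also have "\<dots> \<le> exp (e * A \<omega> T)" using exp_ge_add_one_self[of "e * A \<omega> T"] by linarith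
      finally show "norm (A \<omega> T) \<le> norm (exp (e * A \<omega> T))" using A_pos[OF \<omega>] by simp
    qed
  qed simp
  have pointwise: "exp (q * a) * (C powr q) ^ n \<le> c ^ n * exp ((1 - c) * a) + exp (e * a)" for a :: real and n :: nat
  proof -
    have "exp (q * a) * (C powr q) ^ n = (c ^ n * exp ((1 - c) * a)) powr (1 / q) * exp (e * a) powr (1 / p)"
    proof -
      have "(c ^ n) powr (1 / q) = (C powr q) ^ n"
        using C q by (simp add: c_def powr_realpow[symmetric] powr_powr power2_eq_square mult_ac)
      moreover have "exp ((1 - c) * a) powr (1 / q) * exp (e * a) powr (1 / p) = exp (q * a)"
      proof -
        have "(1 - c) / q + e / p = q"
          using p unfolding e_def q_def by (simp add: field_simps)
        then have "(1 - c) * a * (1 / q) + e * a * (1 / p) = q * a"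
          by (metis (no_types, opaque_lifting) distrib_right mult.commute mult.left_commute times_divide_eq_right mult_1_right)
        then show ?thesis
          by (simp add: exp_powr_real exp_add[symmetric])
      qed
      ultimately show ?thesis
        using c by (simp add: powr_mult mult_ac)
    qed
    also have "\<dots> \<le> ((c ^ n * exp ((1 - c) * a)) powr (1 / q)) powr q + (exp (e * a) powr (1 / p)) powr p"
      using q p c by (intro Young_sum) auto
    also have "\<dots> = c ^ n * exp ((1 - c) * a) + exp (e * a)"
      using q p c by (simp add: powr_powr)
    finally show ?thesis .
  qed
  have "(\<integral>\<^sup>+\<omega>. ennreal (exp (q * A \<omega> T) * (C powr q) ^ card (jumps \<omega>)) \<partial>M)
      \<le> (\<integral>\<^sup>+\<omega>. ennreal (c ^ card (jumps \<omega>) * exp ((1 - c) * A \<omega> T)) + ennreal (exp (e * A \<omega> T)) \<partial>M)"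
    using pointwise c by (intro nn_integral_mono) (simp add: ennreal_plus[symmetric] ennreal_leI del: ennreal_plus)
  also have "\<dots> = (\<integral>\<^sup>+\<omega>. ennreal (c ^ card (jumps \<omega>) * exp ((1 - c) * A \<omega> T)) \<partial>M) + (\<integral>\<^sup>+\<omega>. ennreal (exp (e * A \<omega> T)) \<partial>M)"
    by (rule nn_integral_add) measurable
  also have "\<dots> < \<infinity>"
    using jump_moment[OF c int_A] integrableD(2)[OF exp_e] by (auto simp: less_top intro: le_less_trans)
  finally have "(\<integral>\<^sup>+\<omega>. ennreal (exp (q * A \<omega> T) * (C powr q) ^ card (jumps \<omega>)) \<partial>M) < \<infinity>" .
  then show ?thesis
    unfolding q_def[symmetric] by (simp add: integrable_iff_bounded abs_mult power_abs)
qed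

section \<open>Change of measure\<close>

lemma mean_integral_bounds:
  assumes R: "intensity C R" and \<omega>: "\<omega> \<in> space M"
  shows "0 \<le> (\<integral>s. mark_mean R \<omega> s \<partial>dA \<omega>)" and "(\<integral>s. mark_mean R \<omega> s \<partial>dA \<omega>) \<le> C * A \<omega> T"
proof -
  show "0 \<le> (\<integral>s. mark_mean R \<omega> s \<partial>dA \<omega>)"
    using mark_mean_bounds(1)[OF R \<omega>] by (intro integral_nonneg_AE AE_I2) (simp add: space_dA[OF \<omega>])
  have "(\<integral>s. mark_mean R \<omega> s \<partial>dA \<omega>) \<le> (\<integral>s. C \<partial>dA \<omega>)"
    using mark_mean_bounds(2)[OF R \<omega>]
    by (intro integral_mono integrable_mark_mean[OF R \<omega>] integrable_dA_const[OF \<omega>]) (simp add: space_dA[OF \<omega>])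
  then show "(\<integral>s. mark_mean R \<omega> s \<partial>dA \<omega>) \<le> C * A \<omega> T"
    by (simp add: measure_dA_space[OF \<omega>] mult.commute)
qed

lemma measurable_mean_integral:
  assumes R: "intensity C R"
  shows "(\<lambda>\<omega>. \<integral>s. mark_mean R \<omega> s \<partial>dA \<omega>) \<in> borel_measurable M"
proof -
  have "(\<lambda>\<omega>. A \<omega> T - log_drift R \<omega> T) \<in> borel_measurable M"
    using measurable_compose[OF measurable_event_section predictable_log_drift[OF R], of T] A_measurable[of T] T_pos
    by simp
  then show ?thesis
  proof (rule measurable_cong[THEN iffD1, rotated])
    fix \<omega> assume \<omega>: "\<omega> \<in> space M"
    show "A \<omega> T - log_drift R \<omega> T = (\<integral>s. mark_mean R \<omega> s \<partial>dA \<omega>)"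
      unfolding log_drift_terminal[OF \<omega>]
      using integrable_mark_mean[OF R \<omega>] integrable_dA_const[OF \<omega>] by (simp add: measure_dA_space[OF \<omega>])
  qed
qed

lemma nn_integral_mark_mean:
  assumes R: "intensity C R" and \<omega>: "\<omega> \<in> space M"
  shows "(\<integral>\<^sup>+t. \<integral>\<^sup>+x. ennreal (R \<omega> t x) \<partial>\<phi> \<omega> t \<partial>dA \<omega>) = ennreal (\<integral>s. mark_mean R \<omega> s \<partial>dA \<omega>)"
proof -
  have "(\<integral>\<^sup>+t. \<integral>\<^sup>+x. ennreal (R \<omega> t x) \<partial>\<phi> \<omega> t \<partial>dA \<omega>) = (\<integral>\<^sup>+t. ennreal (mark_mean R \<omega> t) \<partial>dA \<omega>)"
    by (intro nn_integral_cong ennreal_mark_mean[OF R \<omega>]) (simp add: space_dA[OF \<omega>])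
  also have "\<dots> = ennreal (\<integral>s. mark_mean R \<omega> s \<partial>dA \<omega>)"
    using mark_mean_bounds(1)[OF R \<omega>]
    by (intro nn_integral_eq_integral integrable_mark_mean[OF R \<omega>] AE_I2) (simp add: space_dA[OF \<omega>])
  finally show ?thesis .
qed

text \<open>Multiplying the compensator by \<open>R\<close> is the effect of the change of measure, for small integrands.
  The trick is to perturb the intensity: \<open>R (1 + e H)\<close> is again an intensity, and its density is
  that of \<open>R\<close> times \<open>exp (- e \<integral>\<integral> R H d\<nu>) \<Prod> (1 + e H)\<close>. As all these densities have expectation \<open>1\<close>,
  the derivative at \<open>e = 0\<close> of the expectation vanishes, and this derivative is the expectation of
  \<open>(\<Sum> H - \<integral>\<integral> R H d\<nu>)\<close> under the new measure. The room between \<open>C\<close> and \<open>C (1 + \<eta>)\<close> dominates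
  the difference quotients.\<close>

lemma compensation_under_density_bounded:
  assumes R: "intensity C R" and C: "1 \<le> C" and \<kappa>: "1 < \<kappa>" and \<eta>: "0 < \<eta>"
    and D: "integrable M (\<lambda>\<omega>. exp (\<kappa> * A \<omega> T) * (C * (1 + \<eta>)) ^ card (jumps \<omega>))"
    and H: "intensity \<eta> H"
  defines "RH \<equiv> \<lambda>\<omega> t x. R \<omega> t x * H \<omega> t x"
  shows "integrable M (\<lambda>\<omega>. jump_density R \<omega> * (\<Sum>n\<in>jumps \<omega>. H \<omega> (\<tau> n \<omega>) (X n \<omega>)))"
    and "integrable M (\<lambda>\<omega>. jump_density R \<omega> * (\<integral>s. mark_mean RH \<omega> s \<partial>dA \<omega>))"
    and "(\<integral>\<omega>. jump_density R \<omega> * (\<Sum>n\<in>jumps \<omega>. H \<omega> (\<tau> n \<omega>) (X n \<omega>)) \<partial>M)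
       = (\<integral>\<omega>. jump_density R \<omega> * (\<integral>s. mark_mean RH \<omega> s \<partial>dA \<omega>) \<partial>M)"
proof -
  let ?L = "jump_density R"
  define a where "a \<omega> = (\<integral>s. mark_mean RH \<omega> s \<partial>dA \<omega>)" for \<omega>
  define \<Sigma> where "\<Sigma> \<omega> = (\<Sum>n\<in>jumps \<omega>. H \<omega> (\<tau> n \<omega>) (X n \<omega>))" for \<omega>
  define N where "N \<omega> = card (jumps \<omega>)" for \<omega>
  have RH: "intensity (C * \<eta>) RH"
    unfolding RH_def using intensity_mult[OF R H] C \<eta> by simp
  have C\<eta>: "1 \<le> C * (1 + \<eta>)" "C \<le> C * (1 + \<eta>)"
    using C \<eta> mult_mono[of 1 C 1 "1 + \<eta>"] by auto
  note [measurable] = measurable_jump_density[OF R]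
  have a_meas [measurable]: "a \<in> borel_measurable M"
    unfolding a_def by (rule measurable_mean_integral[OF RH])
  have \<Sigma>_meas [measurable]: "\<Sigma> \<in> borel_measurable M"
    unfolding \<Sigma>_def by (rule measurable_jump_sum[OF intensityD(1)[OF H]])
  have N_meas [measurable]: "(\<lambda>\<omega>. (c::real) ^ N \<omega>) \<in> borel_measurable M" for c
    unfolding N_def by (rule measurable_power_jumps)
  have A_pos: "0 \<le> A \<omega> T" if "\<omega> \<in> space M" for \<omega>
    using A_nonneg[OF that, of T] T_pos by simp
  have a_bounds: "0 \<le> a \<omega>" "a \<omega> \<le> C * \<eta> * A \<omega> T" if "\<omega> \<in> space M" for \<omega>
    unfolding a_def using mean_integral_bounds[OF RH that] by auto
  have h_bounds: "0 \<le> H \<omega> (\<tau> n \<omega>) (X n \<omega>)" "H \<omega> (\<tau> n \<omega>) (X n \<omega>) \<le> \<eta>" if "\<omega> \<in> space M" "n \<in> jumps \<omega>" for \<omega> n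
    using intensityD(2,3)[OF H that(1) \<tau>_in[OF that]] by auto
  \<comment> \<open>the density of the perturbed intensity relative to the density \<open>L\<close> of \<open>R\<close>\<close>
  define G where "G e \<omega> = exp (- e * a \<omega>) * (\<Prod>n\<in>jumps \<omega>. 1 + e * H \<omega> (\<tau> n \<omega>) (X n \<omega>))" for e \<omega>
  define R' where "R' e \<omega> t x = R \<omega> t x * (1 + e * H \<omega> t x)" for e \<omega> t x
  have R': "intensity (C * (1 + \<eta>)) (R' e)" if e: "0 \<le> e" "e \<le> 1" for e
  proof -
    have "intensity (1 + \<eta>) (\<lambda>\<omega> t x. 1 + e * H \<omega> t x)"
      unfolding intensity_def
    proof (intro conjI ballI allI)
      have "(\<lambda>z. H (fst (fst z)) (snd (fst z)) (snd z)) \<in> borel_measurable (\<P> \<Otimes>\<^sub>M borel)"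
        using intensityD(1)[OF H] by (simp add: split_beta')
      then have "(\<lambda>z. 1 + e * H (fst (fst z)) (snd (fst z)) (snd z)) \<in> borel_measurable (\<P> \<Otimes>\<^sub>M borel)"
        by (intro borel_measurable_add borel_measurable_times borel_measurable_const)
      then show "predictable_field (\<lambda>\<omega> t x. 1 + e * H \<omega> t x)"
        by (simp add: split_beta')
      fix \<omega> t x assume "\<omega> \<in> space M" "t \<in> {0..T}"
      note b = intensityD(2,3)[OF H this, of x]
      show "0 \<le> 1 + e * H \<omega> t x" using b e by simp
      show "1 + e * H \<omega> t x \<le> 1 + \<eta>"
        using mult_mono[of e 1 "H \<omega> t x" \<eta>] b e by simp
    qed
    from intensity_mult[OF R this] show ?thesis
      unfolding R'_def using C \<eta> by simp
  qed
  have L_R': "jump_density (R' e) \<omega> = ?L \<omega> * G e \<omega>" if e: "0 \<le> e" "e \<le> 1" and \<omega>: "\<omega> \<in> space M" for e \<omega>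
  proof -
    have "mark_mean (R' e) \<omega> s = mark_mean R \<omega> s + e * mark_mean RH \<omega> s" if s: "s \<in> {0..T}" for s
    proof -
      have "mark_mean (R' e) \<omega> s = (\<integral>x. R \<omega> s x + e * RH \<omega> s x \<partial>\<phi> \<omega> s)"
        unfolding mark_mean_def R'_def RH_def by (simp add: algebra_simps)
      also have "\<dots> = mark_mean R \<omega> s + e * mark_mean RH \<omega> s"
        using integrable_mark[OF R \<omega> s] integrable_mark[OF RH \<omega> s] by (simp add: mark_mean_def)
      finally show ?thesis .
    qed
    then have "log_drift (R' e) \<omega> T = (\<integral>s. (1 - mark_mean R \<omega> s) - e * mark_mean RH \<omega> s \<partial>dA \<omega>)"
      unfolding log_drift_terminal[OF \<omega>]
      by (intro Bochner_Integration.integral_cong) (auto simp: space_dA[OF \<omega>])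
    also have "\<dots> = log_drift R \<omega> T - e * a \<omega>"
      unfolding log_drift_terminal[OF \<omega>] a_def
      using integrable_mark_mean[OF R \<omega>] integrable_mark_mean[OF RH \<omega>] integrable_dA_const[OF \<omega>] by simp
    finally have "log_drift (R' e) \<omega> T = log_drift R \<omega> T + (- e * a \<omega>)"
      by simp
    then show ?thesis
      by (simp only: jump_density_def G_def R'_def prod.distrib exp_add mult_ac)
  qed
  note L_int = expectation_jump_density_dominated[OF R C \<kappa>]
  have D_pos: "0 \<le> exp (\<kappa> * A \<omega> T) * (C * (1 + \<eta>)) ^ N \<omega>" for \<omega>
    using C\<eta> by simp
  have powC: "C ^ N \<omega> \<le> (C * (1 + \<eta>)) ^ N \<omega>" for \<omega>
    using C C\<eta> by (intro power_mono) auto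
  have DC: "integrable M (\<lambda>\<omega>. exp (\<kappa> * A \<omega> T) * C ^ card (jumps \<omega>))"
  proof (rule Bochner_Integration.integrable_bound[OF D])
    have [measurable]: "(\<lambda>\<omega>. A \<omega> T) \<in> borel_measurable M" using A_measurable[of T] T_pos by simp
    show "(\<lambda>\<omega>. exp (\<kappa> * A \<omega> T) * C ^ card (jumps \<omega>)) \<in> borel_measurable M"
      using N_meas[of C] unfolding N_def by measurable
    show "AE \<omega> in M. norm (exp (\<kappa> * A \<omega> T) * C ^ card (jumps \<omega>)) \<le> norm (exp (\<kappa> * A \<omega> T) * (C * (1 + \<eta>)) ^ card (jumps \<omega>))"
      using powC C C\<eta> by (intro AE_I2) (simp add: N_def abs_mult power_abs)
  qed
  have L: "integrable M ?L" "(\<integral>\<omega>. ?L \<omega> \<partial>M) = 1"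
    using L_int[OF DC] by auto
  have LG: "integrable M (\<lambda>\<omega>. ?L \<omega> * G e \<omega>)" "(\<integral>\<omega>. ?L \<omega> * G e \<omega> \<partial>M) = 1" if e: "0 \<le> e" "e \<le> 1" for e
  proof -
    note * = expectation_jump_density_dominated[OF R'[OF e] C\<eta>(1) \<kappa> D]
    show "integrable M (\<lambda>\<omega>. ?L \<omega> * G e \<omega>)"
      using *(1) by (rule Bochner_Integration.integrable_cong[THEN iffD1, rotated 2]) (auto simp: L_R'[OF e])
    show "(\<integral>\<omega>. ?L \<omega> * G e \<omega> \<partial>M) = 1"
      using *(2) by (simp add: L_R'[OF e] cong: Bochner_Integration.integral_cong)
  qed
  have L_pos: "0 \<le> ?L \<omega>" and L_le: "?L \<omega> \<le> exp (A \<omega> T) * C ^ N \<omega>" if "\<omega> \<in> space M" for \<omega>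
    using jump_density_bounds[OF R C that] by (auto simp: N_def)
  \<comment> \<open>the difference quotients are at most \<open>(1 + \<eta>)^N + a\<close>; both terms are integrable against \<open>L\<close>\<close>
  have dom1_le: "?L \<omega> * (1 + \<eta>) ^ N \<omega> \<le> exp (\<kappa> * A \<omega> T) * (C * (1 + \<eta>)) ^ N \<omega>" if \<omega>: "\<omega> \<in> space M" for \<omega>
  proof -
    have "?L \<omega> * (1 + \<eta>) ^ N \<omega> \<le> (exp (A \<omega> T) * C ^ N \<omega>) * (1 + \<eta>) ^ N \<omega>"
      using L_le[OF \<omega>] \<eta> by (intro mult_right_mono) auto
    also have "\<dots> = exp (A \<omega> T) * (C * (1 + \<eta>)) ^ N \<omega>"
      by (simp add: power_mult_distrib)
    also have "\<dots> \<le> exp (\<kappa> * A \<omega> T) * (C * (1 + \<eta>)) ^ N \<omega>"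
      using mult_right_mono[of 1 \<kappa> "A \<omega> T"] \<kappa> A_pos[OF \<omega>] C\<eta> by (intro mult_right_mono) auto
    finally show ?thesis .
  qed
  have dom2_le: "?L \<omega> * a \<omega> \<le> (C * \<eta> / (\<kappa> - 1)) * (exp (\<kappa> * A \<omega> T) * (C * (1 + \<eta>)) ^ N \<omega>)" if \<omega>: "\<omega> \<in> space M" for \<omega>
  proof -
    have "?L \<omega> * a \<omega> \<le> (exp (A \<omega> T) * C ^ N \<omega>) * (C * \<eta> * A \<omega> T)"
      using L_le[OF \<omega>] L_pos[OF \<omega>] a_bounds[OF \<omega>] C by (intro mult_mono) auto
    also have "\<dots> = C * \<eta> * (A \<omega> T * exp (A \<omega> T)) * C ^ N \<omega>"
      by (simp add: mult_ac)
    also have "\<dots> \<le> C * \<eta> * (1 / (\<kappa> - 1) * exp (\<kappa> * A \<omega> T)) * (C * (1 + \<eta>)) ^ N \<omega>"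
    proof (rule mult_mono)
      show "C * \<eta> * (A \<omega> T * exp (A \<omega> T)) \<le> C * \<eta> * (1 / (\<kappa> - 1) * exp (\<kappa> * A \<omega> T))"
        using C \<eta> by (intro mult_left_mono[OF mult_exp_le[OF \<kappa> A_pos[OF \<omega>]]]) simp
    qed (use powC[of \<omega>] C \<eta> \<kappa> in auto)
    finally show ?thesis by (simp add: field_simps)
  qed
  have dom1: "integrable M (\<lambda>\<omega>. ?L \<omega> * (1 + \<eta>) ^ N \<omega>)"
  proof (rule Bochner_Integration.integrable_bound[OF D])
    show "AE \<omega> in M. norm (?L \<omega> * (1 + \<eta>) ^ N \<omega>) \<le> norm (exp (\<kappa> * A \<omega> T) * (C * (1 + \<eta>)) ^ card (jumps \<omega>))"
    proof (rule AE_I2)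
      fix \<omega> assume \<omega>: "\<omega> \<in> space M"
      have "norm (?L \<omega> * (1 + \<eta>) ^ N \<omega>) = ?L \<omega> * (1 + \<eta>) ^ N \<omega>"
        using L_pos[OF \<omega>] \<eta> by simp
      also note dom1_le[OF \<omega>]
      finally show "norm (?L \<omega> * (1 + \<eta>) ^ N \<omega>) \<le> norm (exp (\<kappa> * A \<omega> T) * (C * (1 + \<eta>)) ^ card (jumps \<omega>))"
        unfolding N_def by (rule order_trans) (simp only: real_norm_def abs_ge_self)
    qed
  qed simp
  have dom2: "integrable M (\<lambda>\<omega>. ?L \<omega> * a \<omega>)"
  proof (rule Bochner_Integration.integrable_bound[OF integrable_mult_right[OF D, of "C * \<eta> / (\<kappa> - 1)"]])
    show "AE \<omega> in M. norm (?L \<omega> * a \<omega>) \<le> norm (C * \<eta> / (\<kappa> - 1) * (exp (\<kappa> * A \<omega> T) * (C * (1 + \<eta>)) ^ card (jumps \<omega>)))"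
    proof (rule AE_I2)
      fix \<omega> assume \<omega>: "\<omega> \<in> space M"
      have "norm (?L \<omega> * a \<omega>) = ?L \<omega> * a \<omega>"
        using L_pos[OF \<omega>] a_bounds(1)[OF \<omega>] by simp
      also note dom2_le[OF \<omega>]
      finally show "norm (?L \<omega> * a \<omega>) \<le> norm (C * \<eta> / (\<kappa> - 1) * (exp (\<kappa> * A \<omega> T) * (C * (1 + \<eta>)) ^ card (jumps \<omega>)))"
        unfolding N_def by (rule order_trans) (simp only: real_norm_def abs_ge_self)
    qed
  qed simp
  have prod_le: "(\<Prod>n\<in>jumps \<omega>. 1 + H \<omega> (\<tau> n \<omega>) (X n \<omega>)) \<le> (1 + \<eta>) ^ N \<omega>" if \<omega>: "\<omega> \<in> space M" for \<omega>
    unfolding N_def using finite_jumps[OF \<omega>] h_bounds[OF \<omega>] \<eta> by (intro prod_le_power_card) auto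
  have \<Sigma>_bounds: "0 \<le> \<Sigma> \<omega>" "\<Sigma> \<omega> \<le> (1 + \<eta>) ^ N \<omega>" if \<omega>: "\<omega> \<in> space M" for \<omega>
  proof -
    show "0 \<le> \<Sigma> \<omega>" unfolding \<Sigma>_def using h_bounds[OF \<omega>] by (intro sum_nonneg)
    have "1 + \<Sigma> \<omega> \<le> (\<Prod>n\<in>jumps \<omega>. 1 + H \<omega> (\<tau> n \<omega>) (X n \<omega>))"
      unfolding \<Sigma>_def using h_bounds[OF \<omega>] finite_jumps[OF \<omega>] by (intro one_plus_sum_le_prod)
    then show "\<Sigma> \<omega> \<le> (1 + \<eta>) ^ N \<omega>" using prod_le[OF \<omega>] by linarith
  qed
  have L\<Sigma>: "integrable M (\<lambda>\<omega>. ?L \<omega> * \<Sigma> \<omega>)"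
  proof (rule Bochner_Integration.integrable_bound[OF dom1])
    show "AE \<omega> in M. norm (?L \<omega> * \<Sigma> \<omega>) \<le> norm (?L \<omega> * (1 + \<eta>) ^ N \<omega>)"
      using \<Sigma>_bounds L_pos \<eta> by (intro AE_I2) (simp add: abs_mult power_abs mult_left_mono)
  qed simp
  define ee where "ee j = inverse (real (Suc j))" for j
  have ee: "0 < ee j" "ee j \<le> 1" for j
    by (auto simp: ee_def inverse_le_1_iff)
  have G_bound: "\<bar>(G e \<omega> - 1) / e\<bar> \<le> (1 + \<eta>) ^ N \<omega> + a \<omega>" if e: "0 < e" "e \<le> 1" and \<omega>: "\<omega> \<in> space M" for e \<omega>
  proof -
    define P where "P = (\<Prod>n\<in>jumps \<omega>. 1 + e * H \<omega> (\<tau> n \<omega>) (X n \<omega>))"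
    have P: "1 \<le> P" "P - 1 \<le> e * ((\<Prod>n\<in>jumps \<omega>. 1 + H \<omega> (\<tau> n \<omega>) (X n \<omega>)) - 1)"
      using prod_perturb_bounds[OF finite_jumps[OF \<omega>], of "\<lambda>n. H \<omega> (\<tau> n \<omega>) (X n \<omega>)" e] h_bounds[OF \<omega>] e by (auto simp: P_def)
    have ea: "0 \<le> e * a \<omega>" using a_bounds(1)[OF \<omega>] e by simp
    have "exp (- (e * a \<omega>)) \<le> 1" using ea by simp
    then have "exp (- (e * a \<omega>)) * P \<le> 1 * P"
      using P(1) by (intro mult_right_mono) auto
    moreover have "P - 1 \<le> e * ((1 + \<eta>) ^ N \<omega>)"
    proof -
      have "e * (\<Prod>n\<in>jumps \<omega>. 1 + H \<omega> (\<tau> n \<omega>) (X n \<omega>)) \<le> e * (1 + \<eta>) ^ N \<omega>"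
        using e by (intro mult_left_mono[OF prod_le[OF \<omega>]]) simp
      then show ?thesis
        using P(2) e unfolding right_diff_distrib by linarith
    qed
    ultimately have up: "G e \<omega> - 1 \<le> e * ((1 + \<eta>) ^ N \<omega> + a \<omega>)"
      using ea unfolding G_def P_def[symmetric] distrib_left minus_mult_left[symmetric] by linarith
    have "exp (- (e * a \<omega>)) * 1 \<le> exp (- (e * a \<omega>)) * P"
      using P(1) by (intro mult_left_mono) auto
    moreover have "1 - e * a \<omega> \<le> exp (- (e * a \<omega>))"
      using exp_ge_add_one_self[of "- (e * a \<omega>)"] by simp
    moreover have "0 \<le> e * (1 + \<eta>) ^ N \<omega>" using e \<eta> by simp
    ultimately have "- (e * ((1 + \<eta>) ^ N \<omega> + a \<omega>)) \<le> G e \<omega> - 1"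
      unfolding G_def P_def[symmetric] distrib_left minus_mult_left[symmetric] by linarith
    with up have "\<bar>G e \<omega> - 1\<bar> \<le> e * ((1 + \<eta>) ^ N \<omega> + a \<omega>)"
      by (simp add: abs_le_iff)
    then show ?thesis
      using e by (simp add: abs_divide divide_le_eq mult.commute)
  qed
  have lim: "(\<lambda>j. (G (ee j) \<omega> - 1) / ee j) \<longlonglongrightarrow> \<Sigma> \<omega> - a \<omega>" if \<omega>: "\<omega> \<in> space M" for \<omega>
  proof -
    have "((\<lambda>e. G e \<omega>) has_field_derivative (exp (- 0 * a \<omega>) * \<Sigma> \<omega> + (- a \<omega>) * (\<Prod>n\<in>jumps \<omega>. 1 + 0 * H \<omega> (\<tau> n \<omega>) (X n \<omega>)))) (at 0)"
      unfolding G_def \<Sigma>_def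
      by (rule DERIV_mult'[OF _ prod_perturb_derivative[OF finite_jumps[OF \<omega>]]]) (auto intro!: derivative_eq_intros)
    then have "((\<lambda>e. (G e \<omega> - G 0 \<omega>) / (e - 0)) \<longlongrightarrow> \<Sigma> \<omega> - a \<omega>) (at 0)"
      unfolding has_field_derivative_iff by simp
    moreover have "filterlim ee (at 0) sequentially"
      unfolding filterlim_at ee_def using LIMSEQ_inverse_real_of_nat by simp
    ultimately have "(\<lambda>j. (G (ee j) \<omega> - G 0 \<omega>) / (ee j - 0)) \<longlonglongrightarrow> \<Sigma> \<omega> - a \<omega>"
      by (rule filterlim_compose)
    then show ?thesis by (simp add: G_def)
  qed
  have zero: "(\<integral>\<omega>. ?L \<omega> * ((G (ee j) \<omega> - 1) / ee j) \<partial>M) = 0" for j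
  proof -
    have eq: "?L \<omega> * ((G (ee j) \<omega> - 1) / ee j) = (?L \<omega> * G (ee j) \<omega> - ?L \<omega>) / ee j" for \<omega>
      by (simp add: field_simps)
    have "(\<integral>\<omega>. ?L \<omega> * ((G (ee j) \<omega> - 1) / ee j) \<partial>M) = (\<integral>\<omega>. ?L \<omega> * G (ee j) \<omega> - ?L \<omega> \<partial>M) / ee j"
      unfolding eq by (rule integral_divide_zero)
    also have "\<dots> = 0"
      using LG[of "ee j"] L ee[of j] by simp
    finally show ?thesis .
  qed
  have "(\<lambda>j. \<integral>\<omega>. ?L \<omega> * ((G (ee j) \<omega> - 1) / ee j) \<partial>M) \<longlonglongrightarrow> (\<integral>\<omega>. ?L \<omega> * (\<Sigma> \<omega> - a \<omega>) \<partial>M)"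
  proof (rule integral_dominated_convergence[where w="\<lambda>\<omega>. ?L \<omega> * (1 + \<eta>) ^ N \<omega> + ?L \<omega> * a \<omega>"])
    show "integrable M (\<lambda>\<omega>. ?L \<omega> * (1 + \<eta>) ^ N \<omega> + ?L \<omega> * a \<omega>)"
      using dom1 dom2 by simp
    show "(\<lambda>\<omega>. ?L \<omega> * ((G (ee j) \<omega> - 1) / ee j)) \<in> borel_measurable M" for j
    proof -
      have "(\<lambda>\<omega>. (?L \<omega> * G (ee j) \<omega> - ?L \<omega>) / ee j) \<in> borel_measurable M"
        using LG(1)[of "ee j"] ee[of j] by (intro borel_measurable_divide borel_measurable_diff borel_measurable_integrable) (auto intro: L)
      then show ?thesis by (simp add: field_simps)
    qed
    show "AE \<omega> in M. (\<lambda>j. ?L \<omega> * ((G (ee j) \<omega> - 1) / ee j)) \<longlonglongrightarrow> ?L \<omega> * (\<Sigma> \<omega> - a \<omega>)"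
      using lim by (intro AE_I2 tendsto_mult tendsto_const)
    show "AE \<omega> in M. norm (?L \<omega> * ((G (ee j) \<omega> - 1) / ee j)) \<le> ?L \<omega> * (1 + \<eta>) ^ N \<omega> + ?L \<omega> * a \<omega>" for j
    proof (rule AE_I2)
      fix \<omega> assume \<omega>: "\<omega> \<in> space M"
      have "norm (?L \<omega> * ((G (ee j) \<omega> - 1) / ee j)) = ?L \<omega> * \<bar>(G (ee j) \<omega> - 1) / ee j\<bar>"
        using L_pos[OF \<omega>] by (simp add: abs_mult)
      also have "\<dots> \<le> ?L \<omega> * ((1 + \<eta>) ^ N \<omega> + a \<omega>)"
        by (intro mult_left_mono G_bound ee L_pos \<omega>)
      finally show "norm (?L \<omega> * ((G (ee j) \<omega> - 1) / ee j)) \<le> ?L \<omega> * (1 + \<eta>) ^ N \<omega> + ?L \<omega> * a \<omega>"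
        by (simp add: distrib_left)
    qed
  qed simp
  then have "(\<integral>\<omega>. ?L \<omega> * (\<Sigma> \<omega> - a \<omega>) \<partial>M) = 0"
    unfolding zero by (simp add: LIMSEQ_const_iff)
  then have "(\<integral>\<omega>. ?L \<omega> * \<Sigma> \<omega> \<partial>M) = (\<integral>\<omega>. ?L \<omega> * a \<omega> \<partial>M)"
    using L\<Sigma> dom2 by (simp add: right_diff_distrib)
  then show "(\<integral>\<omega>. ?L \<omega> * (\<Sum>n\<in>jumps \<omega>. H \<omega> (\<tau> n \<omega>) (X n \<omega>)) \<partial>M) = (\<integral>\<omega>. ?L \<omega> * (\<integral>s. mark_mean RH \<omega> s \<partial>dA \<omega>) \<partial>M)"
    by (simp add: \<Sigma>_def a_def)
  show "integrable M (\<lambda>\<omega>. ?L \<omega> * (\<Sum>n\<in>jumps \<omega>. H \<omega> (\<tau> n \<omega>) (X n \<omega>)))"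
    using L\<Sigma> by (simp add: \<Sigma>_def)
  show "integrable M (\<lambda>\<omega>. ?L \<omega> * (\<integral>s. mark_mean RH \<omega> s \<partial>dA \<omega>))"
    using dom2 by (simp add: a_def)
qed

text \<open>The formula is linear in \<open>H\<close>, so that truncations of \<open>H\<close> at the level \<open>k\<close>, scaled below \<open>\<eta>\<close>, reduce it to
  the previous one; then \<open>k\<close> tends to infinity.\<close>

lemma compensation_under_density:
  fixes H :: "'a \<Rightarrow> real \<Rightarrow> 'k \<Rightarrow> ennreal"
  assumes R: "intensity C R" and C: "1 \<le> C" and \<kappa>: "1 < \<kappa>" and \<eta>: "0 < \<eta>"
    and D: "integrable M (\<lambda>\<omega>. exp (\<kappa> * A \<omega> T) * (C * (1 + \<eta>)) ^ card (jumps \<omega>))"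
    and H: "predictable_field H"
  shows "(\<integral>\<^sup>+\<omega>. ennreal (jump_density R \<omega>) * (\<Sum>n\<in>jumps \<omega>. H \<omega> (\<tau> n \<omega>) (X n \<omega>)) \<partial>M)
       = (\<integral>\<^sup>+\<omega>. ennreal (jump_density R \<omega>) * (\<integral>\<^sup>+t. \<integral>\<^sup>+x. ennreal (R \<omega> t x) * H \<omega> t x \<partial>\<phi> \<omega> t \<partial>dA \<omega>) \<partial>M)"
proof -
  let ?L = "\<lambda>\<omega>. ennreal (jump_density R \<omega>)"
  have [measurable]: "?L \<in> borel_measurable M"
    using measurable_jump_density[OF R] by measurable
  define HK where "HK k \<omega> t x = min (H \<omega> t x) (ennreal (real (Suc k)))" for k \<omega> t x
  have HK_field: "predictable_field (HK k)" for k
  proof -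
    have "(\<lambda>z. min (H (fst (fst z)) (snd (fst z)) (snd z)) (ennreal (real (Suc k)))) \<in> borel_measurable (\<P> \<Otimes>\<^sub>M borel)"
      using H by (intro borel_measurable_min borel_measurable_const) (simp add: split_beta')
    then show ?thesis unfolding HK_def split_beta' .
  qed
  note RHK_field = measurable_field_times[OF measurable_field_ennreal[OF intensityD(1)[OF R]] HK_field]
  have HK_sup: "(SUP k. HK k \<omega> t x) = H \<omega> t x" for \<omega> t x
    unfolding HK_def by (rule SUP_min_real)
  have HK_inc: "incseq (\<lambda>k. HK k \<omega> t x)" for \<omega> t x
    unfolding HK_def incseq_def by (intro allI impI min.mono order_refl ennreal_leI) simp
  have step: "(\<integral>\<^sup>+\<omega>. ?L \<omega> * (\<Sum>n\<in>jumps \<omega>. HK k \<omega> (\<tau> n \<omega>) (X n \<omega>)) \<partial>M)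
      = (\<integral>\<^sup>+\<omega>. ?L \<omega> * (\<integral>\<^sup>+t. \<integral>\<^sup>+x. ennreal (R \<omega> t x) * HK k \<omega> t x \<partial>\<phi> \<omega> t \<partial>dA \<omega>) \<partial>M)" for k
  proof -
    define c where "c = \<eta> / real (Suc k)"
    have c: "0 < c" using \<eta> by (simp add: c_def)
    define h where "h \<omega> t x = c * enn2real (HK k \<omega> t x)" for \<omega> t x
    have HK_fin: "HK k \<omega> t x \<noteq> top" "HK k \<omega> t x \<le> ennreal (real (Suc k))" for \<omega> t x
      by (auto simp: HK_def min_def top_unique simp del: of_nat_Suc)
    have HK_le: "enn2real (HK k \<omega> t x) \<le> real (Suc k)" for \<omega> t x
      using enn2real_mono[OF HK_fin(2)[of \<omega> t x]] by (simp del: of_nat_Suc)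
    have h_enn: "ennreal (h \<omega> t x) = ennreal c * HK k \<omega> t x" for \<omega> t x
      unfolding h_def using c HK_fin(1)[of \<omega> t x] by (simp add: ennreal_mult less_top)
    have h: "intensity \<eta> h"
      unfolding intensity_def
    proof (intro conjI ballI allI)
      have "(\<lambda>z. enn2real (HK k (fst (fst z)) (snd (fst z)) (snd z))) \<in> borel_measurable (\<P> \<Otimes>\<^sub>M borel)"
        using measurable_compose[OF HK_field borel_measurable_enn2real[OF measurable_ident]] by (simp add: split_beta')
      then have "(\<lambda>z. c * enn2real (HK k (fst (fst z)) (snd (fst z)) (snd z))) \<in> borel_measurable (\<P> \<Otimes>\<^sub>M borel)"
        by (intro borel_measurable_times borel_measurable_const)
      then show "predictable_field h" by (simp add: h_def split_beta')
      show "0 \<le> h \<omega> t x" for \<omega> t x using c by (simp add: h_def)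
      show "h \<omega> t x \<le> \<eta>" for \<omega> t x
        using mult_left_mono[OF HK_le[of \<omega> t x], of c] c unfolding h_def c_def by simp
    qed
    have Rh: "intensity (C * \<eta>) (\<lambda>\<omega> t x. R \<omega> t x * h \<omega> t x)"
      using intensity_mult[OF R h] C \<eta> by simp
    note b = compensation_under_density_bounded[OF R C \<kappa> \<eta> D h]
    have L_pos: "0 \<le> jump_density R \<omega>" if "\<omega> \<in> space M" for \<omega>
      by (rule jump_density_bounds(1)[OF R C that])
    have h_pos: "0 \<le> h \<omega> t x" for \<omega> t x using c by (simp add: h_def)
    have "(\<integral>\<^sup>+\<omega>. ?L \<omega> * (ennreal c * (\<Sum>n\<in>jumps \<omega>. HK k \<omega> (\<tau> n \<omega>) (X n \<omega>))) \<partial>M)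
        = (\<integral>\<^sup>+\<omega>. ennreal (jump_density R \<omega> * (\<Sum>n\<in>jumps \<omega>. h \<omega> (\<tau> n \<omega>) (X n \<omega>))) \<partial>M)"
    proof (rule nn_integral_cong)
      fix \<omega> assume \<omega>: "\<omega> \<in> space M"
      have "ennreal (\<Sum>n\<in>jumps \<omega>. h \<omega> (\<tau> n \<omega>) (X n \<omega>)) = ennreal c * (\<Sum>n\<in>jumps \<omega>. HK k \<omega> (\<tau> n \<omega>) (X n \<omega>))"
        using h_pos by (simp add: sum_ennreal[symmetric] h_enn sum_distrib_left)
      then show "?L \<omega> * (ennreal c * (\<Sum>n\<in>jumps \<omega>. HK k \<omega> (\<tau> n \<omega>) (X n \<omega>))) = ennreal (jump_density R \<omega> * (\<Sum>n\<in>jumps \<omega>. h \<omega> (\<tau> n \<omega>) (X n \<omega>)))"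
        using L_pos[OF \<omega>] h_pos by (simp add: ennreal_mult sum_nonneg)
    qed
    also have "\<dots> = ennreal (\<integral>\<omega>. jump_density R \<omega> * (\<Sum>n\<in>jumps \<omega>. h \<omega> (\<tau> n \<omega>) (X n \<omega>)) \<partial>M)"
      using L_pos h_pos by (intro nn_integral_eq_integral b AE_I2 mult_nonneg_nonneg sum_nonneg)
    also have "\<dots> = (\<integral>\<^sup>+\<omega>. ennreal (jump_density R \<omega> * (\<integral>s. mark_mean (\<lambda>\<omega> t x. R \<omega> t x * h \<omega> t x) \<omega> s \<partial>dA \<omega>)) \<partial>M)"
      unfolding b(3) using L_pos mean_integral_bounds(1)[OF Rh]
      by (intro nn_integral_eq_integral[symmetric] b AE_I2 mult_nonneg_nonneg)
    also have "\<dots> = (\<integral>\<^sup>+\<omega>. ?L \<omega> * (ennreal c * (\<integral>\<^sup>+t. \<integral>\<^sup>+x. ennreal (R \<omega> t x) * HK k \<omega> t x \<partial>\<phi> \<omega> t \<partial>dA \<omega>)) \<partial>M)"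
    proof (rule nn_integral_cong)
      fix \<omega> assume \<omega>: "\<omega> \<in> space M"
      have RHK_t: "(\<lambda>t. \<integral>\<^sup>+x. ennreal (R \<omega> t x) * HK k \<omega> t x \<partial>\<phi> \<omega> t) \<in> borel_measurable (dA \<omega>)"
        by (rule measurable_time_path[OF predictable_mark_nn_integral[OF RHK_field] \<omega>])
      have "ennreal (\<integral>s. mark_mean (\<lambda>\<omega> t x. R \<omega> t x * h \<omega> t x) \<omega> s \<partial>dA \<omega>) = (\<integral>\<^sup>+t. \<integral>\<^sup>+x. ennreal (R \<omega> t x * h \<omega> t x) \<partial>\<phi> \<omega> t \<partial>dA \<omega>)"
        by (rule nn_integral_mark_mean[OF Rh \<omega>, symmetric])
      also have "\<dots> = (\<integral>\<^sup>+t. ennreal c * (\<integral>\<^sup>+x. ennreal (R \<omega> t x) * HK k \<omega> t x \<partial>\<phi> \<omega> t) \<partial>dA \<omega>)"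
      proof (rule nn_integral_cong)
        fix t assume "t \<in> space (dA \<omega>)"
        then have t: "t \<in> {0..T}" by (simp add: space_dA[OF \<omega>])
        have "(\<integral>\<^sup>+x. ennreal (R \<omega> t x * h \<omega> t x) \<partial>\<phi> \<omega> t) = (\<integral>\<^sup>+x. ennreal c * (ennreal (R \<omega> t x) * HK k \<omega> t x) \<partial>\<phi> \<omega> t)"
          using intensityD(2)[OF R \<omega> t] h_pos by (intro nn_integral_cong) (simp add: ennreal_mult h_enn mult_ac)
        also have "\<dots> = ennreal c * (\<integral>\<^sup>+x. ennreal (R \<omega> t x) * HK k \<omega> t x \<partial>\<phi> \<omega> t)"
          by (rule nn_integral_cmult[OF measurable_mark_section[OF RHK_field \<omega> t]])
        finally show "(\<integral>\<^sup>+x. ennreal (R \<omega> t x * h \<omega> t x) \<partial>\<phi> \<omega> t) = ennreal c * (\<integral>\<^sup>+x. ennreal (R \<omega> t x) * HK k \<omega> t x \<partial>\<phi> \<omega> t)" .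
      qed
      also have "\<dots> = ennreal c * (\<integral>\<^sup>+t. \<integral>\<^sup>+x. ennreal (R \<omega> t x) * HK k \<omega> t x \<partial>\<phi> \<omega> t \<partial>dA \<omega>)"
        by (rule nn_integral_cmult[OF RHK_t])
      finally show "ennreal (jump_density R \<omega> * (\<integral>s. mark_mean (\<lambda>\<omega> t x. R \<omega> t x * h \<omega> t x) \<omega> s \<partial>dA \<omega>))
          = ?L \<omega> * (ennreal c * (\<integral>\<^sup>+t. \<integral>\<^sup>+x. ennreal (R \<omega> t x) * HK k \<omega> t x \<partial>\<phi> \<omega> t \<partial>dA \<omega>))"
        using L_pos[OF \<omega>] mean_integral_bounds(1)[OF Rh \<omega>] by (simp add: ennreal_mult)
    qed
    finally have "ennreal c * (\<integral>\<^sup>+\<omega>. ?L \<omega> * (\<Sum>n\<in>jumps \<omega>. HK k \<omega> (\<tau> n \<omega>) (X n \<omega>)) \<partial>M)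
        = ennreal c * (\<integral>\<^sup>+\<omega>. ?L \<omega> * (\<integral>\<^sup>+t. \<integral>\<^sup>+x. ennreal (R \<omega> t x) * HK k \<omega> t x \<partial>\<phi> \<omega> t \<partial>dA \<omega>) \<partial>M)"
      using measurable_jump_sum_ennreal[OF HK_field[of k]] measurable_compensator_integral[OF RHK_field[of k]]
      by (simp add: mult.left_commute[of _ "ennreal c"] nn_integral_cmult)
    then show ?thesis
      using c by (simp add: ennreal_mult_cancel_left)
  qed
  have "(\<integral>\<^sup>+\<omega>. ?L \<omega> * (\<Sum>n\<in>jumps \<omega>. H \<omega> (\<tau> n \<omega>) (X n \<omega>)) \<partial>M)
      = (\<integral>\<^sup>+\<omega>. (SUP k. ?L \<omega> * (\<Sum>n\<in>jumps \<omega>. HK k \<omega> (\<tau> n \<omega>) (X n \<omega>))) \<partial>M)"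
    by (intro nn_integral_cong) (simp add: SUP_mult_left_ennreal[symmetric] ennreal_SUP_sum HK_inc HK_sup)
  also have "\<dots> = (SUP k. \<integral>\<^sup>+\<omega>. ?L \<omega> * (\<Sum>n\<in>jumps \<omega>. HK k \<omega> (\<tau> n \<omega>) (X n \<omega>)) \<partial>M)"
  proof (rule nn_integral_monotone_convergence_SUP)
    show "incseq (\<lambda>k \<omega>. ?L \<omega> * (\<Sum>n\<in>jumps \<omega>. HK k \<omega> (\<tau> n \<omega>) (X n \<omega>)))"
      using HK_inc by (auto simp: incseq_def le_fun_def intro!: mult_left_mono sum_mono)
    show "(\<lambda>\<omega>. ?L \<omega> * (\<Sum>n\<in>jumps \<omega>. HK k \<omega> (\<tau> n \<omega>) (X n \<omega>))) \<in> borel_measurable M" for k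
      using measurable_jump_sum_ennreal[OF HK_field[of k]] by measurable
  qed
  also have "\<dots> = (SUP k. \<integral>\<^sup>+\<omega>. ?L \<omega> * (\<integral>\<^sup>+t. \<integral>\<^sup>+x. ennreal (R \<omega> t x) * HK k \<omega> t x \<partial>\<phi> \<omega> t \<partial>dA \<omega>) \<partial>M)"
    by (simp only: step)
  also have "\<dots> = (\<integral>\<^sup>+\<omega>. (SUP k. ?L \<omega> * (\<integral>\<^sup>+t. \<integral>\<^sup>+x. ennreal (R \<omega> t x) * HK k \<omega> t x \<partial>\<phi> \<omega> t \<partial>dA \<omega>)) \<partial>M)"
  proof (rule nn_integral_monotone_convergence_SUP[symmetric])
    show "incseq (\<lambda>k \<omega>. ?L \<omega> * (\<integral>\<^sup>+t. \<integral>\<^sup>+x. ennreal (R \<omega> t x) * HK k \<omega> t x \<partial>\<phi> \<omega> t \<partial>dA \<omega>))"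
      using HK_inc by (auto simp: incseq_def le_fun_def intro!: mult_left_mono nn_integral_mono)
    show "(\<lambda>\<omega>. ?L \<omega> * (\<integral>\<^sup>+t. \<integral>\<^sup>+x. ennreal (R \<omega> t x) * HK k \<omega> t x \<partial>\<phi> \<omega> t \<partial>dA \<omega>)) \<in> borel_measurable M" for k
      using measurable_compensator_integral[OF RHK_field[of k]] by measurable
  qed
  also have "\<dots> = (\<integral>\<^sup>+\<omega>. ?L \<omega> * (\<integral>\<^sup>+t. \<integral>\<^sup>+x. ennreal (R \<omega> t x) * H \<omega> t x \<partial>\<phi> \<omega> t \<partial>dA \<omega>) \<partial>M)"
  proof (rule nn_integral_cong)
    fix \<omega> assume \<omega>: "\<omega> \<in> space M"
    have inner: "(\<integral>\<^sup>+x. ennreal (R \<omega> t x) * H \<omega> t x \<partial>\<phi> \<omega> t) = (SUP k. \<integral>\<^sup>+x. ennreal (R \<omega> t x) * HK k \<omega> t x \<partial>\<phi> \<omega> t)"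
      if t: "t \<in> {0..T}" for t
    proof -
      have "(\<integral>\<^sup>+x. ennreal (R \<omega> t x) * H \<omega> t x \<partial>\<phi> \<omega> t) = (\<integral>\<^sup>+x. (SUP k. ennreal (R \<omega> t x) * HK k \<omega> t x) \<partial>\<phi> \<omega> t)"
        by (simp add: SUP_mult_left_ennreal[symmetric] HK_sup)
      also have "\<dots> = (SUP k. \<integral>\<^sup>+x. ennreal (R \<omega> t x) * HK k \<omega> t x \<partial>\<phi> \<omega> t)"
        using HK_inc measurable_mark_section[OF RHK_field \<omega> t]
        by (intro nn_integral_monotone_convergence_SUP) (auto simp: incseq_def le_fun_def intro!: mult_left_mono)
      finally show ?thesis .
    qed
    have "(\<integral>\<^sup>+t. \<integral>\<^sup>+x. ennreal (R \<omega> t x) * H \<omega> t x \<partial>\<phi> \<omega> t \<partial>dA \<omega>)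
        = (\<integral>\<^sup>+t. (SUP k. \<integral>\<^sup>+x. ennreal (R \<omega> t x) * HK k \<omega> t x \<partial>\<phi> \<omega> t) \<partial>dA \<omega>)"
      by (intro nn_integral_cong inner) (simp add: space_dA[OF \<omega>])
    also have "\<dots> = (SUP k. \<integral>\<^sup>+t. \<integral>\<^sup>+x. ennreal (R \<omega> t x) * HK k \<omega> t x \<partial>\<phi> \<omega> t \<partial>dA \<omega>)"
      using HK_inc measurable_time_path[OF predictable_mark_nn_integral[OF RHK_field] \<omega>]
      by (intro nn_integral_monotone_convergence_SUP) (auto simp: incseq_def le_fun_def intro!: mult_left_mono nn_integral_mono)
    finally show "(SUP k. ?L \<omega> * (\<integral>\<^sup>+t. \<integral>\<^sup>+x. ennreal (R \<omega> t x) * HK k \<omega> t x \<partial>\<phi> \<omega> t \<partial>dA \<omega>))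
        = ?L \<omega> * (\<integral>\<^sup>+t. \<integral>\<^sup>+x. ennreal (R \<omega> t x) * H \<omega> t x \<partial>\<phi> \<omega> t \<partial>dA \<omega>)"
      by (simp add: SUP_mult_left_ennreal[symmetric])
  qed
  finally show ?thesis .
qed

text \<open>For signed integrands the formula is applied to the positive and the negative part. The parameter
  \<open>s = 1, -1\<close> selects the part.\<close>

lemma compensation_under_density_signed:
  fixes Z :: "'a \<Rightarrow> real \<Rightarrow> 'k \<Rightarrow> real"
  assumes R: "intensity C R" and C: "1 \<le> C" and \<kappa>: "1 < \<kappa>" and \<eta>: "0 < \<eta>"
    and D: "integrable M (\<lambda>\<omega>. exp (\<kappa> * A \<omega> T) * (C * (1 + \<eta>)) ^ card (jumps \<omega>))"
    and Z: "predictable_field Z"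
    and Z_path: "AE \<omega> in M. (\<integral>\<^sup>+t. \<integral>\<^sup>+x. ennreal \<bar>Z \<omega> t x\<bar> \<partial>\<phi> \<omega> t \<partial>dA \<omega>) < \<infinity>"
    and fin: "(\<integral>\<^sup>+\<omega>. ennreal (jump_density R \<omega>) * (\<integral>\<^sup>+t. \<integral>\<^sup>+x. ennreal \<bar>Z \<omega> t x\<bar> \<partial>\<phi> \<omega> t \<partial>dA \<omega>) \<partial>M) < \<infinity>"
  shows "AE \<omega> in M. integrable (dA \<omega>) (\<lambda>t. \<integral>x. Z \<omega> t x * R \<omega> t x \<partial>\<phi> \<omega> t)"
    and "integrable M (\<lambda>\<omega>. jump_density R \<omega> * (\<Sum>n\<in>jumps \<omega>. Z \<omega> (\<tau> n \<omega>) (X n \<omega>)))"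
    and "integrable M (\<lambda>\<omega>. jump_density R \<omega> * (\<integral>t. \<integral>x. Z \<omega> t x * R \<omega> t x \<partial>\<phi> \<omega> t \<partial>dA \<omega>))"
    and "(\<integral>\<omega>. jump_density R \<omega> * (\<Sum>n\<in>jumps \<omega>. Z \<omega> (\<tau> n \<omega>) (X n \<omega>)) \<partial>M)
       = (\<integral>\<omega>. jump_density R \<omega> * (\<integral>t. \<integral>x. Z \<omega> t x * R \<omega> t x \<partial>\<phi> \<omega> t \<partial>dA \<omega>) \<partial>M)"
proof -
  let ?L = "jump_density R"
  note [measurable] = measurable_jump_density[OF R]
  have L_pos: "0 \<le> ?L \<omega>" if "\<omega> \<in> space M" for \<omega>
    by (rule jump_density_bounds(1)[OF R C that])
  define W where "W s \<omega> t x = ennreal (s * Z \<omega> t x)" for s :: real and \<omega> t x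
  define V where "V s \<omega> = (\<integral>\<^sup>+t. \<integral>\<^sup>+x. ennreal (R \<omega> t x) * W s \<omega> t x \<partial>\<phi> \<omega> t \<partial>dA \<omega>)" for s \<omega>
  define U where "U s \<omega> = (\<Sum>n\<in>jumps \<omega>. W s \<omega> (\<tau> n \<omega>) (X n \<omega>))" for s \<omega>
  have W: "predictable_field (W s)" for s
  proof -
    have "(\<lambda>z. ennreal (s * Z (fst (fst z)) (snd (fst z)) (snd z))) \<in> borel_measurable (\<P> \<Otimes>\<^sub>M borel)"
      using Z by (intro measurable_compose[OF _ measurable_ennreal] borel_measurable_times borel_measurable_const) (simp add: split_beta')
    then show ?thesis by (simp add: W_def split_beta')
  qed
  have [measurable]: "V s \<in> borel_measurable M" for s
    unfolding V_def by (rule measurable_compensator_integral[OF measurable_field_times[OF measurable_field_ennreal[OF intensityD(1)[OF R]] W]])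
  have [measurable]: "U s \<in> borel_measurable M" for s
    unfolding U_def by (rule measurable_jump_sum_ennreal[OF W])
  have UV: "(\<integral>\<^sup>+\<omega>. ennreal (?L \<omega>) * U s \<omega> \<partial>M) = (\<integral>\<^sup>+\<omega>. ennreal (?L \<omega>) * V s \<omega> \<partial>M)" for s
    unfolding U_def V_def by (rule compensation_under_density[OF R C \<kappa> \<eta> D W])
  have absZ: "predictable_field (\<lambda>\<omega> t x. ennreal \<bar>Z \<omega> t x\<bar>)"
    by (rule measurable_field_abs[OF Z])
  have V_le: "V s \<omega> \<le> ennreal C * (\<integral>\<^sup>+t. \<integral>\<^sup>+x. ennreal \<bar>Z \<omega> t x\<bar> \<partial>\<phi> \<omega> t \<partial>dA \<omega>)" if \<omega>: "\<omega> \<in> space M" and s: "\<bar>s\<bar> = 1" for s \<omega>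
  proof -
    have "V s \<omega> \<le> (\<integral>\<^sup>+t. ennreal C * (\<integral>\<^sup>+x. ennreal \<bar>Z \<omega> t x\<bar> \<partial>\<phi> \<omega> t) \<partial>dA \<omega>)"
      unfolding V_def
    proof (rule nn_integral_mono)
      fix t assume "t \<in> space (dA \<omega>)"
      then have t: "t \<in> {0..T}" by (simp add: space_dA[OF \<omega>])
      have "(\<integral>\<^sup>+x. ennreal (R \<omega> t x) * W s \<omega> t x \<partial>\<phi> \<omega> t) \<le> (\<integral>\<^sup>+x. ennreal C * ennreal \<bar>Z \<omega> t x\<bar> \<partial>\<phi> \<omega> t)"
      proof (intro nn_integral_mono mult_mono ennreal_leI)
        show "R \<omega> t x \<le> C" for x by (rule intensityD(3)[OF R \<omega> t])
        have "s * Z \<omega> t x \<le> \<bar>Z \<omega> t x\<bar>" for x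
          using abs_ge_self[of "s * Z \<omega> t x"] s by (simp add: abs_mult)
        then show "W s \<omega> t x \<le> ennreal \<bar>Z \<omega> t x\<bar>" for x
          unfolding W_def by (rule ennreal_leI)
      qed auto
      also have "\<dots> = ennreal C * (\<integral>\<^sup>+x. ennreal \<bar>Z \<omega> t x\<bar> \<partial>\<phi> \<omega> t)"
        by (rule nn_integral_cmult[OF measurable_mark_section[OF absZ \<omega> t]])
      finally show "(\<integral>\<^sup>+x. ennreal (R \<omega> t x) * W s \<omega> t x \<partial>\<phi> \<omega> t) \<le> ennreal C * (\<integral>\<^sup>+x. ennreal \<bar>Z \<omega> t x\<bar> \<partial>\<phi> \<omega> t)" .
    qed
    also have "\<dots> = ennreal C * (\<integral>\<^sup>+t. \<integral>\<^sup>+x. ennreal \<bar>Z \<omega> t x\<bar> \<partial>\<phi> \<omega> t \<partial>dA \<omega>)"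
      by (rule nn_integral_cmult[OF measurable_time_path[OF predictable_mark_nn_integral[OF absZ] \<omega>]])
    finally show ?thesis .
  qed
  have LV_fin: "(\<integral>\<^sup>+\<omega>. ennreal (?L \<omega>) * V s \<omega> \<partial>M) < \<infinity>" if s: "\<bar>s\<bar> = 1" for s
  proof -
    have "(\<integral>\<^sup>+\<omega>. ennreal (?L \<omega>) * V s \<omega> \<partial>M) \<le> (\<integral>\<^sup>+\<omega>. ennreal C * (ennreal (?L \<omega>) * (\<integral>\<^sup>+t. \<integral>\<^sup>+x. ennreal \<bar>Z \<omega> t x\<bar> \<partial>\<phi> \<omega> t \<partial>dA \<omega>)) \<partial>M)"
      using V_le[OF _ s] by (intro nn_integral_mono) (simp add: mult.left_commute[of "ennreal C"] mult_left_mono)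
    also have "\<dots> = ennreal C * (\<integral>\<^sup>+\<omega>. ennreal (?L \<omega>) * (\<integral>\<^sup>+t. \<integral>\<^sup>+x. ennreal \<bar>Z \<omega> t x\<bar> \<partial>\<phi> \<omega> t \<partial>dA \<omega>) \<partial>M)"
      using measurable_compensator_integral[OF absZ] by (intro nn_integral_cmult) measurable
    also have "\<dots> < \<infinity>"
      using fin by (simp add: ennreal_mult_less_top)
    finally show ?thesis .
  qed
  have V_path: "AE \<omega> in M. V 1 \<omega> < \<infinity> \<and> V (-1) \<omega> < \<infinity>"
    using Z_path AE_space
  proof eventually_elim
    case (elim \<omega>)
    then have "ennreal C * (\<integral>\<^sup>+t. \<integral>\<^sup>+x. ennreal \<bar>Z \<omega> t x\<bar> \<partial>\<phi> \<omega> t \<partial>dA \<omega>) < \<infinity>"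
      by (simp add: ennreal_mult_less_top)
    then show ?case
      using V_le[OF elim(2), of 1] V_le[OF elim(2), of "-1"] by (auto intro: le_less_trans)
  qed
  have path: "integrable (dA \<omega>) (\<lambda>t. \<integral>x. Z \<omega> t x * R \<omega> t x \<partial>\<phi> \<omega> t)
      \<and> (\<integral>t. \<integral>x. Z \<omega> t x * R \<omega> t x \<partial>\<phi> \<omega> t \<partial>dA \<omega>) = enn2real (V 1 \<omega>) - enn2real (V (-1) \<omega>)"
    if \<omega>: "\<omega> \<in> space M" and V: "V 1 \<omega> < \<infinity>" "V (-1) \<omega> < \<infinity>" for \<omega>
  proof -
    let ?f = "\<lambda>(t, x). Z \<omega> t x * R \<omega> t x"
    let ?\<nu> = "kernel_product (dA \<omega>) borel (\<phi> \<omega>)"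
    have f_meas: "?f \<in> borel_measurable (dA \<omega> \<Otimes>\<^sub>M borel)"
      using borel_measurable_times[OF measurable_field_section[OF Z \<omega>] measurable_field_section[OF intensityD(1)[OF R] \<omega>]]
      by (simp add: split_beta')
    have nn: "(\<integral>\<^sup>+z. ennreal (s * ?f z) \<partial>?\<nu>) = V s \<omega>" for s
    proof -
      have "(\<lambda>z. ennreal (s * ?f z)) \<in> borel_measurable (dA \<omega> \<Otimes>\<^sub>M borel)"
        by (intro measurable_compose[OF _ measurable_ennreal] borel_measurable_times borel_measurable_const f_meas)
      from nn_integral_kernel_product[OF \<phi>_section[OF \<omega>] this]
      have "(\<integral>\<^sup>+z. ennreal (s * ?f z) \<partial>?\<nu>) = (\<integral>\<^sup>+t. \<integral>\<^sup>+x. ennreal (s * (Z \<omega> t x * R \<omega> t x)) \<partial>\<phi> \<omega> t \<partial>dA \<omega>)"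
        by simp
      also have "\<dots> = V s \<omega>"
        unfolding V_def W_def
      proof (intro nn_integral_cong)
        fix t x assume "t \<in> space (dA \<omega>)"
        then have "0 \<le> R \<omega> t x" using intensityD(2)[OF R \<omega>, of t x] by (simp add: space_dA[OF \<omega>])
        then show "ennreal (s * (Z \<omega> t x * R \<omega> t x)) = ennreal (R \<omega> t x) * ennreal (s * Z \<omega> t x)"
          by (simp add: ennreal_mult'[symmetric] mult_ac)
      qed
      finally show ?thesis .
    qed
    have i: "integrable ?\<nu> ?f"
      unfolding real_integrable_def
      using f_meas nn[of 1] nn[of "-1"] V by (auto cong: measurable_cong_sets simp: split_beta')
    show ?thesis
      using integral_kernel_product[OF \<phi>_section[OF \<omega>] i] real_lebesgue_integral_def[OF i] nn[of 1] nn[of "-1"]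
      by simp
  qed
  show "AE \<omega> in M. integrable (dA \<omega>) (\<lambda>t. \<integral>x. Z \<omega> t x * R \<omega> t x \<partial>\<phi> \<omega> t)"
    using V_path AE_space by eventually_elim (use path in blast)
  have intV: "integrable M (\<lambda>\<omega>. ?L \<omega> * enn2real (V s \<omega>))" "(\<integral>\<omega>. ?L \<omega> * enn2real (V s \<omega>) \<partial>M) = enn2real (\<integral>\<^sup>+\<omega>. ennreal (?L \<omega>) * V s \<omega> \<partial>M)"
    if s: "s \<in> {1, -1}" for s
  proof -
    have "(\<integral>\<^sup>+\<omega>. ennreal (?L \<omega> * enn2real (V s \<omega>)) \<partial>M) = (\<integral>\<^sup>+\<omega>. ennreal (?L \<omega>) * V s \<omega> \<partial>M)"
    proof (rule nn_integral_cong_AE)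
      show "AE \<omega> in M. ennreal (?L \<omega> * enn2real (V s \<omega>)) = ennreal (?L \<omega>) * V s \<omega>"
        using V_path AE_space
      proof eventually_elim
        case (elim \<omega>)
        then have "V s \<omega> < top" using s by auto
        then show ?case using L_pos[of \<omega>] elim by (simp add: ennreal_mult)
      qed
    qed
    moreover have "(\<integral>\<^sup>+\<omega>. ennreal (norm (?L \<omega> * enn2real (V s \<omega>))) \<partial>M) = (\<integral>\<^sup>+\<omega>. ennreal (?L \<omega> * enn2real (V s \<omega>)) \<partial>M)"
      using L_pos by (intro nn_integral_cong) (simp add: abs_mult)
    ultimately show "integrable M (\<lambda>\<omega>. ?L \<omega> * enn2real (V s \<omega>))"
      using LV_fin[of s] s by (auto simp: integrable_iff_bounded)
    show "(\<integral>\<omega>. ?L \<omega> * enn2real (V s \<omega>) \<partial>M) = enn2real (\<integral>\<^sup>+\<omega>. ennreal (?L \<omega>) * V s \<omega> \<partial>M)"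
      unfolding \<open>(\<integral>\<^sup>+\<omega>. ennreal (?L \<omega> * enn2real (V s \<omega>)) \<partial>M) = _\<close>[symmetric]
      using L_pos by (intro integral_eq_nn_integral AE_I2) auto
  qed
  have U_fin: "U s \<omega> < top" if "\<omega> \<in> space M" for s \<omega>
    unfolding U_def W_def using finite_jumps[OF that] by simp
  have intU: "integrable M (\<lambda>\<omega>. ?L \<omega> * enn2real (U s \<omega>))" "(\<integral>\<omega>. ?L \<omega> * enn2real (U s \<omega>) \<partial>M) = enn2real (\<integral>\<^sup>+\<omega>. ennreal (?L \<omega>) * V s \<omega> \<partial>M)"
    if s: "s \<in> {1, -1}" for s
  proof -
    have eq: "(\<integral>\<^sup>+\<omega>. ennreal (?L \<omega> * enn2real (U s \<omega>)) \<partial>M) = (\<integral>\<^sup>+\<omega>. ennreal (?L \<omega>) * V s \<omega> \<partial>M)"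
      unfolding UV[symmetric] using L_pos U_fin by (intro nn_integral_cong) (simp add: ennreal_mult)
    have "(\<integral>\<^sup>+\<omega>. ennreal (norm (?L \<omega> * enn2real (U s \<omega>))) \<partial>M) = (\<integral>\<^sup>+\<omega>. ennreal (?L \<omega> * enn2real (U s \<omega>)) \<partial>M)"
      using L_pos by (intro nn_integral_cong) (simp add: abs_mult)
    with eq show "integrable M (\<lambda>\<omega>. ?L \<omega> * enn2real (U s \<omega>))"
      using LV_fin[of s] s by (auto simp: integrable_iff_bounded)
    show "(\<integral>\<omega>. ?L \<omega> * enn2real (U s \<omega>) \<partial>M) = enn2real (\<integral>\<^sup>+\<omega>. ennreal (?L \<omega>) * V s \<omega> \<partial>M)"
      unfolding eq[symmetric] using L_pos by (intro integral_eq_nn_integral AE_I2) auto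
  qed
  have sum_eq: "(\<Sum>n\<in>jumps \<omega>. Z \<omega> (\<tau> n \<omega>) (X n \<omega>)) = enn2real (U 1 \<omega>) - enn2real (U (-1) \<omega>)" if \<omega>: "\<omega> \<in> space M" for \<omega>
  proof -
    have "enn2real (U s \<omega>) = (\<Sum>n\<in>jumps \<omega>. max 0 (s * Z \<omega> (\<tau> n \<omega>) (X n \<omega>)))" for s
    proof -
      have "U s \<omega> = (\<Sum>n\<in>jumps \<omega>. ennreal (max 0 (s * Z \<omega> (\<tau> n \<omega>) (X n \<omega>))))"
        unfolding U_def W_def by (intro sum.cong refl) (simp add: max_def ennreal_neg)
      also have "\<dots> = ennreal (\<Sum>n\<in>jumps \<omega>. max 0 (s * Z \<omega> (\<tau> n \<omega>) (X n \<omega>)))"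
        by (intro sum_ennreal) simp
      finally show ?thesis by (simp add: sum_nonneg)
    qed
    then show ?thesis
      by (simp add: sum_subtractf[symmetric] max_def) (intro sum.cong; simp)
  qed
  have eq1: "?L \<omega> * (\<Sum>n\<in>jumps \<omega>. Z \<omega> (\<tau> n \<omega>) (X n \<omega>)) = ?L \<omega> * enn2real (U 1 \<omega>) - ?L \<omega> * enn2real (U (-1) \<omega>)"
    if "\<omega> \<in> space M" for \<omega>
    by (simp only: sum_eq[OF that] right_diff_distrib)
  have eq2: "AE \<omega> in M. ?L \<omega> * enn2real (V 1 \<omega>) - ?L \<omega> * enn2real (V (-1) \<omega>) = ?L \<omega> * (\<integral>t. \<integral>x. Z \<omega> t x * R \<omega> t x \<partial>\<phi> \<omega> t \<partial>dA \<omega>)"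
    using V_path AE_space
  proof eventually_elim
    case (elim \<omega>)
    then show ?case using path[of \<omega>] by (simp add: right_diff_distrib)
  qed
  have meas: "(\<lambda>\<omega>. \<integral>t. \<integral>x. Z \<omega> t x * R \<omega> t x \<partial>\<phi> \<omega> t \<partial>dA \<omega>) \<in> borel_measurable M"
  proof (rule measurable_integral_dA, rule measurable_P_imp, rule predictable_mark_integral)
    show "predictable_field (\<lambda>\<omega> t x. Z \<omega> t x * R \<omega> t x)"
      using borel_measurable_times[OF Z intensityD(1)[OF R]] by (simp add: split_beta')
  qed
  show "integrable M (\<lambda>\<omega>. ?L \<omega> * (\<Sum>n\<in>jumps \<omega>. Z \<omega> (\<tau> n \<omega>) (X n \<omega>)))"
    by (rule Bochner_Integration.integrable_cong[THEN iffD2, OF refl eq1]) (auto intro!: intU)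
  show "integrable M (\<lambda>\<omega>. ?L \<omega> * (\<integral>t. \<integral>x. Z \<omega> t x * R \<omega> t x \<partial>\<phi> \<omega> t \<partial>dA \<omega>))"
    using intV[of 1] intV[of "-1"] meas by (subst integrable_cong_AE[OF _ _ eq2, symmetric]) auto
  have "(\<integral>\<omega>. ?L \<omega> * (\<Sum>n\<in>jumps \<omega>. Z \<omega> (\<tau> n \<omega>) (X n \<omega>)) \<partial>M) = (\<integral>\<omega>. ?L \<omega> * enn2real (U 1 \<omega>) - ?L \<omega> * enn2real (U (-1) \<omega>) \<partial>M)"
    by (intro Bochner_Integration.integral_cong refl eq1)
  also have "\<dots> = (\<integral>\<omega>. ?L \<omega> * enn2real (V 1 \<omega>) - ?L \<omega> * enn2real (V (-1) \<omega>) \<partial>M)"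
    using intU[of 1] intU[of "-1"] intV[of 1] intV[of "-1"] by simp
  also have "\<dots> = (\<integral>\<omega>. ?L \<omega> * (\<integral>t. \<integral>x. Z \<omega> t x * R \<omega> t x \<partial>\<phi> \<omega> t \<partial>dA \<omega>) \<partial>M)"
    using eq2 meas by (intro integral_cong_AE) auto
  finally show "(\<integral>\<omega>. ?L \<omega> * (\<Sum>n\<in>jumps \<omega>. Z \<omega> (\<tau> n \<omega>) (X n \<omega>)) \<partial>M)
       = (\<integral>\<omega>. ?L \<omega> * (\<integral>t. \<integral>x. Z \<omega> t x * R \<omega> t x \<partial>\<phi> \<omega> t \<partial>dA \<omega>) \<partial>M)" .
qed

text \<open>The primitive of \<open>exp (- b A) dA\<close> is \<open>(1 - exp (- b A)) / b\<close>, whatever the size of \<open>A\<close>.\<close>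

lemma nn_integral_exp_neg_A:
  assumes \<omega>: "\<omega> \<in> space M" and b: "0 < b"
  shows "(\<integral>\<^sup>+t. ennreal (exp (- b * A \<omega> t)) \<partial>dA \<omega>) \<le> ennreal (1 / b)"
proof -
  interpret atomless_time_measure "dA \<omega>" T by (rule atomless_dA[OF \<omega>])
  have prim: "primitive (dA \<omega>) (\<lambda>_. - b) t = - b * A \<omega> t" if "t \<in> {0..T}" for t
    using integral_indicator_dA[OF \<omega> that] by (simp add: primitive_def)
  have "primitive (dA \<omega>) (\<lambda>s. exp (primitive (dA \<omega>) (\<lambda>_. - b) s) * (- b)) T = exp (primitive (dA \<omega>) (\<lambda>_. - b) T) - 1"
    by (rule prim_exp[where K=b]) (use b in auto)
  also have "primitive (dA \<omega>) (\<lambda>s. exp (primitive (dA \<omega>) (\<lambda>_. - b) s) * (- b)) T = (\<integral>s. - b * exp (- b * A \<omega> s) \<partial>dA \<omega>)"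
    unfolding primitive_terminal[OF \<omega>]
    by (intro Bochner_Integration.integral_cong) (auto simp: space_dA[OF \<omega>] prim)
  also have "\<dots> = - b * (\<integral>s. exp (- b * A \<omega> s) \<partial>dA \<omega>)"
    by (rule integral_mult_right_zero)
  finally have "b * (\<integral>s. exp (- b * A \<omega> s) \<partial>dA \<omega>) = 1 - exp (primitive (dA \<omega>) (\<lambda>_. - b) T)"
    by simp
  then have "b * (\<integral>s. exp (- b * A \<omega> s) \<partial>dA \<omega>) \<le> 1"
    by simp
  then have le: "(\<integral>s. exp (- b * A \<omega> s) \<partial>dA \<omega>) \<le> 1 / b"
    using b by (simp add: field_simps)
  have "integrable (dA \<omega>) (\<lambda>s. exp (- b * A \<omega> s))"
  proof (rule integrable_dA_bounded[OF \<omega>, where K=1])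
    show "(\<lambda>s. exp (- b * A \<omega> s)) \<in> borel_measurable (dA \<omega>)"
      using A_path_measurable[OF \<omega>] by measurable
  qed (use A_nonneg[OF \<omega>] b in auto)
  then have "(\<integral>\<^sup>+t. ennreal (exp (- b * A \<omega> t)) \<partial>dA \<omega>) = ennreal (\<integral>s. exp (- b * A \<omega> s) \<partial>dA \<omega>)"
    by (intro nn_integral_eq_integral) auto
  also have "\<dots> \<le> ennreal (1 / b)"
    using le by (rule ennreal_leI)
  finally show ?thesis .
qed

text \<open>Young's inequality with weights, \<open>L |Z| \<le> L^q exp (- b A\<^sub>t) + |Z|^p exp (\<beta> A\<^sub>t)\<close> for \<open>b = q \<beta> / p\<close>.
  The weight is needed because no power of \<open>A\<close> is to spare next to \<open>L^q\<close>, while \<open>exp (- b A)\<close> has a bounded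
  integral against \<open>dA\<close>.\<close>

lemma integrable_density_field:
  fixes p q \<beta> C :: real
  assumes R: "intensity C R" and C: "1 < C" and p: "1 < p" and q: "1 < q" "1 / q + 1 / p = 1" and \<beta>: "0 < \<beta>"
    and D: "integrable M (\<lambda>\<omega>. exp (q * A \<omega> T) * (C powr q) ^ card (jumps \<omega>))"
    and Z: "predictable_field Z"
    and Z_fin: "(\<integral>\<^sup>+\<omega>. \<integral>\<^sup>+t. \<integral>\<^sup>+x. ennreal (\<bar>Z \<omega> t x\<bar> powr p * exp (\<beta> * A \<omega> t)) \<partial>\<phi> \<omega> t \<partial>dA \<omega> \<partial>M) < \<infinity>"
  shows "(\<integral>\<^sup>+\<omega>. ennreal (jump_density R \<omega>) * (\<integral>\<^sup>+t. \<integral>\<^sup>+x. ennreal \<bar>Z \<omega> t x\<bar> \<partial>\<phi> \<omega> t \<partial>dA \<omega>) \<partial>M) < \<infinity>"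
proof -
  let ?L = "jump_density R"
  define b where "b = q * \<beta> / p"
  have b: "0 < b" using q p \<beta> by (simp add: b_def)
  define D' where "D' \<omega> = exp (q * A \<omega> T) * (C powr q) ^ card (jumps \<omega>)" for \<omega>
  have D'_pos: "0 \<le> D' \<omega>" for \<omega> by (simp add: D'_def)
  define V where "V \<omega> = (\<integral>\<^sup>+t. \<integral>\<^sup>+x. ennreal (\<bar>Z \<omega> t x\<bar> powr p * exp (\<beta> * A \<omega> t)) \<partial>\<phi> \<omega> t \<partial>dA \<omega>)" for \<omega>
  have Zs: "(\<lambda>z. Z (fst (fst z)) (snd (fst z)) (snd z)) \<in> borel_measurable (\<P> \<Otimes>\<^sub>M borel)"
    using Z by (simp add: split_beta')
  have As: "(\<lambda>z. A (fst (fst z)) (snd (fst z))) \<in> borel_measurable (\<P> \<Otimes>\<^sub>M (borel :: 'k measure))"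
    using measurable_compose[OF measurable_fst A_predictable] by (simp add: split_beta')
  have absZ: "predictable_field (\<lambda>\<omega> t x. ennreal \<bar>Z \<omega> t x\<bar>)"
    by (rule measurable_field_abs[OF Z])
  have G: "predictable_field (\<lambda>\<omega> t x. ennreal (\<bar>Z \<omega> t x\<bar> powr p * exp (\<beta> * A \<omega> t)))"
    unfolding split_beta' using Zs As by measurable
  have [measurable]: "V \<in> borel_measurable M"
    unfolding V_def by (rule measurable_compensator_integral[OF G])
  have [measurable]: "D' \<in> borel_measurable M"
    using borel_measurable_integrable[OF D] by (simp add: D'_def[abs_def])
  have key: "ennreal (?L \<omega>) * (\<integral>\<^sup>+t. \<integral>\<^sup>+x. ennreal \<bar>Z \<omega> t x\<bar> \<partial>\<phi> \<omega> t \<partial>dA \<omega>) \<le> ennreal (1 / b) * ennreal (D' \<omega>) + V \<omega>"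
    if \<omega>: "\<omega> \<in> space M" for \<omega>
  proof -
    define W where "W = exp (A \<omega> T) * C ^ card (jumps \<omega>)"
    have W: "0 < W" using C by (simp add: W_def)
    have L: "0 \<le> ?L \<omega>" "?L \<omega> \<le> W"
      using jump_density_bounds[OF R _ \<omega>] C by (auto simp: W_def)
    have W_powr: "W powr q = D' \<omega>"
    proof -
      have "(C ^ card (jumps \<omega>)) powr q = (C powr q) ^ card (jumps \<omega>)"
        using C by (simp add: powr_realpow[symmetric] powr_powr mult.commute)
      then show ?thesis
        using C by (simp add: W_def D'_def powr_mult exp_powr_real mult.commute)
    qed
    have young: "?L \<omega> * \<bar>z\<bar> \<le> D' \<omega> * exp (- b * a) + \<bar>z\<bar> powr p * exp (\<beta> * a)" for z a :: real
    proof -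
      have "?L \<omega> * \<bar>z\<bar> \<le> W * \<bar>z\<bar>" using L by (intro mult_right_mono) auto
      also have "\<dots> = (W * exp (- (\<beta> / p) * a)) * (\<bar>z\<bar> * exp (\<beta> / p * a))"
        by (simp add: mult_ac exp_add[symmetric])
      also have "\<dots> \<le> (W * exp (- (\<beta> / p) * a)) powr q + (\<bar>z\<bar> * exp (\<beta> / p * a)) powr p"
        using q p W by (intro Young_sum) auto
      also have "(W * exp (- (\<beta> / p) * a)) powr q = D' \<omega> * exp (- b * a)"
        using W by (simp add: powr_mult W_powr exp_powr_real b_def mult_ac)
      also have "(\<bar>z\<bar> * exp (\<beta> / p * a)) powr p = \<bar>z\<bar> powr p * exp (\<beta> * a)"
        using p by (simp add: powr_mult exp_powr_real mult_ac)
      finally show ?thesis .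
    qed
    have mZ: "(\<lambda>x. ennreal \<bar>Z \<omega> t x\<bar>) \<in> borel_measurable (\<phi> \<omega> t)"
      and mG: "(\<lambda>x. ennreal (\<bar>Z \<omega> t x\<bar> powr p * exp (\<beta> * A \<omega> t))) \<in> borel_measurable (\<phi> \<omega> t)" if "t \<in> {0..T}" for t
      using measurable_mark_section[OF absZ \<omega> that] measurable_mark_section[OF G \<omega> that] by auto
    have "ennreal (?L \<omega>) * (\<integral>\<^sup>+t. \<integral>\<^sup>+x. ennreal \<bar>Z \<omega> t x\<bar> \<partial>\<phi> \<omega> t \<partial>dA \<omega>)
        = (\<integral>\<^sup>+t. ennreal (?L \<omega>) * (\<integral>\<^sup>+x. ennreal \<bar>Z \<omega> t x\<bar> \<partial>\<phi> \<omega> t) \<partial>dA \<omega>)"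
      by (rule nn_integral_cmult[OF measurable_time_path[OF predictable_mark_nn_integral[OF absZ] \<omega>], symmetric])
    also have "\<dots> \<le> (\<integral>\<^sup>+t. ennreal (D' \<omega>) * ennreal (exp (- b * A \<omega> t)) + (\<integral>\<^sup>+x. ennreal (\<bar>Z \<omega> t x\<bar> powr p * exp (\<beta> * A \<omega> t)) \<partial>\<phi> \<omega> t) \<partial>dA \<omega>)"
    proof (rule nn_integral_mono)
      fix t assume "t \<in> space (dA \<omega>)"
      then have t: "t \<in> {0..T}" by (simp add: space_dA[OF \<omega>])
      interpret \<phi>: prob_space "\<phi> \<omega> t" by (rule prob_\<phi>[OF \<omega> t])
      have "ennreal (?L \<omega>) * (\<integral>\<^sup>+x. ennreal \<bar>Z \<omega> t x\<bar> \<partial>\<phi> \<omega> t) = (\<integral>\<^sup>+x. ennreal (?L \<omega>) * ennreal \<bar>Z \<omega> t x\<bar> \<partial>\<phi> \<omega> t)"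
        by (rule nn_integral_cmult[OF mZ[OF t], symmetric])
      also have "\<dots> \<le> (\<integral>\<^sup>+x. ennreal (D' \<omega> * exp (- b * A \<omega> t)) + ennreal (\<bar>Z \<omega> t x\<bar> powr p * exp (\<beta> * A \<omega> t)) \<partial>\<phi> \<omega> t)"
      proof (rule nn_integral_mono)
        fix x
        have "ennreal (?L \<omega>) * ennreal \<bar>Z \<omega> t x\<bar> = ennreal (?L \<omega> * \<bar>Z \<omega> t x\<bar>)"
          using L by (simp add: ennreal_mult)
        also have "\<dots> \<le> ennreal (D' \<omega> * exp (- b * A \<omega> t) + \<bar>Z \<omega> t x\<bar> powr p * exp (\<beta> * A \<omega> t))"
          by (rule ennreal_leI[OF young])
        also have "\<dots> = ennreal (D' \<omega> * exp (- b * A \<omega> t)) + ennreal (\<bar>Z \<omega> t x\<bar> powr p * exp (\<beta> * A \<omega> t))"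
          using D'_pos by (intro ennreal_plus) auto
        finally show "ennreal (?L \<omega>) * ennreal \<bar>Z \<omega> t x\<bar> \<le> \<dots>" .
      qed
      also have "\<dots> = ennreal (D' \<omega> * exp (- b * A \<omega> t)) + (\<integral>\<^sup>+x. ennreal (\<bar>Z \<omega> t x\<bar> powr p * exp (\<beta> * A \<omega> t)) \<partial>\<phi> \<omega> t)"
        by (subst nn_integral_add[OF borel_measurable_const mG[OF t]]) (simp add: \<phi>.emeasure_space_1)
      also have "ennreal (D' \<omega> * exp (- b * A \<omega> t)) = ennreal (D' \<omega>) * ennreal (exp (- b * A \<omega> t))"
        using D'_pos by (intro ennreal_mult) auto
      finally show "ennreal (?L \<omega>) * (\<integral>\<^sup>+x. ennreal \<bar>Z \<omega> t x\<bar> \<partial>\<phi> \<omega> t)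
        \<le> ennreal (D' \<omega>) * ennreal (exp (- b * A \<omega> t)) + (\<integral>\<^sup>+x. ennreal (\<bar>Z \<omega> t x\<bar> powr p * exp (\<beta> * A \<omega> t)) \<partial>\<phi> \<omega> t)" .
    qed
    also have "\<dots> = ennreal (D' \<omega>) * (\<integral>\<^sup>+t. ennreal (exp (- b * A \<omega> t)) \<partial>dA \<omega>) + V \<omega>"
    proof -
      have m: "(\<lambda>t. ennreal (exp (- b * A \<omega> t))) \<in> borel_measurable (dA \<omega>)"
        using A_path_measurable[OF \<omega>] by measurable
      show ?thesis
        unfolding V_def nn_integral_cmult[OF m, symmetric]
        by (rule nn_integral_add[OF borel_measurable_times_ennreal[OF borel_measurable_const m]
              measurable_time_path[OF predictable_mark_nn_integral[OF G] \<omega>]])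
    qed
    also have "\<dots> \<le> ennreal (D' \<omega>) * ennreal (1 / b) + V \<omega>"
      by (intro add_right_mono mult_left_mono nn_integral_exp_neg_A[OF \<omega> b]) simp
    finally show ?thesis by (simp add: mult.commute)
  qed
  have "(\<integral>\<^sup>+\<omega>. ennreal (?L \<omega>) * (\<integral>\<^sup>+t. \<integral>\<^sup>+x. ennreal \<bar>Z \<omega> t x\<bar> \<partial>\<phi> \<omega> t \<partial>dA \<omega>) \<partial>M)
      \<le> (\<integral>\<^sup>+\<omega>. ennreal (1 / b) * ennreal (D' \<omega>) + V \<omega> \<partial>M)"
    by (rule nn_integral_mono[OF key])
  also have "\<dots> = ennreal (1 / b) * (\<integral>\<^sup>+\<omega>. ennreal (D' \<omega>) \<partial>M) + (\<integral>\<^sup>+\<omega>. V \<omega> \<partial>M)"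
    by (simp add: nn_integral_add nn_integral_cmult)
  also have "\<dots> < \<infinity>"
    using integrableD(2)[OF D] Z_fin by (simp add: D'_def V_def ennreal_mult_less_top less_top)
  finally show ?thesis .
qed

section \<open>The piecewise constant process\<close>

lemma pc_process_eq:
  assumes \<omega>: "\<omega> \<in> space M" and n: "S n \<omega> \<le> ennreal t" "ennreal t < S (Suc n) \<omega>"
  shows "pc_process S X \<omega> t = X n \<omega>"
proof -
  have "(THE n. S n \<omega> \<le> ennreal t \<and> ennreal t < S (Suc n) \<omega>) = n"
  proof (rule the_equality)
    fix m assume m: "S m \<omega> \<le> ennreal t \<and> ennreal t < S (Suc m) \<omega>"
    show "m = n"
    proof (rule ccontr)
      assume "m \<noteq> n"
      then consider "Suc m \<le> n" | "Suc n \<le> m" by linarith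
      then show False
      proof cases
        case 1
        have "S (Suc m) \<omega> \<le> ennreal t" using S_le[OF \<omega> 1] n(1) by (rule order_trans)
        with m show False by (metis leD)
      next
        case 2
        then have "S (Suc n) \<omega> \<le> ennreal t" using S_le[OF \<omega> 2] m by (metis order_trans)
        with n(2) show False by (metis leD)
      qed
    qed
  qed (use n in simp)
  then show ?thesis by (simp add: pc_process_def)
qed

text \<open>Agrees with the index in the definition of \<open>pc_process\<close> on \<open>[0, T]\<close>, and is measurable as a least
  number.\<close>

definition jump_index :: "'a \<Rightarrow> real \<Rightarrow> nat" where
  "jump_index \<omega> t = (LEAST n. ennreal t < S (Suc n) \<omega>)"

lemma jump_index:
  assumes \<omega>: "\<omega> \<in> space M" and t: "t \<in> {0..T}"
  shows "S (jump_index \<omega> t) \<omega> \<le> ennreal t" and "ennreal t < S (Suc (jump_index \<omega> t)) \<omega>"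
proof -
  obtain k where "ennreal T < S k \<omega>" using non_explosive[OF \<omega>] by blast
  then have "ennreal t < S k \<omega>"
    using t by (auto intro: le_less_trans[OF ennreal_leI])
  then have "ennreal t < S (Suc k) \<omega>"
    using S_mono[OF \<omega>, of k] by (rule less_le_trans)
  then show "ennreal t < S (Suc (jump_index \<omega> t)) \<omega>"
    unfolding jump_index_def by (rule LeastI)
  show "S (jump_index \<omega> t) \<omega> \<le> ennreal t"
  proof (cases "jump_index \<omega> t")
    case 0
    then show ?thesis using S_0[OF \<omega>] by simp
  next
    case (Suc n)
    then have "\<not> ennreal t < S (Suc n) \<omega>"
      using not_less_Least[of n "\<lambda>n. ennreal t < S (Suc n) \<omega>"] by (simp add: jump_index_def)
    then show ?thesis using Suc by simp
  qed
qed

lemma pc_process_index: "\<omega> \<in> space M \<Longrightarrow> t \<in> {0..T} \<Longrightarrow> pc_process S X \<omega> t = X (jump_index \<omega> t) \<omega>"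
  by (rule pc_process_eq[OF _ jump_index])

lemma measurable_pc_process: "(\<lambda>(\<omega>, t). pc_process S X \<omega> t) \<in> M \<Otimes>\<^sub>M time_space T \<rightarrow>\<^sub>M borel"
proof -
  let ?N = "M \<Otimes>\<^sub>M time_space T"
  have snd: "snd \<in> borel_measurable ?N"
    by (rule measurable_compose[OF measurable_snd]) (rule measurable_restrict_space1, simp)
  have "Measurable.pred ?N (\<lambda>z. ennreal (snd z) < S (Suc n) (fst z))" for n
    by (rule borel_measurable_pred_less)
       (rule measurable_compose[OF snd measurable_ennreal], rule measurable_compose[OF measurable_fst S_measurable])
  then have idx: "(\<lambda>z. jump_index (fst z) (snd z)) \<in> ?N \<rightarrow>\<^sub>M count_space UNIV"
    unfolding jump_index_def by (rule measurable_Least)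
  have "(\<lambda>z. X (jump_index (fst z) (snd z)) (fst z)) \<in> ?N \<rightarrow>\<^sub>M borel"
    by (rule measurable_compose_countable[OF measurable_compose[OF measurable_fst X_measurable] idx])
  then show ?thesis
    by (rule measurable_cong[THEN iffD1, rotated]) (auto simp: space_pair_measure pc_process_index)
qed

text \<open>The process and its left limits only differ at the finitely many jump times, and \<open>dA\<close> has no atoms. At
  the remaining times the process is constant on a left neighbourhood.\<close>

lemma AE_pc_left:
  assumes \<omega>: "\<omega> \<in> space M"
  shows "AE t in dA \<omega>. pc_left S X \<omega> t = pc_process S X \<omega> t"
  using AE_dA_not_in[OF \<omega> finite.insertI[OF finite_imageI[OF finite_jumps[OF \<omega>]]], of 0 "\<lambda>n. \<tau> n \<omega>"] AE_space
proof eventually_elim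
  fix t assume *: "t \<notin> insert 0 ((\<lambda>n. \<tau> n \<omega>) ` jumps \<omega>)" "t \<in> space (dA \<omega>)"
  then have t: "t \<in> {0..T}" "0 < t" by (auto simp: space_dA[OF \<omega>])
  define n where "n = jump_index \<omega> t"
  note n = jump_index[OF \<omega> t(1), folded n_def]
  define s where "s = enn2real (S n \<omega>)"
  have "S n \<omega> < top" using n(1) ennreal_less_top le_less_trans by blast
  then have s: "S n \<omega> = ennreal s" "0 \<le> s" by (auto simp: s_def)
  have "s \<le> t" using n(1) t s by (simp add: ennreal_le_iff)
  moreover have "s \<noteq> t"
  proof (cases "n = 0")
    case True
    then show ?thesis using S_0[OF \<omega>] s t by (auto simp: s_def)
  next
    case False
    then have "n \<in> jumps \<omega>"
      using n(1) t by (auto simp: jumps_def intro: order_trans[OF _ ennreal_leI])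
    then show ?thesis using * by (auto simp: s_def \<tau>_def)
  qed
  ultimately have "s < t" by simp
  then have "\<forall>\<^sub>F s' in at_left t. s' \<in> {s<..<t}"
    using eventually_at_left_real by blast
  then have "\<forall>\<^sub>F s' in at_left t. pc_process S X \<omega> s' = X n \<omega>"
  proof eventually_elim
    fix s' assume s': "s' \<in> {s<..<t}"
    show "pc_process S X \<omega> s' = X n \<omega>"
    proof (rule pc_process_eq[OF \<omega>])
      show "S n \<omega> \<le> ennreal s'" using s s' by (simp add: ennreal_leI)
      have "ennreal s' \<le> ennreal t" using s' by (intro ennreal_leI) simp
      then show "ennreal s' < S (Suc n) \<omega>" using n(2) by (rule le_less_trans)
    qed
  qed
  then have "(pc_process S X \<omega> \<longlongrightarrow> X n \<omega>) (at_left t)"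
    by (rule tendsto_eventually)
  then have "pc_left S X \<omega> t = X n \<omega>"
    unfolding pc_left_def by (intro tendsto_Lim) auto
  then show "pc_left S X \<omega> t = pc_process S X \<omega> t"
    using pc_process_index[OF \<omega> t(1)] by (simp add: n_def)
qed

section \<open>The control problem\<close>

text \<open>The exceptional set of a property holding \<open>dA\<^sub>t(\<omega>) P(d\<omega>)\<close>-almost everywhere lies in a measurable null set,
  almost all of whose sections are null.\<close>

lemma AE_kernel_product_dA:
  assumes "AE z in kernel_product M (time_space T) dA. P z"
  shows "AE \<omega> in M. AE t in dA \<omega>. P (\<omega>, t)"
proof -
  let ?K = "kernel_product M (time_space T) dA"
  from assms obtain N where N: "{z \<in> space ?K. \<not> P z} \<subseteq> N" "N \<in> sets ?K" "emeasure ?K N = 0"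
    by (rule AE_E)
  have meas: "(\<lambda>\<omega>. emeasure (dA \<omega>) (Pair \<omega> -` B)) \<in> borel_measurable M" if B: "B \<in> sets (M \<Otimes>\<^sub>M time_space T)" for B
  proof -
    have "(\<lambda>\<omega>. \<integral>\<^sup>+t. indicator B (\<omega>, t) \<partial>dA \<omega>) \<in> borel_measurable M"
      using B by (intro measurable_nn_integral_dA) (simp add: split_beta')
    moreover have "(\<integral>\<^sup>+t. indicator B (\<omega>, t) \<partial>dA \<omega>) = emeasure (dA \<omega>) (Pair \<omega> -` B)" if "\<omega> \<in> space M" for \<omega>
    proof -
      have "(\<integral>\<^sup>+t. indicator B (\<omega>, t) \<partial>dA \<omega>) = (\<integral>\<^sup>+t. indicator (Pair \<omega> -` B) t \<partial>dA \<omega>)"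
        by (intro nn_integral_cong) (simp split: split_indicator)
      also have "\<dots> = emeasure (dA \<omega>) (Pair \<omega> -` B)"
        using sets_Pair1[OF B, of \<omega>] by (intro nn_integral_indicator) (simp add: sets_dA[OF that])
      finally show ?thesis .
    qed
    ultimately show ?thesis by (simp cong: measurable_cong)
  qed
  have N': "N \<in> sets (M \<Otimes>\<^sub>M time_space T)" using N(2) by simp
  have "(\<integral>\<^sup>+\<omega>. emeasure (dA \<omega>) (Pair \<omega> -` N) \<partial>M) = 0"
    using emeasure_kernel_product[of M dA "time_space T", OF sets_dA meas N'] N(3) by simp
  then have "AE \<omega> in M. emeasure (dA \<omega>) (Pair \<omega> -` N) = 0"
    using nn_integral_0_iff_AE[OF meas[OF N']] by simp
  then show ?thesis
    using AE_space
  proof eventually_elim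
    case (elim \<omega>)
    have "Pair \<omega> -` N \<in> null_sets (dA \<omega>)"
      using elim sets_Pair1[OF N', of \<omega>] by (intro null_setsI) (simp_all add: sets_dA)
    from AE_not_in[OF this] AE_space show ?case
    proof eventually_elim
      case (elim t)
      have "(\<omega>, t) \<in> space ?K" using \<open>\<omega> \<in> space M\<close> elim by (simp add: space_dA)
      with elim N(1) show ?case by blast
    qed
  qed
qed

lemma control_value: "u \<in> controls (space M) F T U \<Longrightarrow> \<omega> \<in> space M \<Longrightarrow> t \<in> {0..T} \<Longrightarrow> u \<omega> t \<in> space U"
  using measurable_space[of "\<lambda>(\<omega>, t). u \<omega> t" \<P> U "(\<omega>, t)"] by (simp add: controls_def space_P)

lemma control_intensity:
  assumes C1: "hypothesis_C1 (space M) F T U r l g C\<^sub>r C\<^sub>l" and u: "u \<in> controls (space M) F T U"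
  shows "intensity C\<^sub>r (\<lambda>\<omega> t x. r \<omega> t x (u \<omega> t))"
  unfolding intensity_def
proof (intro conjI ballI allI)
  have "(\<lambda>z. (fst z, (snd z, (case fst z of (\<omega>, t) \<Rightarrow> u \<omega> t)))) \<in> \<P> \<Otimes>\<^sub>M borel \<rightarrow>\<^sub>M \<P> \<Otimes>\<^sub>M (borel \<Otimes>\<^sub>M U)"
    using u unfolding controls_def by (intro measurable_Pair measurable_fst measurable_snd measurable_compose[OF measurable_fst]) auto
  moreover have "(\<lambda>((\<omega>, t), (x, u)). r \<omega> t x u) \<in> borel_measurable (\<P> \<Otimes>\<^sub>M (borel \<Otimes>\<^sub>M U))"
    using C1 by (simp add: hypothesis_C1_def)
  ultimately have "(\<lambda>z. (\<lambda>((\<omega>, t), (x, u)). r \<omega> t x u) (fst z, (snd z, (case fst z of (\<omega>, t) \<Rightarrow> u \<omega> t)))) \<in> borel_measurable (\<P> \<Otimes>\<^sub>M borel)"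
    by (rule measurable_compose)
  then show "predictable_field (\<lambda>\<omega> t x. r \<omega> t x (u \<omega> t))"
    by (simp add: split_beta')
  fix \<omega> t x assume "\<omega> \<in> space M" "t \<in> {0..T}"
  with C1 control_value[OF u this] show "0 \<le> r \<omega> t x (u \<omega> t)" "r \<omega> t x (u \<omega> t) \<le> C\<^sub>r"
    unfolding hypothesis_C1_def by blast+
qed

lemma measurable_running_cost:
  assumes C1: "hypothesis_C1 (space M) F T U r l g C\<^sub>r C\<^sub>l" and u: "u \<in> controls (space M) F T U"
  shows "(\<lambda>(\<omega>, t). l \<omega> t (pc_process S X \<omega> t) (u \<omega> t)) \<in> borel_measurable (M \<Otimes>\<^sub>M time_space T)"
proof -
  have "(\<lambda>z. (z, (case z of (\<omega>, t) \<Rightarrow> pc_process S X \<omega> t, case z of (\<omega>, t) \<Rightarrow> u \<omega> t)))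
      \<in> M \<Otimes>\<^sub>M time_space T \<rightarrow>\<^sub>M \<P> \<Otimes>\<^sub>M (borel \<Otimes>\<^sub>M U)"
    using u unfolding controls_def
    by (intro measurable_Pair measurable_pair_P measurable_pc_process measurable_P_imp) auto
  moreover have "(\<lambda>((\<omega>, t), (x, u)). l \<omega> t x u) \<in> borel_measurable (\<P> \<Otimes>\<^sub>M (borel \<Otimes>\<^sub>M U))"
    using C1 by (simp add: hypothesis_C1_def)
  ultimately have "(\<lambda>z. (\<lambda>((\<omega>, t), (x, u)). l \<omega> t x u) (z, (case z of (\<omega>, t) \<Rightarrow> pc_process S X \<omega> t, case z of (\<omega>, t) \<Rightarrow> u \<omega> t)))
      \<in> borel_measurable (M \<Otimes>\<^sub>M time_space T)"
    by (rule measurable_compose)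
  then show ?thesis
    by (simp add: split_beta')
qed

lemma running_cost_path:
  assumes C1: "hypothesis_C1 (space M) F T U r l g C\<^sub>r C\<^sub>l" and u: "u \<in> controls (space M) F T U" and \<omega>: "\<omega> \<in> space M"
  shows "integrable (dA \<omega>) (\<lambda>t. l \<omega> t (pc_process S X \<omega> t) (u \<omega> t))"
    and "\<bar>\<integral>t. l \<omega> t (pc_process S X \<omega> t) (u \<omega> t) \<partial>dA \<omega>\<bar> \<le> C\<^sub>l * A \<omega> T"
proof -
  let ?f = "\<lambda>t. l \<omega> t (pc_process S X \<omega> t) (u \<omega> t)"
  have bnd: "\<bar>?f t\<bar> \<le> C\<^sub>l" if "t \<in> {0..T}" for t
    using C1 control_value[OF u \<omega> that] \<omega> that unfolding hypothesis_C1_def by blast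
  have m: "?f \<in> borel_measurable (dA \<omega>)"
    unfolding measurable_dA[OF \<omega>] using measurable_Pair2[OF measurable_running_cost[OF C1 u] \<omega>] by simp
  show i: "integrable (dA \<omega>) ?f"
    by (rule integrable_dA_bounded[OF \<omega> m bnd])
  have "\<bar>\<integral>t. ?f t \<partial>dA \<omega>\<bar> \<le> (\<integral>t. \<bar>?f t\<bar> \<partial>dA \<omega>)"
    by (rule integral_abs_bound)
  also have "\<dots> \<le> (\<integral>t. C\<^sub>l \<partial>dA \<omega>)"
    using bnd i by (intro integral_mono integrable_dA_const[OF \<omega>] integrable_abs) (auto simp: space_dA[OF \<omega>])
  finally show "\<bar>\<integral>t. ?f t \<partial>dA \<omega>\<bar> \<le> C\<^sub>l * A \<omega> T"
    by (simp add: measure_dA_space[OF \<omega>] mult.commute)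
qed

lemma set_integral_dA:
  fixes f :: "real \<Rightarrow> real"
  assumes \<omega>: "\<omega> \<in> space M" and f: "f \<in> borel_measurable (dA \<omega>)"
  shows "(LINT t:{0<..T}|dA \<omega>. f t) = (\<integral>t. f t \<partial>dA \<omega>)"
  unfolding set_lebesgue_integral_def
proof (rule integral_cong_AE)
  have "{0<..T} \<in> sets (dA \<omega>)"
    by (simp add: sets_dA[OF \<omega>] sets_restrict_space_iff subset_eq)
  then show "(\<lambda>t. indicator {0<..T} t *\<^sub>R f t) \<in> borel_measurable (dA \<omega>)"
    using f by simp
  show "AE t in dA \<omega>. indicator {0<..T} t *\<^sub>R f t = f t"
    using AE_dA_not_in[OF \<omega>, of "{0}"] AE_space by (auto elim!: eventually_elim2 simp: space_dA[OF \<omega>])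
qed (rule f)

text \<open>The controls act through the intensity \<open>r \<omega> t x (u \<omega> t)\<close>, and the density of the controlled measure
  is the stochastic exponential of this intensity.\<close>

lemma likelihood_terminal:
  assumes R: "intensity C (\<lambda>\<omega> t x. r \<omega> t x (u \<omega> t))" and \<omega>: "\<omega> \<in> space M"
  shows "likelihood T S X A \<phi> r u \<omega> T = jump_density (\<lambda>\<omega> t x. r \<omega> t x (u \<omega> t)) \<omega>"
proof -
  let ?R = "\<lambda>\<omega> t x. r \<omega> t x (u \<omega> t)"
  let ?B = "{0<..T} \<times> (UNIV :: 'k set)"
  let ?\<nu> = "kernel_product (dA \<omega>) borel (\<phi> \<omega>)"
  let ?f = "\<lambda>z. indicator ?B z *\<^sub>R (case z of (s, x) \<Rightarrow> 1 - ?R \<omega> s x)"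
  have t_set: "{0<..T} \<in> sets (dA \<omega>)"
    by (simp add: sets_dA[OF \<omega>] sets_restrict_space_iff subset_eq)
  have "(\<lambda>(s, x). ?R \<omega> s x) \<in> borel_measurable (dA \<omega> \<Otimes>\<^sub>M borel)"
    by (rule measurable_field_section[OF intensityD(1)[OF R] \<omega>])
  then have f: "?f \<in> borel_measurable (dA \<omega> \<Otimes>\<^sub>M borel)"
    using t_set by (intro borel_measurable_scaleR borel_measurable_indicator pair_measureI) (auto simp: split_beta')
  have bnd: "\<bar>?f (s, x)\<bar> \<le> 1 + C" if "s \<in> {0..T}" for s x
    using intensityD(2,3)[OF R \<omega> that, of x] by (auto split: split_indicator)
  have "(\<integral>\<^sup>+z. ennreal \<bar>?f z\<bar> \<partial>?\<nu>) = (\<integral>\<^sup>+s. \<integral>\<^sup>+x. ennreal \<bar>?f (s, x)\<bar> \<partial>\<phi> \<omega> s \<partial>dA \<omega>)"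
    using f by (intro nn_integral_kernel_product[OF \<phi>_section[OF \<omega>]]) (intro measurable_compose[OF _ measurable_ennreal] borel_measurable_abs)
  also have "\<dots> \<le> (\<integral>\<^sup>+s. ennreal (1 + C) \<partial>dA \<omega>)"
  proof (rule nn_integral_mono)
    fix s assume "s \<in> space (dA \<omega>)"
    then have s: "s \<in> {0..T}" by (simp add: space_dA[OF \<omega>])
    interpret \<phi>: prob_space "\<phi> \<omega> s" by (rule prob_\<phi>[OF \<omega> s])
    have "(\<integral>\<^sup>+x. ennreal \<bar>?f (s, x)\<bar> \<partial>\<phi> \<omega> s) \<le> (\<integral>\<^sup>+x. ennreal (1 + C) \<partial>\<phi> \<omega> s)"
      by (intro nn_integral_mono ennreal_leI bnd[OF s])
    then show "(\<integral>\<^sup>+x. ennreal \<bar>?f (s, x)\<bar> \<partial>\<phi> \<omega> s) \<le> ennreal (1 + C)"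
      by (simp add: \<phi>.emeasure_space_1)
  qed
  also have "\<dots> < \<infinity>"
    by (simp add: emeasure_dA_space[OF \<omega>] ennreal_mult_less_top)
  finally have i: "integrable ?\<nu> ?f"
    using f by (simp add: integrable_iff_bounded measurable_cong_sets[OF sets_kernel_product refl])
  have "(\<integral>z. ?f z \<partial>?\<nu>) = (\<integral>s. \<integral>x. ?f (s, x) \<partial>\<phi> \<omega> s \<partial>dA \<omega>)"
    by (rule integral_kernel_product(2)[OF \<phi>_section[OF \<omega>] i])
  also have "\<dots> = (\<integral>s. indicator {0<..T} s *\<^sub>R (1 - mark_mean ?R \<omega> s) \<partial>dA \<omega>)"
  proof (intro Bochner_Integration.integral_cong refl)
    fix s assume "s \<in> space (dA \<omega>)"
    then have s: "s \<in> {0..T}" by (simp add: space_dA[OF \<omega>])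
    interpret \<phi>: prob_space "\<phi> \<omega> s" by (rule prob_\<phi>[OF \<omega> s])
    have "(\<integral>x. ?f (s, x) \<partial>\<phi> \<omega> s) = (\<integral>x. indicator {0<..T} s * (1 - ?R \<omega> s x) \<partial>\<phi> \<omega> s)"
      by (intro Bochner_Integration.integral_cong) (auto split: split_indicator)
    also have "\<dots> = indicator {0<..T} s * (1 - mark_mean ?R \<omega> s)"
      using integrable_mark[OF R \<omega> s] by (simp add: mark_mean_def \<phi>.prob_space)
    finally show "(\<integral>x. ?f (s, x) \<partial>\<phi> \<omega> s) = indicator {0<..T} s *\<^sub>R (1 - mark_mean ?R \<omega> s)" by simp
  qed
  also have "\<dots> = (\<integral>s. 1 - mark_mean ?R \<omega> s \<partial>dA \<omega>)"
    using set_integral_dA[OF \<omega>, of "\<lambda>s. 1 - mark_mean ?R \<omega> s"] measurable_time_path[OF predictable_mark_mean[OF R] \<omega>]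
    by (simp add: set_lebesgue_integral_def)
  finally have "(LINT (s, x):?B|compensator T A \<phi> \<omega>. 1 - ?R \<omega> s x) = log_drift ?R \<omega> T"
    by (simp add: set_lebesgue_integral_def compensator_def log_drift_terminal[OF \<omega>])
  then show ?thesis
    unfolding likelihood_def jump_density_def by (simp add: jumps_def \<tau>_def)
qed

lemma terminal_measurable:
  assumes C1: "hypothesis_C1 (space M) F T U r l g C\<^sub>r C\<^sub>l"
  shows "(\<lambda>\<omega>. g \<omega> (pc_process S X \<omega> T)) \<in> borel_measurable M"
proof -
  have g: "(\<lambda>(\<omega>, x). g \<omega> x) \<in> borel_measurable (F (ennreal T) \<Otimes>\<^sub>M borel)"
    using C1 by (simp add: hypothesis_C1_def)
  have id: "(\<lambda>\<omega>. \<omega>) \<in> M \<rightarrow>\<^sub>M F (ennreal T)"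
  proof (rule measurableI)
    fix B assume "B \<in> sets (F (ennreal T))"
    then show "(\<lambda>\<omega>. \<omega>) -` B \<inter> space M \<in> sets M"
      using sets_F_M sets.sets_into_space[of B M] by (auto simp: Int_absorb2)
  qed (simp add: space_F)
  have "(\<lambda>\<omega>. pc_process S X \<omega> T) \<in> M \<rightarrow>\<^sub>M borel"
    using measurable_compose[OF measurable_Pair2' measurable_pc_process, of T] T_pos by simp
  from measurable_compose[OF measurable_Pair[OF id this] g] show ?thesis by simp
qed

lemma cost_eq:
  assumes C1: "hypothesis_C1 (space M) F T U r l g C\<^sub>r C\<^sub>l" and C: "1 \<le> C\<^sub>r" and u: "u \<in> controls (space M) F T U"
  shows "cost M T S X A \<phi> r l g u = (\<integral>\<omega>. jump_density (\<lambda>\<omega> t x. r \<omega> t x (u \<omega> t)) \<omega> *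
     ((\<integral>t. l \<omega> t (pc_process S X \<omega> t) (u \<omega> t) \<partial>dA \<omega>) + g \<omega> (pc_process S X \<omega> T)) \<partial>M)"
proof -
  let ?R = "\<lambda>\<omega> t x. r \<omega> t x (u \<omega> t)"
  note R = control_intensity[OF C1 u]
  let ?c = "\<lambda>\<omega>. (\<integral>t. l \<omega> t (pc_process S X \<omega> t) (u \<omega> t) \<partial>dA \<omega>) + g \<omega> (pc_process S X \<omega> T)"
  have c_meas: "?c \<in> borel_measurable M"
    by (intro borel_measurable_add measurable_integral_dA measurable_running_cost[OF C1 u] terminal_measurable[OF C1])
  have dens: "controlled_measure M T S X A \<phi> r u = density M (\<lambda>\<omega>. ennreal (jump_density ?R \<omega>))"
    unfolding controlled_measure_def
    by (rule density_cong) (auto intro!: AE_I2 measurable_compose[OF _ measurable_ennreal] measurable_jump_density[OF R]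
        simp: likelihood_terminal[where r=r and u=u, OF R] cong: measurable_cong)
  have "cost M T S X A \<phi> r l g u = (\<integral>\<omega>. ?c \<omega> \<partial>density M (\<lambda>\<omega>. ennreal (jump_density ?R \<omega>)))"
    unfolding cost_def dens
  proof (intro Bochner_Integration.integral_cong refl)
    fix \<omega> assume "\<omega> \<in> space (density M (\<lambda>\<omega>. ennreal (jump_density ?R \<omega>)))"
    then have \<omega>: "\<omega> \<in> space M" by simp
    show "(LINT t:{0<..T}|dA \<omega>. l \<omega> t (pc_process S X \<omega> t) (u \<omega> t)) + g \<omega> (pc_process S X \<omega> T) = ?c \<omega>"
      using set_integral_dA[OF \<omega>, of "\<lambda>t. l \<omega> t (pc_process S X \<omega> t) (u \<omega> t)"] running_cost_path(1)[OF C1 u \<omega>]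
      by simp
  qed
  also have "\<dots> = (\<integral>\<omega>. jump_density ?R \<omega> *\<^sub>R ?c \<omega> \<partial>M)"
    using jump_density_bounds(1)[OF R C]
    by (intro integral_density c_meas measurable_jump_density[OF R] AE_I2)
  finally show ?thesis by simp
qed

text \<open>The set over which the infimum is taken is bounded below, since \<open>l\<close> and \<open>r\<close> are bounded and
  \<open>\<zeta>\<close> is integrable. Without a lower bound the infimum of a set of reals is an unspecified value.\<close>

lemma hamiltonian_le:
  assumes C1: "hypothesis_C1 (space M) F T U r l g C\<^sub>r C\<^sub>l" and v: "v \<in> space U"
    and \<omega>: "\<omega> \<in> space M" and t: "t \<in> {0..T}"
    and \<zeta>: "\<zeta> \<in> borel_measurable borel" and fin: "(\<integral>\<^sup>+x. ennreal \<bar>\<zeta> x\<bar> \<partial>\<phi> \<omega> t) < \<infinity>"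
  shows "hamiltonian U \<phi> r l \<omega> t y \<zeta> \<le> l \<omega> t y v + (LINT x|\<phi> \<omega> t. \<zeta> x * r \<omega> t x v)"
proof -
  let ?h = "\<lambda>u. l \<omega> t y u + (LINT x|\<phi> \<omega> t. \<zeta> x * r \<omega> t x u)"
  have "\<zeta> \<in> borel_measurable (\<phi> \<omega> t)"
    using \<zeta> by (simp add: measurable_cong_sets[OF sets_\<phi>[OF \<omega> t] refl])
  with fin have i: "integrable (\<phi> \<omega> t) \<zeta>"
    by (simp add: integrable_iff_bounded)
  have "- C\<^sub>l - C\<^sub>r * (\<integral>x. \<bar>\<zeta> x\<bar> \<partial>\<phi> \<omega> t) \<le> ?h u" if u: "u \<in> space U" for u
  proof -
    have b: "0 \<le> r \<omega> t x u" "r \<omega> t x u \<le> C\<^sub>r" "\<bar>l \<omega> t x u\<bar> \<le> C\<^sub>l" for x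
      using C1 \<omega> t u unfolding hypothesis_C1_def by blast+
    have "\<bar>LINT x|\<phi> \<omega> t. \<zeta> x * r \<omega> t x u\<bar> \<le> C\<^sub>r * (\<integral>x. \<bar>\<zeta> x\<bar> \<partial>\<phi> \<omega> t)"
    proof (cases "integrable (\<phi> \<omega> t) (\<lambda>x. \<zeta> x * r \<omega> t x u)")
      case True
      have "\<bar>LINT x|\<phi> \<omega> t. \<zeta> x * r \<omega> t x u\<bar> \<le> (\<integral>x. \<bar>\<zeta> x * r \<omega> t x u\<bar> \<partial>\<phi> \<omega> t)"
        by (rule integral_abs_bound)
      also have "\<dots> \<le> (\<integral>x. C\<^sub>r * \<bar>\<zeta> x\<bar> \<partial>\<phi> \<omega> t)"
        using True i b by (intro integral_mono integrable_abs integrable_mult_right)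
          (auto simp: abs_mult mult.commute[of C\<^sub>r] intro!: mult_left_mono)
      finally show ?thesis by simp
    next
      case False
      have "0 \<le> C\<^sub>r" using b[of undefined] by linarith
      then show ?thesis
        using False by (simp add: not_integrable_integral_eq)
    qed
    then show ?thesis using b(3)[of y] by (simp add: abs_le_iff)
  qed
  then have "bdd_below (?h ` space U)"
    by (auto intro!: bdd_belowI)
  then have "(INF u\<in>space U. ?h u) \<le> ?h v"
    using v by (rule cINF_lower)
  then show ?thesis
    using fin by (simp add: hamiltonian_def)
qed

text \<open>Along almost every path and for almost every time the Hamiltonian is attained at the minimising control,
  which makes it equal to a Borel function, and it lies below its value at any other control.\<close>

lemma hamiltonian_integral:
  assumes C1: "hypothesis_C1 (space M) F T U r l g C\<^sub>r C\<^sub>l"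
    and Z: "predictable_field Z"
    and Z_path: "AE \<omega> in M. (\<integral>\<^sup>+t. \<integral>\<^sup>+x. ennreal \<bar>Z \<omega> t x\<bar> \<partial>\<phi> \<omega> t \<partial>dA \<omega>) < \<infinity>"
    and us: "minimizing_control M T S X F A \<phi> U r l Z us" and u: "u \<in> controls (space M) F T U"
    and int_us: "AE \<omega> in M. integrable (dA \<omega>) (\<lambda>t. \<integral>x. Z \<omega> t x * r \<omega> t x (us \<omega> t) \<partial>\<phi> \<omega> t)"
    and int_u: "AE \<omega> in M. integrable (dA \<omega>) (\<lambda>t. \<integral>x. Z \<omega> t x * r \<omega> t x (u \<omega> t) \<partial>\<phi> \<omega> t)"
  shows "AE \<omega> in M. (LINT s:{0<..T}|completion (dA \<omega>). hamiltonian U \<phi> r l \<omega> s (pc_process S X \<omega> s) (Z \<omega> s))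
        = (\<integral>t. l \<omega> t (pc_process S X \<omega> t) (us \<omega> t) \<partial>dA \<omega>) + (\<integral>t. \<integral>x. Z \<omega> t x * r \<omega> t x (us \<omega> t) \<partial>\<phi> \<omega> t \<partial>dA \<omega>)"
    and "AE \<omega> in M. (LINT s:{0<..T}|completion (dA \<omega>). hamiltonian U \<phi> r l \<omega> s (pc_process S X \<omega> s) (Z \<omega> s))
        \<le> (\<integral>t. l \<omega> t (pc_process S X \<omega> t) (u \<omega> t) \<partial>dA \<omega>) + (\<integral>t. \<integral>x. Z \<omega> t x * r \<omega> t x (u \<omega> t) \<partial>\<phi> \<omega> t \<partial>dA \<omega>)"
proof -
  have us_control: "us \<in> controls (space M) F T U"
    using us by (simp add: minimizing_control_def)
  have absZ: "predictable_field (\<lambda>\<omega> t x. ennreal \<bar>Z \<omega> t x\<bar>)"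
    by (rule measurable_field_abs[OF Z])
  define f where "f \<omega> s = hamiltonian U \<phi> r l \<omega> s (pc_process S X \<omega> s) (Z \<omega> s)" for \<omega> s
  \<comment> \<open>what the Hamiltonian minimises, at the control \<open>w\<close>\<close>
  define k where "k w \<omega> t = l \<omega> t (pc_process S X \<omega> t) (w \<omega> t) + (\<integral>x. Z \<omega> t x * r \<omega> t x (w \<omega> t) \<partial>\<phi> \<omega> t)" for w :: "'a \<Rightarrow> real \<Rightarrow> 'b" and \<omega> t
  have "AE \<omega> in M. AE t in dA \<omega>. (\<integral>\<^sup>+v. ennreal \<bar>Z \<omega> t v\<bar> \<partial>\<phi> \<omega> t) < \<infinity> \<longrightarrow>
        hamiltonian U \<phi> r l \<omega> t (pc_left S X \<omega> t) (Z \<omega> t) =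
          l \<omega> t (pc_left S X \<omega> t) (us \<omega> t) + (LINT v|\<phi> \<omega> t. Z \<omega> t v * r \<omega> t v (us \<omega> t))"
    using us AE_kernel_product_dA by (fastforce simp: minimizing_control_def)
  then have main: "AE \<omega> in M. (LINT s:{0<..T}|completion (dA \<omega>). f \<omega> s) = (\<integral>t. k us \<omega> t \<partial>dA \<omega>)
      \<and> (\<integral>t. k us \<omega> t \<partial>dA \<omega>) \<le> (\<integral>t. k u \<omega> t \<partial>dA \<omega>)
      \<and> (\<forall>w\<in>{us, u}. (\<integral>t. k w \<omega> t \<partial>dA \<omega>) = (\<integral>t. l \<omega> t (pc_process S X \<omega> t) (w \<omega> t) \<partial>dA \<omega>) + (\<integral>t. \<integral>x. Z \<omega> t x * r \<omega> t x (w \<omega> t) \<partial>\<phi> \<omega> t \<partial>dA \<omega>))"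
    using Z_path int_us int_u AE_space
  proof eventually_elim
    fix \<omega> assume min: "AE t in dA \<omega>. (\<integral>\<^sup>+v. ennreal \<bar>Z \<omega> t v\<bar> \<partial>\<phi> \<omega> t) < \<infinity> \<longrightarrow>
        hamiltonian U \<phi> r l \<omega> t (pc_left S X \<omega> t) (Z \<omega> t) =
          l \<omega> t (pc_left S X \<omega> t) (us \<omega> t) + (LINT v|\<phi> \<omega> t. Z \<omega> t v * r \<omega> t v (us \<omega> t))"
      and fin: "(\<integral>\<^sup>+t. \<integral>\<^sup>+x. ennreal \<bar>Z \<omega> t x\<bar> \<partial>\<phi> \<omega> t \<partial>dA \<omega>) < \<infinity>"
      and i_us: "integrable (dA \<omega>) (\<lambda>t. \<integral>x. Z \<omega> t x * r \<omega> t x (us \<omega> t) \<partial>\<phi> \<omega> t)"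
      and i_u: "integrable (dA \<omega>) (\<lambda>t. \<integral>x. Z \<omega> t x * r \<omega> t x (u \<omega> t) \<partial>\<phi> \<omega> t)"
      and \<omega>: "\<omega> \<in> space M"
    have k_int: "integrable (dA \<omega>) (k w \<omega>)" if "w \<in> {us, u}" for w
      unfolding k_def using that i_us i_u running_cost_path(1)[OF C1 us_control \<omega>] running_cost_path(1)[OF C1 u \<omega>]
      by (intro Bochner_Integration.integrable_add) auto
    have k_eq: "(\<integral>t. k w \<omega> t \<partial>dA \<omega>) = (\<integral>t. l \<omega> t (pc_process S X \<omega> t) (w \<omega> t) \<partial>dA \<omega>) + (\<integral>t. \<integral>x. Z \<omega> t x * r \<omega> t x (w \<omega> t) \<partial>\<phi> \<omega> t \<partial>dA \<omega>)"
      if "w \<in> {us, u}" for w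
      unfolding k_def using that i_us i_u running_cost_path(1)[OF C1 us_control \<omega>] running_cost_path(1)[OF C1 u \<omega>]
      by (intro Bochner_Integration.integral_add) auto
    have AE_fin: "AE t in dA \<omega>. (\<integral>\<^sup>+v. ennreal \<bar>Z \<omega> t v\<bar> \<partial>\<phi> \<omega> t) \<noteq> \<infinity>"
      using fin by (intro nn_integral_noteq_infinite measurable_time_path[OF predictable_mark_nn_integral[OF absZ] \<omega>]) simp
    have f_us: "AE t in dA \<omega>. f \<omega> t = k us \<omega> t"
      using min AE_fin AE_pc_left[OF \<omega>]
      by eventually_elim (simp add: f_def k_def less_top)
    have f_u: "AE t in dA \<omega>. f \<omega> t \<le> k u \<omega> t"
      using AE_fin AE_space
    proof eventually_elim
      case (elim t)
      then have t: "t \<in> {0..T}" by (simp add: space_dA[OF \<omega>])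
      have "Z \<omega> t \<in> borel_measurable borel"
        using measurable_Pair2[OF Z, of "(\<omega>, t)"] \<omega> t by (simp add: space_P)
      then show ?case
        unfolding f_def k_def using elim control_value[OF u \<omega> t]
        by (intro hamiltonian_le[OF C1 _ \<omega> t]) (auto simp: less_top)
    qed
    have "(LINT s:{0<..T}|completion (dA \<omega>). f \<omega> s) = (LINT s:{0<..T}|dA \<omega>. k us \<omega> s)"
      unfolding set_lebesgue_integral_def
    proof (rule integral_completion_AE)
      have "{0<..T} \<in> sets (dA \<omega>)"
        by (simp add: sets_dA[OF \<omega>] sets_restrict_space_iff subset_eq)
      then show "(\<lambda>s. indicator {0<..T} s *\<^sub>R k us \<omega> s) \<in> borel_measurable (dA \<omega>)"
        using borel_measurable_integrable[OF k_int[of us]] by simp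
      show "AE s in dA \<omega>. indicator {0<..T} s *\<^sub>R f \<omega> s = indicator {0<..T} s *\<^sub>R k us \<omega> s"
        using f_us by eventually_elim simp
    qed
    also have "\<dots> = (\<integral>t. k us \<omega> t \<partial>dA \<omega>)"
      using borel_measurable_integrable[OF k_int[of us]] by (intro set_integral_dA[OF \<omega>]) simp
    finally have 1: "(LINT s:{0<..T}|completion (dA \<omega>). f \<omega> s) = (\<integral>t. k us \<omega> t \<partial>dA \<omega>)" .
    have 2: "(\<integral>t. k us \<omega> t \<partial>dA \<omega>) \<le> (\<integral>t. k u \<omega> t \<partial>dA \<omega>)"
      using f_us f_u by (intro integral_mono_AE k_int) (auto elim: eventually_elim2)
    show "(LINT s:{0<..T}|completion (dA \<omega>). f \<omega> s) = (\<integral>t. k us \<omega> t \<partial>dA \<omega>)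
      \<and> (\<integral>t. k us \<omega> t \<partial>dA \<omega>) \<le> (\<integral>t. k u \<omega> t \<partial>dA \<omega>)
      \<and> (\<forall>w\<in>{us, u}. (\<integral>t. k w \<omega> t \<partial>dA \<omega>) = (\<integral>t. l \<omega> t (pc_process S X \<omega> t) (w \<omega> t) \<partial>dA \<omega>) + (\<integral>t. \<integral>x. Z \<omega> t x * r \<omega> t x (w \<omega> t) \<partial>\<phi> \<omega> t \<partial>dA \<omega>))"
      using 1 2 k_eq by blast
  qed
  show "AE \<omega> in M. (LINT s:{0<..T}|completion (dA \<omega>). hamiltonian U \<phi> r l \<omega> s (pc_process S X \<omega> s) (Z \<omega> s))
        = (\<integral>t. l \<omega> t (pc_process S X \<omega> t) (us \<omega> t) \<partial>dA \<omega>) + (\<integral>t. \<integral>x. Z \<omega> t x * r \<omega> t x (us \<omega> t) \<partial>\<phi> \<omega> t \<partial>dA \<omega>)"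
    using main by eventually_elim (simp add: f_def)
  show "AE \<omega> in M. (LINT s:{0<..T}|completion (dA \<omega>). hamiltonian U \<phi> r l \<omega> s (pc_process S X \<omega> s) (Z \<omega> s))
        \<le> (\<integral>t. l \<omega> t (pc_process S X \<omega> t) (u \<omega> t) \<partial>dA \<omega>) + (\<integral>t. \<integral>x. Z \<omega> t x * r \<omega> t x (u \<omega> t) \<partial>\<phi> \<omega> t \<partial>dA \<omega>)"
    using main by eventually_elim (simp add: f_def)
qed

text \<open>A consequence of \<open>F\<close> being trivial at time \<open>0\<close>, valid for every \<open>\<omega>\<close> and not just almost surely.\<close>

lemma adapted_initial_const:
  assumes "adapted F T Y"
  obtains y where "\<And>\<omega>. \<omega> \<in> space M \<Longrightarrow> Y \<omega> 0 = y"
proof -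
  obtain \<omega>0 where \<omega>0: "\<omega>0 \<in> space M" using not_empty by blast
  have "(\<lambda>\<omega>. Y \<omega> 0) \<in> borel_measurable (F 0)"
    using assms T_pos by (auto simp: adapted_def dest!: bspec[of _ _ 0])
  from measurable_sets[OF this, of "{Y \<omega>0 0}"] have "(\<lambda>\<omega>. Y \<omega> 0) -` {Y \<omega>0 0} \<inter> space M \<in> sets (F 0)"
    by (simp add: space_F)
  from sets_F_0[OF this] \<omega>0 have "(\<lambda>\<omega>. Y \<omega> 0) -` {Y \<omega>0 0} \<inter> space M = space M"
    by blast
  then have "Y \<omega> 0 = Y \<omega>0 0" if "\<omega> \<in> space M" for \<omega>
    using that by blast
  then show ?thesis by (rule that)
qed

lemma jump_set_integral:
  fixes Z :: "'a \<Rightarrow> real \<Rightarrow> 'k \<Rightarrow> real"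
  assumes Z: "predictable_field Z" and \<omega>: "\<omega> \<in> space M"
  shows "(LINT (s, x):{0<..T} \<times> UNIV|jump_measure T S X \<omega>. Z \<omega> s x) = (\<Sum>n\<in>jumps \<omega>. Z \<omega> (\<tau> n \<omega>) (X n \<omega>))"
proof -
  have "(\<lambda>(s, x). Z \<omega> s x) \<in> borel_measurable (time_space T \<Otimes>\<^sub>M borel)"
    using measurable_field_section[OF Z \<omega>] by (simp add: measurable_cong_sets[OF sets_pair_measure_cong[OF sets_dA[OF \<omega>] refl] refl])
  then have "(\<lambda>z. indicator ({0<..T} \<times> (UNIV :: 'k set)) z *\<^sub>R (case z of (s, x) \<Rightarrow> Z \<omega> s x)) \<in> borel_measurable (time_space T \<Otimes>\<^sub>M borel)"
    by (intro borel_measurable_scaleR borel_measurable_indicator pair_measureI) (auto simp: sets_restrict_space_iff subset_eq)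
  from integral_jump_measure[OF \<omega> this]
  have "(LINT (s, x):{0<..T} \<times> UNIV|jump_measure T S X \<omega>. Z \<omega> s x)
      = (\<Sum>n\<in>jumps \<omega>. indicator ({0<..T} \<times> (UNIV :: 'k set)) (\<tau> n \<omega>, X n \<omega>) *\<^sub>R Z \<omega> (\<tau> n \<omega>) (X n \<omega>))"
    unfolding set_lebesgue_integral_def by simp
  also have "\<dots> = (\<Sum>n\<in>jumps \<omega>. Z \<omega> (\<tau> n \<omega>) (X n \<omega>))"
    using S_eq_\<tau>(2,3)[OF \<omega>] by (intro sum.cong) auto
  finally show ?thesis .
qed

text \<open>The verification argument. Insert the backward equation at time \<open>0\<close> into the cost and use the
  compensation formula under the controlled measure to replace \<open>\<Sum> Z\<close> by \<open>\<integral>\<integral> Z r d\<nu>\<close>. The cost is then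
  \<open>y\<close> plus the expectation of \<open>L E\<close>, where \<open>E\<close> is the \<open>dA\<close>-integral of the
  expression minimised in the Hamiltonian, at the control \<open>u\<close>, minus the Hamiltonian.\<close>

lemma verification:
  fixes U :: "'u measure" and p \<beta> C\<^sub>r C\<^sub>l :: real
  assumes C1: "hypothesis_C1 (space M) F T U r l g C\<^sub>r C\<^sub>l"
    and p: "1 < p" and \<beta>: "0 < \<beta>"
    and exp_A: "integrable M (\<lambda>\<omega>. exp (((2 * p - 1) / (p - 1) + (p - 1) * C\<^sub>r powr ((p / (p - 1))\<^sup>2)) * A \<omega> T))"
    and g_X: "integrable M (\<lambda>\<omega>. \<bar>g \<omega> (pc_process S X \<omega> T)\<bar> powr p * exp (\<beta> * A \<omega> T))"
    and YZ_Lp: "(Y, Z) \<in> Lp_space M T F A \<phi> p \<beta>"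
    and YZ_bsde: "bsde_solution M T S X F A \<phi> (hamiltonian U \<phi> r l) g Y Z"
    and us: "minimizing_control M T S X F A \<phi> U r l Z us"
    and y: "\<And>\<omega>. \<omega> \<in> space M \<Longrightarrow> Y \<omega> 0 = y"
    and u: "u \<in> controls (space M) F T U"
  shows "y \<le> cost M T S X A \<phi> r l g u" and "u = us \<Longrightarrow> cost M T S X A \<phi> r l g u = y"
proof -
  have Cr: "1 < C\<^sub>r" and Cl: "0 < C\<^sub>l" using C1 by (auto simp: hypothesis_C1_def)
  define q where "q = p / (p - 1)"
  have q: "1 < q" "1 / q + 1 / p = 1" using p by (auto simp: q_def field_simps)
  \<comment> \<open>the largest \<open>\<eta>\<close> for which the exponential moment still dominates\<close>
  define \<eta> where "\<eta> = C\<^sub>r powr (q - 1) - 1"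
  have \<eta>: "0 < \<eta>" using Cr q by (simp add: \<eta>_def)
  have Cr_q: "C\<^sub>r powr q = C\<^sub>r * (1 + \<eta>)"
    using Cr powr_add[of C\<^sub>r 1 "q - 1"] by (simp add: \<eta>_def)
  have D: "integrable M (\<lambda>\<omega>. exp (q * A \<omega> T) * (C\<^sub>r powr q) ^ card (jumps \<omega>))"
    unfolding q_def by (rule jump_exponential_moment[OF p Cr exp_A])
  have D': "integrable M (\<lambda>\<omega>. exp (q * A \<omega> T) * (C\<^sub>r * (1 + \<eta>)) ^ card (jumps \<omega>))"
    using D unfolding Cr_q .
  have Z: "predictable_field Z"
    using YZ_Lp by (simp add: Lp_space_def predictable_fun_def)
  have Zs: "(\<lambda>z. Z (fst (fst z)) (snd (fst z)) (snd z)) \<in> borel_measurable (\<P> \<Otimes>\<^sub>M borel)"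
    using Z by (simp add: split_beta')
  have As: "(\<lambda>z. A (fst (fst z)) (snd (fst z))) \<in> borel_measurable (\<P> \<Otimes>\<^sub>M (borel :: 'k measure))"
    using measurable_compose[OF measurable_fst A_predictable] by (simp add: split_beta')
  have absZ: "predictable_field (\<lambda>\<omega> t x. ennreal \<bar>Z \<omega> t x\<bar>)"
    by (rule measurable_field_abs[OF Z])
  have ZpA: "predictable_field (\<lambda>\<omega> t x. ennreal (\<bar>Z \<omega> t x\<bar> powr p * exp (\<beta> * A \<omega> t)))"
    unfolding split_beta' using Zs As by measurable
  have Z_path: "AE \<omega> in M. (\<integral>\<^sup>+t. \<integral>\<^sup>+x. ennreal \<bar>Z \<omega> t x\<bar> \<partial>\<phi> \<omega> t \<partial>dA \<omega>) < \<infinity>"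
  proof -
    have "AE \<omega> in M. (\<integral>\<^sup>+(s, x). ennreal \<bar>Z \<omega> s x\<bar> \<partial>compensator T A \<phi> \<omega>) < \<infinity>"
      using YZ_bsde by (simp add: bsde_solution_def)
    then show ?thesis
      using AE_space by eventually_elim (simp add: nn_integral_compensator[OF absZ])
  qed
  have Z_fin: "(\<integral>\<^sup>+\<omega>. \<integral>\<^sup>+t. \<integral>\<^sup>+x. ennreal (\<bar>Z \<omega> t x\<bar> powr p * exp (\<beta> * A \<omega> t)) \<partial>\<phi> \<omega> t \<partial>dA \<omega> \<partial>M) < \<infinity>"
  proof -
    have "(\<integral>\<^sup>+\<omega>. \<integral>\<^sup>+t. \<integral>\<^sup>+x. ennreal (\<bar>Z \<omega> t x\<bar> powr p * exp (\<beta> * A \<omega> t)) \<partial>\<phi> \<omega> t \<partial>dA \<omega> \<partial>M)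
        = (\<integral>\<^sup>+\<omega>. (\<integral>\<^sup>+(t, x). ennreal (\<bar>Z \<omega> t x\<bar> powr p * exp (\<beta> * A \<omega> t)) \<partial>compensator T A \<phi> \<omega>) \<partial>M)"
      by (intro nn_integral_cong) (simp add: nn_integral_compensator[OF ZpA])
    also have "\<dots> \<le> (\<integral>\<^sup>+\<omega>. (\<integral>\<^sup>+(s, x). ennreal ((\<bar>Y \<omega> s\<bar> powr p + \<bar>Z \<omega> s x\<bar> powr p) * exp (\<beta> * A \<omega> s)) \<partial>compensator T A \<phi> \<omega>) \<partial>M)"
      by (intro nn_integral_mono) (auto intro!: ennreal_leI mult_right_mono)
    also have "\<dots> < \<infinity>"
      using YZ_Lp by (simp add: Lp_space_def)
    finally show ?thesis .
  qed
  have us_control: "us \<in> controls (space M) F T U"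
    using us by (simp add: minimizing_control_def)
  define R where "R = (\<lambda>\<omega> t x. r \<omega> t x (u \<omega> t))"
  define L where "L = jump_density R"
  have fin: "(\<integral>\<^sup>+\<omega>. ennreal (jump_density (\<lambda>\<omega> t x. r \<omega> t x (w \<omega> t)) \<omega>) * (\<integral>\<^sup>+t. \<integral>\<^sup>+x. ennreal \<bar>Z \<omega> t x\<bar> \<partial>\<phi> \<omega> t \<partial>dA \<omega>) \<partial>M) < \<infinity>"
    if "w \<in> controls (space M) F T U" for w
    by (rule integrable_density_field[OF control_intensity[OF C1 that] Cr p q \<beta> D Z Z_fin])
  note Girsanov = compensation_under_density_signed[OF control_intensity[OF C1] less_imp_le[OF Cr] q(1) \<eta> D' Z Z_path fin]
  note G_u = Girsanov[OF u u, folded R_def L_def]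
  have R: "intensity C\<^sub>r R"
    unfolding R_def by (rule control_intensity[OF C1 u])
  have L_pos: "0 \<le> L \<omega>" and L_le: "L \<omega> \<le> exp (A \<omega> T) * C\<^sub>r ^ card (jumps \<omega>)" if "\<omega> \<in> space M" for \<omega>
    using jump_density_bounds[OF R _ that] Cr by (auto simp: L_def)
  have [measurable]: "L \<in> borel_measurable M"
    unfolding L_def by (rule measurable_jump_density[OF R])
  have L1: "integrable M L" "(\<integral>\<omega>. L \<omega> \<partial>M) = 1"
  proof -
    have D1: "integrable M (\<lambda>\<omega>. exp (q * A \<omega> T) * C\<^sub>r ^ card (jumps \<omega>))"
    proof (rule Bochner_Integration.integrable_bound[OF D])
      have [measurable]: "(\<lambda>\<omega>. A \<omega> T) \<in> borel_measurable M" using A_measurable[of T] T_pos by simp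
      show "(\<lambda>\<omega>. exp (q * A \<omega> T) * C\<^sub>r ^ card (jumps \<omega>)) \<in> borel_measurable M"
        using measurable_power_jumps[of C\<^sub>r] by measurable
      have "C\<^sub>r \<le> C\<^sub>r powr q" using powr_mono[of 1 q C\<^sub>r] Cr q by simp
      then show "AE \<omega> in M. norm (exp (q * A \<omega> T) * C\<^sub>r ^ card (jumps \<omega>)) \<le> norm (exp (q * A \<omega> T) * (C\<^sub>r powr q) ^ card (jumps \<omega>))"
        using Cr by (intro AE_I2) (simp add: abs_mult power_abs power_mono)
    qed
    show "integrable M L" "(\<integral>\<omega>. L \<omega> \<partial>M) = 1"
      unfolding L_def using expectation_jump_density_dominated[OF R less_imp_le[OF Cr] q(1) D1] by auto
  qed
  define c where "c \<omega> = (\<integral>t. l \<omega> t (pc_process S X \<omega> t) (u \<omega> t) \<partial>dA \<omega>)" for \<omega>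
  define z where "z \<omega> = (\<integral>t. \<integral>x. Z \<omega> t x * R \<omega> t x \<partial>\<phi> \<omega> t \<partial>dA \<omega>)" for \<omega>
  define \<Sigma> where "\<Sigma> \<omega> = (\<Sum>n\<in>jumps \<omega>. Z \<omega> (\<tau> n \<omega>) (X n \<omega>))" for \<omega>
  define h where "h \<omega> = g \<omega> (pc_process S X \<omega> T)" for \<omega>
  have [measurable]: "c \<in> borel_measurable M" "h \<in> borel_measurable M"
    unfolding c_def h_def by (intro measurable_integral_dA measurable_running_cost[OF C1 u] terminal_measurable[OF C1])+
  have A_pos: "0 \<le> A \<omega> T" if "\<omega> \<in> space M" for \<omega>
    using A_nonneg[OF that, of T] T_pos by simp
  have Lc: "integrable M (\<lambda>\<omega>. L \<omega> * c \<omega>)"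
  proof (rule Bochner_Integration.integrable_bound[OF integrable_mult_right[OF D, of "C\<^sub>l / (q - 1)"]])
    show "AE \<omega> in M. norm (L \<omega> * c \<omega>) \<le> norm (C\<^sub>l / (q - 1) * (exp (q * A \<omega> T) * (C\<^sub>r powr q) ^ card (jumps \<omega>)))"
    proof (rule AE_I2)
      fix \<omega> assume \<omega>: "\<omega> \<in> space M"
      have "norm (L \<omega> * c \<omega>) \<le> (exp (A \<omega> T) * C\<^sub>r ^ card (jumps \<omega>)) * (C\<^sub>l * A \<omega> T)"
        unfolding real_norm_def abs_mult c_def
        using L_pos[OF \<omega>] L_le[OF \<omega>] running_cost_path(2)[OF C1 u \<omega>] by (intro mult_mono) auto
      also have "\<dots> = C\<^sub>l * (A \<omega> T * exp (A \<omega> T)) * C\<^sub>r ^ card (jumps \<omega>)"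
        by (simp add: mult_ac)
      also have "\<dots> \<le> C\<^sub>l * (1 / (q - 1) * exp (q * A \<omega> T)) * (C\<^sub>r powr q) ^ card (jumps \<omega>)"
      proof (rule mult_mono)
        show "C\<^sub>l * (A \<omega> T * exp (A \<omega> T)) \<le> C\<^sub>l * (1 / (q - 1) * exp (q * A \<omega> T))"
          using Cl by (intro mult_left_mono mult_exp_le[OF q(1) A_pos[OF \<omega>]]) simp
        have "C\<^sub>r \<le> C\<^sub>r powr q" using powr_mono[of 1 q C\<^sub>r] Cr q by simp
        then show "C\<^sub>r ^ card (jumps \<omega>) \<le> (C\<^sub>r powr q) ^ card (jumps \<omega>)"
          using Cr by (intro power_mono) auto
      qed (use Cl q Cr in auto)
      also have "\<dots> = C\<^sub>l / (q - 1) * (exp (q * A \<omega> T) * (C\<^sub>r powr q) ^ card (jumps \<omega>))"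
        by simp
      finally show "norm (L \<omega> * c \<omega>) \<le> norm (C\<^sub>l / (q - 1) * (exp (q * A \<omega> T) * (C\<^sub>r powr q) ^ card (jumps \<omega>)))"
        by (rule order_trans) (simp only: real_norm_def abs_ge_self)
    qed
  qed simp
  have Lh: "integrable M (\<lambda>\<omega>. L \<omega> * h \<omega>)"
  proof (rule Bochner_Integration.integrable_bound[OF Bochner_Integration.integrable_add[OF D g_X]])
    show "AE \<omega> in M. norm (L \<omega> * h \<omega>) \<le> norm (exp (q * A \<omega> T) * (C\<^sub>r powr q) ^ card (jumps \<omega>)
        + \<bar>g \<omega> (pc_process S X \<omega> T)\<bar> powr p * exp (\<beta> * A \<omega> T))"
    proof (rule AE_I2)
      fix \<omega> assume \<omega>: "\<omega> \<in> space M"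
      have "norm (L \<omega> * h \<omega>) = L \<omega> * \<bar>h \<omega>\<bar>"
        using L_pos[OF \<omega>] by (simp add: abs_mult)
      also have "\<dots> \<le> L \<omega> powr q + \<bar>h \<omega>\<bar> powr p"
        using L_pos[OF \<omega>] p q by (intro Young_sum) auto
      also have "\<dots> \<le> exp (q * A \<omega> T) * (C\<^sub>r powr q) ^ card (jumps \<omega>) + \<bar>h \<omega>\<bar> powr p * exp (\<beta> * A \<omega> T)"
      proof (rule add_mono)
        show "L \<omega> powr q \<le> exp (q * A \<omega> T) * (C\<^sub>r powr q) ^ card (jumps \<omega>)"
          unfolding L_def by (rule jump_density_powr_le[OF R Cr q(1) \<omega>])
        have "1 \<le> exp (\<beta> * A \<omega> T)" using \<beta> A_pos[OF \<omega>] by simp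
        then show "\<bar>h \<omega>\<bar> powr p \<le> \<bar>h \<omega>\<bar> powr p * exp (\<beta> * A \<omega> T)"
          using mult_left_mono[of 1 "exp (\<beta> * A \<omega> T)" "\<bar>h \<omega>\<bar> powr p"] by simp
      qed
      finally show "norm (L \<omega> * h \<omega>) \<le> norm (exp (q * A \<omega> T) * (C\<^sub>r powr q) ^ card (jumps \<omega>)
        + \<bar>g \<omega> (pc_process S X \<omega> T)\<bar> powr p * exp (\<beta> * A \<omega> T))"
        unfolding h_def by (rule order_trans) (simp only: real_norm_def abs_ge_self)
    qed
  qed simp
  have L\<Sigma>: "integrable M (\<lambda>\<omega>. L \<omega> * \<Sigma> \<omega>)" and Lz: "integrable M (\<lambda>\<omega>. L \<omega> * z \<omega>)"
    and \<Sigma>z: "(\<integral>\<omega>. L \<omega> * \<Sigma> \<omega> \<partial>M) = (\<integral>\<omega>. L \<omega> * z \<omega> \<partial>M)"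
    using G_u(2-4) by (simp_all add: \<Sigma>_def z_def R_def)
  have J: "cost M T S X A \<phi> r l g u = (\<integral>\<omega>. L \<omega> * (c \<omega> + h \<omega>) \<partial>M)"
    unfolding cost_eq[OF C1 less_imp_le[OF Cr] u] L_def R_def c_def h_def ..
  \<comment> \<open>the subtracted term equals the integral of the Hamiltonian, by the equation at time \<open>0\<close>;
    in this form it is measurable\<close>
  define E where "E \<omega> = c \<omega> + z \<omega> - (y + \<Sigma> \<omega> - h \<omega>)" for \<omega>
  have J_E: "cost M T S X A \<phi> r l g u = y + (\<integral>\<omega>. L \<omega> * E \<omega> \<partial>M)" and LE: "integrable M (\<lambda>\<omega>. L \<omega> * E \<omega>)"
  proof -
    have E_eq: "L \<omega> * E \<omega> = ((L \<omega> * c \<omega> + L \<omega> * h \<omega>) + (L \<omega> * z \<omega> - L \<omega> * \<Sigma> \<omega>)) - y * L \<omega>" for \<omega>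
      by (simp add: E_def algebra_simps)
    show "integrable M (\<lambda>\<omega>. L \<omega> * E \<omega>)"
      unfolding E_eq using Lc Lh Lz L\<Sigma> L1 by simp
    have "(\<integral>\<omega>. L \<omega> * E \<omega> \<partial>M) = ((\<integral>\<omega>. L \<omega> * c \<omega> \<partial>M) + (\<integral>\<omega>. L \<omega> * h \<omega> \<partial>M)) - y"
      unfolding E_eq using Lc Lh Lz L\<Sigma> L1 \<Sigma>z by simp
    also have "(\<integral>\<omega>. L \<omega> * c \<omega> \<partial>M) + (\<integral>\<omega>. L \<omega> * h \<omega> \<partial>M) = (\<integral>\<omega>. L \<omega> * (c \<omega> + h \<omega>) \<partial>M)"
      using Lc Lh by (simp add: distrib_left)
    finally show "cost M T S X A \<phi> r l g u = y + (\<integral>\<omega>. L \<omega> * E \<omega> \<partial>M)"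
      unfolding J by simp
  qed
  have bsde0: "AE \<omega> in M. y + \<Sigma> \<omega> - h \<omega> = (LINT s:{0<..T}|completion (dA \<omega>). hamiltonian U \<phi> r l \<omega> s (pc_process S X \<omega> s) (Z \<omega> s))"
  proof -
    have "AE \<omega> in M. \<forall>t\<in>{0..T}.
        Y \<omega> t + (LINT (s, x):{t<..T} \<times> UNIV|jump_measure T S X \<omega>. Z \<omega> s x) =
        g \<omega> (pc_process S X \<omega> T) +
        (LINT s:{t<..T}|completion (stieltjes T (A \<omega>)). hamiltonian U \<phi> r l \<omega> s (pc_process S X \<omega> s) (Z \<omega> s))"
      using YZ_bsde by (simp add: bsde_solution_def)
    then show ?thesis
      using AE_space
    proof eventually_elim
      case (elim \<omega>)
      have "Y \<omega> 0 + (LINT (s, x):{0<..T} \<times> UNIV|jump_measure T S X \<omega>. Z \<omega> s x) =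
        g \<omega> (pc_process S X \<omega> T) +
        (LINT s:{0<..T}|completion (stieltjes T (A \<omega>)). hamiltonian U \<phi> r l \<omega> s (pc_process S X \<omega> s) (Z \<omega> s))"
        using elim(1) T_pos by (auto dest!: bspec[of _ _ 0])
      then show ?case
        unfolding y[OF elim(2)] jump_set_integral[OF Z elim(2)] \<Sigma>_def h_def by linarith
    qed
  qed
  note ham = hamiltonian_integral[OF C1 Z Z_path us u Girsanov(1)[OF us_control us_control] Girsanov(1)[OF u u]]
  have "AE \<omega> in M. 0 \<le> L \<omega> * E \<omega>"
    using bsde0 ham(2) AE_space
    by eventually_elim (use L_pos in \<open>auto simp: E_def c_def z_def R_def intro!: mult_nonneg_nonneg\<close>)
  then have "0 \<le> (\<integral>\<omega>. L \<omega> * E \<omega> \<partial>M)"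
    by (rule integral_nonneg_AE)
  then show "y \<le> cost M T S X A \<phi> r l g u"
    unfolding J_E by simp
  show "cost M T S X A \<phi> r l g u = y" if "u = us"
  proof -
    have "AE \<omega> in M. L \<omega> * E \<omega> = 0"
      using bsde0 ham(1) by eventually_elim (simp add: E_def c_def z_def R_def that)
    then have "(\<integral>\<omega>. L \<omega> * E \<omega> \<partial>M) = (\<integral>\<omega>. 0 \<partial>M)"
      using LE by (intro integral_cong_AE) auto
    then show ?thesis
      unfolding J_E by simp
  qed
qed

end

section \<open>Optimality\<close>

theorem theorem5p4:
  fixes M :: "'a measure"
    and T :: real
    and S :: "nat \<Rightarrow> 'a \<Rightarrow> ennreal"
    and X :: "nat \<Rightarrow> 'a \<Rightarrow> 'k::t2_space"
    and \<Delta> :: 'k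
    and F :: "ennreal \<Rightarrow> 'a measure"
    and A :: "'a \<Rightarrow> real \<Rightarrow> real"
    and \<phi> :: "'a \<Rightarrow> real \<Rightarrow> 'k measure"
    and U :: "'u measure"
    and r l :: "'a \<Rightarrow> real \<Rightarrow> 'k \<Rightarrow> 'u \<Rightarrow> real"
    and g :: "'a \<Rightarrow> 'k \<Rightarrow> real"
    and C\<^sub>r C\<^sub>l p \<epsilon> C\<^sub>\<epsilon> \<beta> :: real
    and Y :: "'a \<Rightarrow> real \<Rightarrow> real"
    and Z :: "'a \<Rightarrow> real \<Rightarrow> 'k \<Rightarrow> real"
    and u_star :: "'a \<Rightarrow> real \<Rightarrow> 'u"
  defines "\<A> \<equiv> controls (space M) F T U"
    and "J \<equiv> cost M T S X A \<phi> r l g"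
  assumes setting: "marked_point_process M T S X \<Delta> F A \<phi>"
    and C1: "hypothesis_C1 (space M) F T U r l g C\<^sub>r C\<^sub>l"
    and C2: "hypothesis_C2 M T S X F A \<phi> U r l"
    and p: "1 < p"
    and \<epsilon>: "0 < \<epsilon>"
    and C\<^sub>\<epsilon>: "C\<^sub>\<epsilon> = (1 - (1 / (1 + \<epsilon>)) powr (1 / (p - 1))) powr (1 - p)"
    and exp_A: "integrable M (\<lambda>\<omega>. exp (((2 * p - 1) / (p - 1) + (p - 1) * C\<^sub>r powr ((p / (p - 1))\<^sup>2)) * A \<omega> T))"
    and \<beta>: "1 + C\<^sub>\<epsilon> / (1 + \<epsilon>) + (p - 1) * ((C\<^sub>r + 1) powr p * (1 + \<epsilon>)) powr (1 / (p - 1)) < \<beta>"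
    and exp_\<beta>A: "integrable M (\<lambda>\<omega>. exp (\<beta> * A \<omega> T))"
    and g_X: "integrable M (\<lambda>\<omega>. \<bar>g \<omega> (pc_process S X \<omega> T)\<bar> powr p * exp (\<beta> * A \<omega> T))"
    and YZ_Lp: "(Y, Z) \<in> Lp_space M T F A \<phi> p \<beta>"
    and YZ_bsde: "bsde_solution M T S X F A \<phi> (hamiltonian U \<phi> r l) g Y Z"
    and u_star: "minimizing_control M T S X F A \<phi> U r l Z u_star"
  shows "(u_star \<in> \<A> \<and> (\<forall>u\<in>\<A>. J u_star \<le> J u)) \<and>
    (\<forall>\<omega>\<in>space M. Y \<omega> 0 = J u_star) \<and> J u_star = (INF u\<in>\<A>. J u)"
proof -
  interpret marked_point_process M T S X \<Delta> F A \<phi> by (rule setting)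
  have us: "u_star \<in> \<A>"
    using u_star by (simp add: minimizing_control_def \<A>_def)
  have \<beta>_pos: "0 < \<beta>"
  proof -
    have "0 \<le> C\<^sub>\<epsilon> / (1 + \<epsilon>)" using \<epsilon> by (simp add: C\<^sub>\<epsilon>)
    moreover have "0 \<le> (p - 1) * ((C\<^sub>r + 1) powr p * (1 + \<epsilon>)) powr (1 / (p - 1))" using p by simp
    ultimately show ?thesis using \<beta> by linarith
  qed
  obtain y where y: "\<And>\<omega>. \<omega> \<in> space M \<Longrightarrow> Y \<omega> 0 = y"
    using adapted_initial_const[of Y] YZ_bsde by (auto simp: bsde_solution_def)
  note ver = verification[OF C1 p \<beta>_pos exp_A g_X YZ_Lp YZ_bsde u_star y]
  have le: "y \<le> J u" if "u \<in> \<A>" for u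
    using ver(1) that by (simp add: \<A>_def J_def)
  have eq: "J u_star = y"
    using ver(2)[OF _ _ refl] us by (simp add: \<A>_def J_def)
  have "(INF u\<in>\<A>. J u) = J u_star"
  proof (rule antisym)
    show "(INF u\<in>\<A>. J u) \<le> J u_star"
      using us le by (intro cINF_lower bdd_belowI[where m=y]) auto
    show "J u_star \<le> (INF u\<in>\<A>. J u)"
      using us le eq by (intro cINF_greatest) auto
  qed
  then show ?thesis
    using us le eq y by auto
qed

end
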